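(* For all bipartitions $(\lambda,\mu)\vdash n$ and $(\alpha,\beta)\vdash n$, and for every signed composition $\gamma$ of $n$ obtained by arranging in some order the parts of $\alpha$ (unbarred) and the parts of $\beta$ (barred), $$\chi^{\lambda,\mu}(\alpha,\beta)=\sum_{Q\in\mathrm{SYT}(\lambda,\mu)}\mathrm{wt}_\gamma(\mathrm{sDes}(Q)).$$ In other words, $\mathrm{SYT}(\lambda,\mu)$ with the map $\mathrm{sDes}$ is a fine set for the irreducible character $\chi^{\lambda,\mu}$.
   Context: $B_n$ is the hyperoctahedral group. Its conjugacy classes are indexed by signed cycle types $(\alpha,\beta)\vdash n$ (viewing $w$ as a permutation of $\{1,\dots,n,\bar1,\dots,\bar n\}$, $\alpha$ lists lengths of positive cycles — pairs of disjoint cycles $c,\bar c$, length $|c|$ — and $\beta$ lengths of negative cycles $c=\bar c$, length $|c|/2$); $\chi(\alpha,\beta)$ is the value of a class function there. $\chi^{\lambda,\mu}$ is the irreducible character of $B_n$ indexed by the bipartition $(\lambda,\mu)$, normalized so that its Frobenius characteristic $\frac{1}{2^nn!}\sum_w\chi^{\lambda,\mu}(w)p^+_{\alpha(w)}p^-_{\beta(w)}$ equals $s_\lambda(x)s_\mu(y)$, where $p^\pm_k=\sum_i(x_i^k\pm y_i^k)$. A standard Young bitableau of shape $(\lambda,\mu)$ is a pair $Q=(Q^+,Q^-)$ of row- and column-strictly increasing fillings of shapes $\lambda,\mu$ using each element of $[n]$ once; $\mathrm{SYT}(\lambda,\mu)$ is their set. $\mathrm{sDes}(Q)=(S,\varepsilon)$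 where $S$ consists of $n$ and all $s\in[n-1]$ such that either $s,s+1$ are in the same tableau and $s+1$ is in a lower row than $s$, or $s,s+1$ are in different tableaux; $\varepsilon(s)=+$ if $s\in Q^+$ and $-$ otherwise. Its sign vector is $\tilde\varepsilon(j)=+$ iff $j\in Q^+$. For a signed composition $\gamma$ (composition of $n$ with some parts barred) with partial sums $0=r_0<r_1<\dots<r_k=n$, $S(\gamma)=\{r_1,\dots,r_k\}$, blocks $I_i=\{r_{i-1}+1,\dots,r_i\}$, and a pair $\sigma=(S,\varepsilon)$ ($n\in S\subseteq[n]$, $\varepsilon:S\to\{\pm\}$, sign vector $\tilde\varepsilon(j)=\varepsilon(\min\{s\in S:s\ge j\})$): $\mathrm{wt}_\gamma(\sigma)=0$ if for some $i$ the set $S\cap\{r_{i-1}+1,\dots,r_i-1\}$ is not an initial segment of $\{r_{i-1}+1,\dots,r_i-1\}$ or $\tilde\varepsilon$ is not constant on $I_i$; otherwise $\mathrm{wt}_\gamma(\sigma)=(-1)^{|S\setminus S(\gamma)|+n_\gamma(\sigma)}$, where $n_\gamma(\sigma)$ counts the $i$ with $\tilde\varepsilon=-$ on $I_i$ and the $i$-th part of $\gamma$ barred. *)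

theory Defs
  imports
    "Jordan_Normal_Form.VS_Connect"
    "HOL-Combinatorics.Orbits"
    "HOL-Library.Multiset"
    "HOL-Library.FuncSet"
begin

hide_const (open) Multiset.mult

text \<open>The barred letter of \<^term>\<open>i\<close> is \<^term>\<open>- i\<close>.\<close>

definition letters :: "nat \<Rightarrow> int set" where
  "letters n = {- int n..int n} - {0}"

definition hyperoct :: "nat \<Rightarrow> (int \<Rightarrow> int) monoid" where
  "hyperoct n = \<lparr>carrier = {w. w permutes letters n \<and> (\<forall>i. w (- i) = - w i)},
                 mult = (\<circ>), one = id\<rparr>"

lemma group_hyperoct: "group (hyperoct n)"
proof (rule groupI)
  fix v w assume "v \<in> carrier (hyperoct n)" "w \<in> carrier (hyperoct n)"
  then show "v \<otimes>\<^bsub>hyperoct n\<^esub> w \<in> carrier (hyperoct n)"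
    by (auto simp: hyperoct_def intro: permutes_compose)
next
  fix w assume w: "w \<in> carrier (hyperoct n)"
  then have p: "w permutes letters n" and s: "\<And>i. w (- i) = - w i"
    by (auto simp: hyperoct_def)
  have "Hilbert_Choice.inv w (- i) = - Hilbert_Choice.inv w i" for i
    by (metis p s permutes_inverses(1) permutes_inverses(2))
  with p have "Hilbert_Choice.inv w \<in> carrier (hyperoct n)"
    by (auto simp: hyperoct_def permutes_inv)
  moreover have "Hilbert_Choice.inv w \<otimes>\<^bsub>hyperoct n\<^esub> w = \<one>\<^bsub>hyperoct n\<^esub>"
    using permutes_inv_o(2)[OF p] by (simp add: hyperoct_def)
  ultimately show "\<exists>v\<in>carrier (hyperoct n). v \<otimes>\<^bsub>hyperoct n\<^esub> w = \<one>\<^bsub>hyperoct n\<^esub>"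
    by blast
qed (auto simp: hyperoct_def permutes_id)

definition cycles :: "nat \<Rightarrow> (int \<Rightarrow> int) \<Rightarrow> int set set" where
  "cycles n w = Orbits.orbit w ` letters n"

text \<open>A positive cycle is a pair \<open>{c, - c}\<close> of disjoint cycles, so its union has
  twice as many elements as \<open>c\<close>.\<close>

definition pos_cycle_type :: "nat \<Rightarrow> (int \<Rightarrow> int) \<Rightarrow> nat multiset" where
  "pos_cycle_type n w =
     image_mset (\<lambda>P. card (\<Union>P) div 2)
       (mset_set {{c, uminus ` c} |c. c \<in> cycles n w \<and> uminus ` c \<noteq> c})"

definition neg_cycle_type :: "nat \<Rightarrow> (int \<Rightarrow> int) \<Rightarrow> nat multiset" where
  "neg_cycle_type n w =
     image_mset (\<lambda>c. card c div 2) (mset_set {c \<in> cycles n w. uminus ` c = c})"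

abbreviation general_linear :: "nat \<Rightarrow> complex mat monoid" where
  "general_linear d \<equiv> units_of (ring_mat TYPE(complex) d ())"

definition irreducible_rep :: "('g, 'x) monoid_scheme \<Rightarrow> nat \<Rightarrow> ('g \<Rightarrow> complex mat) \<Rightarrow> bool" where
  "irreducible_rep G d \<rho> \<longleftrightarrow>
     \<rho> \<in> hom G (general_linear d) \<and> d > 0 \<and>
     (\<forall>W. VectorSpace.subspace class_ring W (module_vec TYPE(complex) d) \<and>
          (\<forall>g\<in>carrier G. \<forall>v\<in>W. \<rho> g *\<^sub>v v \<in> W)
        \<longrightarrow> W = {0\<^sub>v d} \<or> W = carrier_vec d)"

definition irreducible_character :: "('g, 'x) monoid_scheme \<Rightarrow> ('g \<Rightarrow> complex) \<Rightarrow> bool" where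
  "irreducible_character G \<chi> \<longleftrightarrow>
     (\<exists>d \<rho>. irreducible_rep G d \<rho> \<and> (\<forall>g\<in>carrier G. \<chi> g = sum_list (diag_mat (\<rho> g))))"

text \<open>A monomial is the finite multiset of its variables.\<close>

typedef ('v, 'a) mfps = "UNIV :: ('v multiset \<Rightarrow> 'a) set"
  morphisms mcoeff Abs_mfps ..

setup_lifting type_definition_mfps

lemma finite_submultisets [simp]: "finite {A. A \<subseteq># M}"
proof (induction M)
  case (add x M)
  have "{A. A \<subseteq># add_mset x M} \<subseteq> {A. A \<subseteq># M} \<union> add_mset x ` {A. A \<subseteq># M}"
  proof
    fix A assume A: "A \<in> {A. A \<subseteq># add_mset x M}"
    show "A \<in> {A. A \<subseteq># M} \<union> add_mset x ` {A. A \<subseteq># M}"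
    proof (cases "x \<in># A")
      case True
      then obtain B where "A = add_mset x B" by (meson multi_member_split)
      with A show ?thesis by auto
    next
      case False
      with A show ?thesis
        by (metis Un_iff diff_single_trivial mem_Collect_eq subset_eq_diff_conv
            add_mset_add_single)
    qed
  qed
  with add show ?case by (meson finite_UnI finite_imageI finite_subset)
qed simp

instantiation mfps :: (type, comm_ring_1) comm_ring_1
begin

lift_definition zero_mfps :: "('a, 'b) mfps" is "\<lambda>M. 0" .
lift_definition one_mfps :: "('a, 'b) mfps" is "\<lambda>M. if M = {#} then 1 else 0" .
lift_definition plus_mfps :: "('a, 'b) mfps \<Rightarrow> ('a, 'b) mfps \<Rightarrow> ('a, 'b) mfps"
  is "\<lambda>f g M. f M + g M" .
lift_definition minus_mfps :: "('a, 'b) mfps \<Rightarrow> ('a, 'b) mfps \<Rightarrow> ('a, 'b) mfps"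
  is "\<lambda>f g M. f M - g M" .
lift_definition uminus_mfps :: "('a, 'b) mfps \<Rightarrow> ('a, 'b) mfps"
  is "\<lambda>f M. - f M" .
lift_definition times_mfps :: "('a, 'b) mfps \<Rightarrow> ('a, 'b) mfps \<Rightarrow> ('a, 'b) mfps"
  is "\<lambda>f g M. \<Sum>A | A \<subseteq># M. f A * g (M - A)" .

instance
proof
  fix f g h :: "('a, 'b) mfps"
  have diff_diff: "M - (M - A) = A" if "A \<subseteq># M" for A M :: "'a multiset"
    using that by (auto simp: multiset_eq_iff subseteq_mset_def)
  have diff_diff': "M - B - (A - B) = M - A" if "B \<subseteq># A" for A B M :: "'a multiset"
    using that by (auto simp: multiset_eq_iff subseteq_mset_def)
  have sub1: "A - B \<subseteq># M - B" if "A \<subseteq># M" for A B M :: "'a multiset"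
    using that by (auto simp: subseteq_mset_def diff_le_mono)
  have sub2: "B + C \<subseteq># M" if "B \<subseteq># M" "C \<subseteq># M - B" for B C M :: "'a multiset"
    using that by (metis subset_mset.add_diff_inverse subset_mset.add_left_mono)
  show "f * g = g * f"
  proof (transfer, rule ext)
    fix f g :: "'a multiset \<Rightarrow> 'b" and M
    show "(\<Sum>A | A \<subseteq># M. f A * g (M - A)) = (\<Sum>A | A \<subseteq># M. g A * f (M - A))"
      by (rule sum.reindex_bij_witness[where i = "\<lambda>A. M - A" and j = "\<lambda>A. M - A"])
         (auto simp: mult.commute diff_diff)
  qed
  show "f * g * h = f * (g * h)"
  proof (transfer, rule ext)
    fix f g h :: "'a multiset \<Rightarrow> 'b" and M
    have "(\<Sum>A | A \<subseteq># M. (\<Sum>B | B \<subseteq># A. f B * g (A - B)) * h (M - A)) =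
          (\<Sum>(A, B)\<in>(SIGMA A:{A. A \<subseteq># M}. {B. B \<subseteq># A}). f B * g (A - B) * h (M - A))"
      by (simp add: sum_distrib_right sum.Sigma)
    also have "\<dots> = (\<Sum>(B, C)\<in>(SIGMA B:{B. B \<subseteq># M}. {C. C \<subseteq># M - B}).
                        f B * (g C * h (M - B - C)))"
      by (rule sum.reindex_bij_witness[where i = "\<lambda>(B, C). (B + C, B)" and
            j = "\<lambda>(A, B). (B, A - B)"])
         (auto simp: mult.assoc diff_diff' sub1 sub2 intro: subset_mset.order_trans)
    also have "\<dots> = (\<Sum>B | B \<subseteq># M. f B * (\<Sum>C | C \<subseteq># M - B. g C * h (M - B - C)))"
      by (simp add: sum_distrib_left sum.Sigma)
    finally show "(\<Sum>A | A \<subseteq># M. (\<Sum>B | B \<subseteq># A. f B * g (A - B)) * h (M - A)) =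
      (\<Sum>B | B \<subseteq># M. f B * (\<Sum>C | C \<subseteq># M - B. g C * h (M - B - C)))" .
  qed
  show "1 * f = f"
  proof (transfer, rule ext)
    fix f :: "'a multiset \<Rightarrow> 'b" and M
    have "(\<Sum>A | A \<subseteq># M. (if A = {#} then 1 else 0) * f (M - A)) =
          (\<Sum>A | A \<subseteq># M. if A = {#} then f M else 0)"
      by (rule sum.cong) auto
    then show "(\<Sum>A | A \<subseteq># M. (if A = {#} then 1 else 0) * f (M - A)) = f M"
      by (simp add: sum.delta)
  qed
  show "(f + g) * h = f * h + g * h"
    by transfer (simp add: distrib_right sum.distrib)
  show "(0 :: ('a, 'b) mfps) \<noteq> 1"
    by transfer (metis zero_neq_one)
qed (transfer; simp add: fun_eq_iff algebra_simps)+

end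

definition mconst :: "'a::zero \<Rightarrow> ('v, 'a) mfps" where
  "mconst c = Abs_mfps (\<lambda>M. if M = {#} then c else 0)"

definition is_partition :: "nat list \<Rightarrow> bool" where
  "is_partition l \<longleftrightarrow> sorted_wrt (\<ge>) l \<and> 0 \<notin> set l"

definition is_bipartition :: "nat \<Rightarrow> nat list \<Rightarrow> nat list \<Rightarrow> bool" where
  "is_bipartition n l m \<longleftrightarrow>
     is_partition l \<and> is_partition m \<and> sum_list l + sum_list m = n"

text \<open>English convention: cell \<open>(r, c)\<close> is in row \<open>r\<close>, and lower rows have larger \<open>r\<close>.\<close>

definition diagram :: "nat list \<Rightarrow> (nat \<times> nat) set" where
  "diagram l = {(r, c). r < length l \<and> c < l ! r}"

definition col_strict :: "nat list \<Rightarrow> (nat \<times> nat \<Rightarrow> nat) \<Rightarrow> bool" where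
  "col_strict l T \<longleftrightarrow>
     (\<forall>r r' c. r < r' \<and> (r, c) \<in> diagram l \<and> (r', c) \<in> diagram l \<longrightarrow> T (r, c) < T (r', c))"

definition row_strict :: "nat list \<Rightarrow> (nat \<times> nat \<Rightarrow> nat) \<Rightarrow> bool" where
  "row_strict l T \<longleftrightarrow>
     (\<forall>r c c'. c < c' \<and> (r, c) \<in> diagram l \<and> (r, c') \<in> diagram l \<longrightarrow> T (r, c) < T (r, c'))"

definition row_weak :: "nat list \<Rightarrow> (nat \<times> nat \<Rightarrow> nat) \<Rightarrow> bool" where
  "row_weak l T \<longleftrightarrow>
     (\<forall>r c c'. c < c' \<and> (r, c) \<in> diagram l \<and> (r, c') \<in> diagram l \<longrightarrow> T (r, c) \<le> T (r, c'))"

definition SSYT :: "nat list \<Rightarrow> (nat \<times> nat \<Rightarrow> nat) set" where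
  "SSYT l = {T \<in> extensional (diagram l). row_weak l T \<and> col_strict l T}"

text \<open>The Schur function in the variables \<open>v 0, v 1, \<dots>\<close>.\<close>

definition schur :: "(nat \<Rightarrow> 'v) \<Rightarrow> nat list \<Rightarrow> ('v, complex) mfps" where
  "schur v l = Abs_mfps (\<lambda>M. of_nat (card
     {T \<in> SSYT l. image_mset (\<lambda>b. v (T b)) (mset_set (diagram l)) = M}))"

text \<open>The variables \<open>x\<^sub>i\<close> and \<open>y\<^sub>i\<close> are \<^term>\<open>Inl i\<close> and \<^term>\<open>Inr i\<close>.  The series
  \<open>power_sum s k\<close> is \<open>\<Sum>\<^sub>i (x\<^sub>i\<^sup>k + s y\<^sub>i\<^sup>k)\<close> for \<open>k \<ge> 1\<close>; \<open>s = 1\<close> gives \<open>p\<^sup>+\<close>, \<open>s = -1\<close>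
  gives \<open>p\<^sup>-\<close>.\<close>

definition power_sum :: "complex \<Rightarrow> nat \<Rightarrow> (nat + nat, complex) mfps" where
  "power_sum s k = Abs_mfps (\<lambda>M.
     if \<exists>i. M = replicate_mset k (Inl i) then 1
     else if \<exists>i. M = replicate_mset k (Inr i) then s else 0)"

definition frob_char :: "nat \<Rightarrow> ((int \<Rightarrow> int) \<Rightarrow> complex) \<Rightarrow> (nat + nat, complex) mfps" where
  "frob_char n \<chi> = mconst (1 / (2 ^ n * fact n)) *
     (\<Sum>w\<in>carrier (hyperoct n). mconst (\<chi> w) *
        (\<Prod>k\<in>#pos_cycle_type n w. power_sum 1 k) *
        (\<Prod>k\<in>#neg_cycle_type n w. power_sum (-1) k))"

datatype sign = Plus | Minus

type_synonym filling = "nat \<times> nat \<Rightarrow> nat"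

definition SYT2 :: "nat \<Rightarrow> nat list \<Rightarrow> nat list \<Rightarrow> (filling \<times> filling) set" where
  "SYT2 n l m = {(P, N).
     P \<in> extensional (diagram l) \<and> N \<in> extensional (diagram m) \<and>
     inj_on P (diagram l) \<and> inj_on N (diagram m) \<and>
     P ` diagram l \<inter> N ` diagram m = {} \<and> P ` diagram l \<union> N ` diagram m = {1..n} \<and>
     row_strict l P \<and> col_strict l P \<and> row_strict m N \<and> col_strict m N}"

definition next_lower :: "nat list \<Rightarrow> filling \<Rightarrow> nat \<Rightarrow> bool" where
  "next_lower l T s \<longleftrightarrow>
     (\<exists>r c r' c'. (r, c) \<in> diagram l \<and> (r', c') \<in> diagram l \<and>
        T (r, c) = s \<and> T (r', c') = s + 1 \<and> r < r')"

definition sDes :: "nat \<Rightarrow> nat list \<Rightarrow> nat list \<Rightarrow> filling \<times> filling \<Rightarrow> nat set \<times> (nat \<Rightarrow> sign)" where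
  "sDes n l m = (\<lambda>(P, N).
     let S = {n} \<union> {s \<in> {1..n - 1}.
               next_lower l P s \<or> next_lower m N s \<or>
               (s \<in> P ` diagram l \<and> s + 1 \<in> N ` diagram m) \<or>
               (s \<in> N ` diagram m \<and> s + 1 \<in> P ` diagram l)}
     in (S, \<lambda>s\<in>S. if s \<in> P ` diagram l then Plus else Minus))"

text \<open>A signed composition is a list of pairs of a part and a flag telling whether it is barred.\<close>

type_synonym signed_comp = "(nat \<times> bool) list"

definition psum :: "signed_comp \<Rightarrow> nat \<Rightarrow> nat" where
  "psum \<gamma> i = sum_list (map fst (take i \<gamma>))"

definition sign_vector :: "nat set \<times> (nat \<Rightarrow> sign) \<Rightarrow> nat \<Rightarrow> sign" where
  "sign_vector = (\<lambda>(S, \<epsilon>) j. \<epsilon> (LEAST s. s \<in> S \<and> s \<ge> j))"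

definition initial_segment :: "nat set \<Rightarrow> nat set \<Rightarrow> bool" where
  "initial_segment A B \<longleftrightarrow> A \<subseteq> B \<and> (\<forall>a\<in>A. \<forall>b\<in>B. b < a \<longrightarrow> b \<in> A)"

text \<open>Parts are numbered from 0: the block of part \<open>i\<close> is \<open>{psum \<gamma> i<..psum \<gamma> (Suc i)}\<close>.\<close>

definition wt :: "signed_comp \<Rightarrow> nat set \<times> (nat \<Rightarrow> sign) \<Rightarrow> int" where
  "wt \<gamma> \<sigma> =
    (if \<exists>i<length \<gamma>.
          \<not> initial_segment (fst \<sigma> \<inter> {psum \<gamma> i<..<psum \<gamma> (Suc i)}) {psum \<gamma> i<..<psum \<gamma> (Suc i)} \<or>
          \<not> (\<exists>e. \<forall>j\<in>{psum \<gamma> i<..psum \<gamma> (Suc i)}. sign_vector \<sigma> j = e)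
     then 0
     else (-1) ^ (card (fst \<sigma> - psum \<gamma> ` {1..length \<gamma>}) +
                  card {i. i < length \<gamma> \<and> snd (\<gamma> ! i) \<and>
                         (\<forall>j\<in>{psum \<gamma> i<..psum \<gamma> (Suc i)}. sign_vector \<sigma> j = Minus)}))"

end

theory Submission
  imports Defs "HOL-Combinatorics.Cycles"
begin

text \<open>
  From \<open>p\<^sub>k = \<Sum>\<^sub>d (-1)\<^bsup>l(d)-1\<^esup> last(d) h\<^sub>d\<close>, the sum over all compositions \<open>d\<close> of \<open>k\<close>, one obtains for
  every signed composition \<open>\<gamma>\<close> a linear functional on series, a signed sum of monomial
  coefficients over the refinements of \<open>\<gamma>\<close>, which plays the role of the scalar product with
  \<open>p\<^sub>\<gamma>\<close>.  Evaluated at a product of power sums it vanishes unless the types agree, in which case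
  it gives the centralizer order, so at the Frobenius characteristic of \<open>\<chi>\<close> it gives
  \<open>\<chi>(\<alpha>, \<beta>)\<close>.  Evaluated at \<open>s\<^sub>\<lambda>(x) s\<^sub>\<mu>(y)\<close>, standardization turns monomial
  coefficients into numbers of bitableaux with prescribed descents, and the alternating sum over
  refinements collapses to \<open>wt\<^sub>\<gamma>\<close>.  No orthogonality of Schur functions is needed.
\<close>

subsection \<open>The functional attached to a signed composition\<close>

text \<open>The weight by the last part is what produces initial segments: the coefficients of all
  compositions whose cuts contain a given set sum to zero unless that set is an initial segment.
  Weighting by the first part would give final segments. Two alphabets enter through p^+_k = p_k(x)
  + p_k(y) and p^-_k = p_k(x) - p_k(y): every part of \<gamma> also chooses an alphabet, and on the
  tableau side this choice becomes the requirement that signs be constant on a block. Vanishing on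
  products of the wrong type is a derivation argument. Removing one power sum from the product
  lowers one exponent; if that exponent lies in the refinement of some part of \<gamma>, all terms
  cancel unless the part equals the removed one, which is then deleted with a factor 2k. The parts
  of \<gamma> are never permuted, and the j-th entry of a refinement is always the exponent of x_j
  or y_j. The character side sees only the multiset of parts and the tableau side sees their order,
  which is why every arrangement gives the same value.\<close>

definition comps :: "nat \<Rightarrow> nat list set" where
  "comps k = {d. sum_list d = k \<and> 0 \<notin> set d}"

text \<open>At \<open>[]\<close> this involves the unspecified \<open>last []\<close>; that list
  lies only in \<open>comps 0\<close>, and parts are positive wherever the value matters.\<close>

definition comp_weight :: "nat list \<Rightarrow> complex" where
  "comp_weight d = (-1) ^ (length d - 1) * of_nat (last d)"

lemma comps_0 [simp]: "comps 0 = {[]}"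
  by (auto simp: comps_def) (metis list.set_intros(1) neq_Nil_conv sum_list_eq_0_iff)

lemma length_le_sum_list: "0 \<notin> set d \<Longrightarrow> length d \<le> sum_list (d :: nat list)"
  by (induction d) auto

lemma finite_comps [simp]: "finite (comps k)"
proof (rule finite_subset)
  show "comps k \<subseteq> {d. set d \<subseteq> {..k} \<and> length d \<le> k}"
    using length_le_sum_list by (auto simp: comps_def member_le_sum_list)
qed (simp add: finite_lists_length_le)

text \<open>Adding \<open>c\<close> to a part of \<open>d\<close> cancels against inserting \<open>c\<close> as a new part: this makes the
  functional vanish on products of several power sums.\<close>

lemma comp_weight_cancel:
  assumes "d \<noteq> []"
  shows "(\<Sum>j<length d. comp_weight (d[j := d ! j + c])) +
         (\<Sum>j\<le>length d. comp_weight (take j d @ c # drop j d)) = 0"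
proof -
  obtain xs y where d: "d = xs @ [y]" using assms rev_exhaust by blast
  \<comment> \<open>The weight sees only the length and the last part. Changing the last part, or
    inserting behind it, is therefore split off; every other change preserves the last part, and an
    insertion flips the sign.\<close>
  have "(\<Sum>j<length d. comp_weight (d[j := d ! j + c])) =
      (\<Sum>j<length xs. (-1) ^ length xs * of_nat y) + (-1) ^ length xs * of_nat (y + c)"
    unfolding d by (simp add: comp_weight_def list_update_append nth_append)
  moreover have "(\<Sum>j\<le>length d. comp_weight (take j d @ c # drop j d)) =
      (\<Sum>j\<le>length xs. (-1) ^ Suc (length xs) * of_nat y) + (-1) ^ Suc (length xs) * of_nat c"
    unfolding d by (simp add: comp_weight_def)
  ultimately show ?thesis by (simp add: algebra_simps)
qed

lemma sum_list_update_add: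
  "j < length (d :: nat list) \<Longrightarrow> sum_list (d[j := d ! j + c]) = sum_list d + c"
  by (simp add: sum_list_update elem_le_sum_list)

lemma sum_list_update_diff:
  assumes "j < length (d :: nat list)" "c \<le> d ! j"
  shows "sum_list (d[j := d ! j - c]) = sum_list d - c"
  using assms elem_le_sum_list[of j d] by (simp add: sum_list_update)

lemma sum_sum_Sigma:
  assumes "finite D" "\<And>d. d \<in> D \<Longrightarrow> finite (A d)" "\<And>d. d \<in> D \<Longrightarrow> finite (B d)"
  shows "(\<Sum>d\<in>D. (\<Sum>j\<in>A d. f d j) + (\<Sum>j\<in>B d. f d j)) =
    (\<Sum>(d,j)\<in>Sigma D A. f d j) + (\<Sum>(d,j)\<in>Sigma D B. f d j)"
  using assms by (simp add: sum.distrib sum.Sigma)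

text \<open>The skewing operator adjoint to multiplication by p_c sends p_k to c if k = c and to 0
  otherwise. Collect the terms by the resulting composition of \<open>k - c\<close>: it arises by
  shrinking a part or by losing a part equal to \<open>c\<close>, and
  \<open>comp_weight_cancel\<close> kills every nonempty result.\<close>

lemma sum_comps_diff:
  assumes F0: "\<And>xs ys. F (xs @ 0 # ys) = F (xs @ ys)" and c: "0 < c"
  shows "(\<Sum>d\<in>comps k. comp_weight d *
            (\<Sum>j<length d. if c \<le> d ! j then F (d[j := d ! j - c]) else 0)) =
         (if k = c then of_nat c * F [] else (0 :: complex))"
proof (cases "c \<le> k")
  case False
  have "\<not> c \<le> d ! j" if "d \<in> comps k" "j < length d" for d j
    using that False elem_le_sum_list[of j d] by (auto simp: comps_def)
  then have "(\<Sum>d\<in>comps k. comp_weight d *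
            (\<Sum>j<length d. if c \<le> d ! j then F (d[j := d ! j - c]) else 0)) = 0"
    by (intro sum.neutral) (auto intro!: sum.neutral)
  with False show ?thesis by auto
next
  case True
  define m where "m = k - c"
  have k: "k = m + c" using True m_def by simp
  let ?f = "\<lambda>d j. comp_weight d * F (d[j := d ! j - c])"
  have "(\<Sum>d\<in>comps k. comp_weight d *
            (\<Sum>j<length d. if c \<le> d ! j then F (d[j := d ! j - c]) else 0)) =
        (\<Sum>d\<in>comps k. (\<Sum>j | j < length d \<and> c \<le> d ! j. ?f d j))"
    by (rule sum.cong) (auto simp: sum_distrib_left sum.If_cases lessThan_def Collect_conj_eq)
  \<comment> \<open>A part equal to \<open>c\<close> becomes 0, which is not allowed in a
    composition; \<open>F0\<close> turns this case into the deletion of the part.\<close>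
  also have "\<dots> = (\<Sum>d\<in>comps k. (\<Sum>j | j < length d \<and> c < d ! j. ?f d j) +
                                (\<Sum>j | j < length d \<and> c = d ! j. ?f d j))"
    by (rule sum.cong, simp, subst sum.union_disjoint[symmetric])
       (auto intro!: sum.cong)
  also have "\<dots> = (\<Sum>(d,j)\<in>(SIGMA d:comps k. {j. j < length d \<and> c < d ! j}). ?f d j) +
                  (\<Sum>(d,j)\<in>(SIGMA d:comps k. {j. j < length d \<and> c = d ! j}). ?f d j)"
    by (rule sum_sum_Sigma) auto
  also have "(\<Sum>(d,j)\<in>(SIGMA d:comps k. {j. j < length d \<and> c < d ! j}). ?f d j) =
      (\<Sum>(d,j)\<in>(SIGMA d:comps m. {..<length d}). comp_weight (d[j := d ! j + c]) * F d)"
    by (rule sum.reindex_bij_witness[where i = "\<lambda>(d,j). (d[j := d ! j + c], j)" and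
          j = "\<lambda>(d,j). (d[j := d ! j - c], j)"])
       (auto simp: comps_def k sum_list_update_add sum_list_update_diff c
          dest!: set_update_subset_insert[THEN subsetD] intro!: gr0I, (metis nth_mem)+)
  also have "(\<Sum>(d,j)\<in>(SIGMA d:comps k. {j. j < length d \<and> c = d ! j}). ?f d j) =
      (\<Sum>(d,j)\<in>(SIGMA d:comps m. {..length d}). comp_weight (take j d @ c # drop j d) * F d)"
  proof (rule sum.reindex_bij_witness[where i = "\<lambda>(d,j). (take j d @ c # drop j d, j)" and
          j = "\<lambda>(d,j). (take j d @ drop (Suc j) d, j)"], goal_cases)
    case (1 a)
    then obtain d j where a: "a = (d, j)" "j < length d" "d ! j = c" by auto
    then show ?case by (auto simp: min_def id_take_nth_drop[symmetric])
  next
    case (2 a)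
    then obtain d j where a: "a = (d, j)" "j < length d" "d ! j = c" "d \<in> comps k" by auto
    define xs ys where "xs = take j d" and "ys = drop (Suc j) d"
    have d: "d = xs @ c # ys" using id_take_nth_drop[OF a(2)] a(3) xs_def ys_def by simp
    have "length xs = j" using a xs_def by simp
    then show ?case using a(4) unfolding a(1) by (auto simp: d comps_def k)
  next
    case (3 b)
    then show ?case by (auto simp: min_def)
  next
    case (4 b)
    then obtain d j where b: "b = (d, j)" "j \<le> length d" "d \<in> comps m" by auto
    define xs ys where "xs = take j d" and "ys = drop j d"
    have d: "d = xs @ ys" using xs_def ys_def by simp
    have "length xs = j" using b xs_def by simp
    then show ?case using b(3) c unfolding b(1) by (auto simp: d comps_def k)
  next
    case (5 a)
    then obtain d j where a: "a = (d, j)" "j < length d" "d ! j = c" by auto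
    define xs ys where "xs = take j d" and "ys = drop (Suc j) d"
    have d: "d = xs @ c # ys" using id_take_nth_drop[OF a(2)] a(3) xs_def ys_def by simp
    have "length xs = j" using a xs_def by simp
    then show ?case unfolding a(1) d by (auto simp: list_update_append nth_append F0)
  qed
  also have "(\<Sum>(d,j)\<in>(SIGMA d:comps m. {..<length d}). comp_weight (d[j := d ! j + c]) * F d) +
      (\<Sum>(d,j)\<in>(SIGMA d:comps m. {..length d}). comp_weight (take j d @ c # drop j d) * F d) =
      (\<Sum>d\<in>comps m. ((\<Sum>j<length d. comp_weight (d[j := d ! j + c])) +
         (\<Sum>j\<le>length d. comp_weight (take j d @ c # drop j d))) * F d)"
    by (simp add: sum.Sigma[symmetric] sum_distrib_right sum.distrib distrib_right)
  \<comment> \<open>For \<open>[]\<close> there is no part to enlarge, and the single insertion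
    gives \<open>[c]\<close>, of weight \<open>c\<close>.\<close>
  also have "\<dots> = (\<Sum>d\<in>comps m. if d = [] then of_nat c * F [] else 0)"
    by (rule sum.cong) (auto simp: comp_weight_cancel, simp add: comp_weight_def)
  also have "\<dots> = (if k = c then of_nat c * F [] else 0)"
    by (cases "m = 0") (auto simp: k, auto simp: comps_def intro!: sum.neutral)
  finally show ?thesis .
qed

section \<open>Two alphabets: the functional for signed compositions\<close>

definition bar_sign :: "bool \<Rightarrow> sign \<Rightarrow> complex" where
  "bar_sign b e = (if b \<and> e = Minus then -1 else 1)"

lemma UNIV_sign: "(UNIV :: sign set) = {Plus, Minus}"
  using sign.exhaust by auto

instance sign :: finite
  by standard (simp add: UNIV_sign)

text \<open>Orthogonality of the two characters of a group of order 2. It separates barred from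
  unbarred parts and is the origin of the 2 in the factor 2k.\<close>

lemma sum_bar_sign: "(\<Sum>e\<in>UNIV. bar_sign b e * bar_sign b' e) = (if b = b' then 2 else 0)"
  by (auto simp: UNIV_sign bar_sign_def)

text \<open>Each p^+_k or p^-_k is expanded over the alphabet \<open>e\<close> and the composition
  \<open>d\<close>; pairing with a product of complete functions reads off a monomial coefficient,
  here a value of \<open>F\<close>. The accumulator keeps the exponents already chosen, in the order
  of the parts.\<close>

fun refine_sum :: "signed_comp \<Rightarrow> (nat \<times> sign) list \<Rightarrow> ((nat \<times> sign) list \<Rightarrow> complex) \<Rightarrow> complex"
where
  "refine_sum [] acc F = F acc"
| "refine_sum ((k, b) # \<gamma>) acc F = (\<Sum>e\<in>UNIV. bar_sign b e *
     (\<Sum>d\<in>comps k. comp_weight d * refine_sum \<gamma> (acc @ map (\<lambda>x. (x, e)) d) F))"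

lemma sum_swap3:
  fixes b :: "'e \<Rightarrow> 'a :: comm_ring_1"
  shows "(\<Sum>e\<in>E. b e * (\<Sum>d\<in>D. w d * (\<Sum>j\<in>J. if P j then q j * R e d j else 0))) =
     (\<Sum>j\<in>J. if P j then q j * (\<Sum>e\<in>E. b e * (\<Sum>d\<in>D. w d * R e d j)) else 0)"
proof -
  have "(\<Sum>e\<in>E. b e * (\<Sum>d\<in>D. w d * (\<Sum>j\<in>J. if P j then q j * R e d j else 0))) =
     (\<Sum>e\<in>E. \<Sum>d\<in>D. \<Sum>j\<in>J. if P j then q j * (b e * (w d * R e d j)) else 0)"
    by (auto simp: sum_distrib_left mult_ac intro!: sum.cong)
  also have "\<dots> = (\<Sum>e\<in>E. \<Sum>j\<in>J. \<Sum>d\<in>D. if P j then q j * (b e * (w d * R e d j)) else 0)"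
    by (intro sum.cong sum.swap refl)
  also have "\<dots> = (\<Sum>j\<in>J. \<Sum>e\<in>E. \<Sum>d\<in>D. if P j then q j * (b e * (w d * R e d j)) else 0)"
    by (rule sum.swap)
  also have "\<dots> = (\<Sum>j\<in>J. if P j then q j * (\<Sum>e\<in>E. b e * (\<Sum>d\<in>D. w d * R e d j)) else 0)"
    by (intro sum.cong) (auto simp: sum_distrib_left)
  finally show ?thesis .
qed

lemma refine_sum_sum:
  "refine_sum \<gamma> acc (\<lambda>ds. \<Sum>x\<in>X. c x * F x ds) = (\<Sum>x\<in>X. c x * refine_sum \<gamma> acc (F x))"
proof (induction \<gamma> arbitrary: acc)
  case (Cons g \<gamma>)
  then show ?case
    using sum_swap3[where P = "\<lambda>_. True"] by (cases g) simp
qed simp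

text \<open>The coefficient of a product of power sums with parts \<open>cs\<close> at the monomial whose \<open>j\<close>-th
  variable has sign and exponent \<open>ds ! j\<close>; exponents may be zero.\<close>

fun assign :: "signed_comp \<Rightarrow> (nat \<times> sign) list \<Rightarrow> complex" where
  "assign [] ds = (if \<forall>x\<in>set ds. fst x = 0 then 1 else 0)"
| "assign ((k, b) # cs) ds = (\<Sum>j<length ds. if k \<le> fst (ds ! j)
     then bar_sign b (snd (ds ! j)) * assign cs (ds[j := (fst (ds ! j) - k, snd (ds ! j))]) else 0)"

lemma sum_lessThan_add:
  fixes p q :: nat
  shows "(\<Sum>j<p + q. f j) = (\<Sum>j<p. f j) + (\<Sum>j<q. f (p + j) :: 'a :: comm_monoid_add)"
  by (induction q) (auto simp: add.assoc)

lemma sum_lessThan_insert: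
  "(\<Sum>j<Suc (p + q). f j) = (\<Sum>j<p. f j) + f p + (\<Sum>j<q. f (Suc (p + j)) :: 'a :: comm_monoid_add)"
  using sum_lessThan_add[of f p "Suc q"]
  by (simp only: sum.lessThan_Suc_shift add_Suc_right add_0_right add.assoc)

text \<open>A positive part never fits into the exponent 0, so that position adds no summand. This
  provides the hypothesis \<open>F0\<close> of \<open>sum_comps_diff\<close>.\<close>

lemma assign_zero:
  assumes "\<forall>x\<in>set cs. 0 < fst x"
  shows "assign cs (xs @ (0, e) # ys) = assign cs (xs @ ys)"
  using assms
proof (induction cs arbitrary: xs ys)
  case (Cons c cs)
  obtain k b where c: "c = (k, b)" by force
  have k: "k > 0" using Cons.prems c by simp
  have IH: "assign cs (xs @ (0, e) # ys) = assign cs (xs @ ys)" for xs ys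
    using Cons by simp
  show ?case
    unfolding c using k
    by (simp only: assign.simps length_append length_Cons add_Suc_right
        sum_lessThan_insert sum_lessThan_add)
       (simp add: nth_append list_update_append IH cong: if_cong)
qed simp

lemma refine_sum_zero:
  assumes "\<forall>x\<in>set cs. 0 < fst x"
  shows "refine_sum \<gamma> (xs @ (0, e) # ys) (assign cs) = refine_sum \<gamma> (xs @ ys) (assign cs)"
proof (induction \<gamma> arbitrary: ys)
  case (Cons g \<gamma>)
  then show ?case by (cases g) simp
qed (simp add: assign_zero assms)

text \<open>The derivation rule: the factor (k, b) is taken either from an exponent already fixed in
  \<open>acc\<close> or from the refinement of a part of \<gamma>. In the second case only parts
  equal to (k, b) survive. The general \<open>acc\<close> is there for the induction; with
  \<open>acc = []\<close> only the second sum remains.\<close>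

lemma refine_sum_assign_Cons:
  assumes cs: "\<forall>x\<in>set cs. 0 < fst x" and k: "0 < k"
  shows "refine_sum \<gamma> acc (assign ((k, b) # cs)) =
    (\<Sum>j<length acc. if k \<le> fst (acc ! j) then bar_sign b (snd (acc ! j)) *
        refine_sum \<gamma> (acc[j := (fst (acc ! j) - k, snd (acc ! j))]) (assign cs) else 0) +
    (\<Sum>i<length \<gamma>. if \<gamma> ! i = (k, b)
        then 2 * of_nat k * refine_sum (take i \<gamma> @ drop (Suc i) \<gamma>) acc (assign cs) else 0)"
proof (induction \<gamma> arbitrary: acc)
  case (Cons g \<gamma>)
  obtain l c where g: "g = (l, c)" by force
  let ?s = "\<lambda>e d. map (\<lambda>x. (x, e)) d :: (nat \<times> sign) list"
  let ?R = "\<lambda>\<gamma> acc. refine_sum \<gamma> acc (assign cs)"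
  let ?upd = "\<lambda>acc j. acc[j := (fst (acc ! j) - k, snd (acc ! j))] :: (nat \<times> sign) list"
  let ?A = "\<lambda>acc e d. \<Sum>j<length acc. if k \<le> fst (acc ! j) then bar_sign b (snd (acc ! j)) *
        ?R \<gamma> (?upd acc j @ ?s e d) else 0"
  let ?B = "\<lambda>e d. \<Sum>j<length d. if k \<le> d ! j then bar_sign b e *
        ?R \<gamma> (acc @ ?s e (d[j := d ! j - k])) else 0"
  let ?C = "\<lambda>acc. \<Sum>i<length \<gamma>. if \<gamma> ! i = (k, b)
        then 2 * of_nat k * ?R (take i \<gamma> @ drop (Suc i) \<gamma>) acc else 0"
  \<comment> \<open>The induction hypothesis for the longer accumulator sums over its positions: old
    ones (\<open>?A\<close>), those of the block just refined (\<open>?B\<close>), and then over the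
    later parts (\<open>?C\<close>). Only \<open>?B\<close> needs an argument.\<close>
  have split: "refine_sum \<gamma> (acc @ ?s e d) (assign ((k, b) # cs)) =
      ?A acc e d + ?B e d + ?C (acc @ ?s e d)" for e d
    by (subst Cons.IH)
       (simp add: sum_lessThan_add nth_append list_update_append map_update cong: if_cong)
  have "refine_sum (g # \<gamma>) acc (assign ((k, b) # cs)) =
     (\<Sum>e\<in>UNIV. bar_sign c e * (\<Sum>d\<in>comps l. comp_weight d * ?A acc e d)) +
     (\<Sum>e\<in>UNIV. bar_sign c e * (\<Sum>d\<in>comps l. comp_weight d * ?B e d)) +
     (\<Sum>e\<in>UNIV. bar_sign c e * (\<Sum>d\<in>comps l. comp_weight d * ?C (acc @ ?s e d)))"
    unfolding g refine_sum.simps split by (simp only: distrib_left sum.distrib)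
  also have "(\<Sum>e\<in>UNIV. bar_sign c e * (\<Sum>d\<in>comps l. comp_weight d * ?A acc e d)) =
     (\<Sum>j<length acc. if k \<le> fst (acc ! j) then bar_sign b (snd (acc ! j)) *
        ?R (g # \<gamma>) (?upd acc j) else 0)"
    unfolding g refine_sum.simps append_Cons by (rule sum_swap3)
  \<comment> \<open>\<open>sum_comps_diff\<close> forces equal lengths; \<open>sum_bar_sign\<close>
    afterwards forces equal bars.\<close>
  also have "(\<Sum>e\<in>UNIV. bar_sign c e * (\<Sum>d\<in>comps l. comp_weight d * ?B e d)) =
     (\<Sum>e\<in>UNIV. bar_sign c e * (if l = k then of_nat k * (bar_sign b e * ?R \<gamma> acc) else 0))"
  proof (intro sum.cong refl arg_cong[where f = "(*) (bar_sign c e)" for e])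
    fix e
    have "?R \<gamma> (acc @ ?s e (xs @ 0 # ys)) = ?R \<gamma> (acc @ ?s e (xs @ ys))" for xs ys
      using refine_sum_zero[OF cs, of \<gamma> "acc @ ?s e xs" e "?s e ys"] by simp
    then show "(\<Sum>d\<in>comps l. comp_weight d * ?B e d) =
        (if l = k then of_nat k * (bar_sign b e * ?R \<gamma> acc) else 0)"
      using sum_comps_diff[of "\<lambda>d. bar_sign b e * ?R \<gamma> (acc @ ?s e d)" k l] k by simp
  qed
  also have "\<dots> = (\<Sum>e\<in>UNIV. bar_sign c e * bar_sign b e) * (if l = k then of_nat k * ?R \<gamma> acc else 0)"
    by (simp add: sum_distrib_right mult_ac)
  also have "\<dots> = (if g = (k, b) then 2 * of_nat k * ?R \<gamma> acc else 0)"
    by (simp add: sum_bar_sign g)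
  also have "(\<Sum>e\<in>UNIV. bar_sign c e * (\<Sum>d\<in>comps l. comp_weight d * ?C (acc @ ?s e d))) =
     (\<Sum>i<length \<gamma>. if \<gamma> ! i = (k, b)
        then 2 * of_nat k * ?R (g # take i \<gamma> @ drop (Suc i) \<gamma>) acc else 0)"
    unfolding g refine_sum.simps append_Cons by (rule sum_swap3)
  finally show ?case
    by (simp only: length_Cons sum.lessThan_Suc_shift nth_Cons_0 nth_Cons_Suc take_Suc_Cons
        drop_Suc_Cons append_Cons take0 drop0 append_Nil add.assoc)
qed (simp cong: if_cong)

text \<open>The order of the centralizer in the hyperoctahedral group. A signed cycle of length k
  contributes 2k in both cases: k powers and the exchange of c with its negative for a positive
  cycle, the 2k powers of a negative one.\<close>

definition centralizer_size :: "(nat \<times> bool) multiset \<Rightarrow> nat" where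
  "centralizer_size M = (\<Prod>c\<in>#M. 2 * fst c) * (\<Prod>c\<in>set_mset M. fact (count M c))"

lemma centralizer_size_empty [simp]: "centralizer_size {#} = 1"
  by (simp add: centralizer_size_def)

lemma centralizer_size_add:
  "centralizer_size (add_mset c M) = 2 * fst c * Suc (count M c) * centralizer_size M"
proof -
  have "(\<Prod>x\<in>set_mset (add_mset c M). fact (count (add_mset c M) x)) =
        Suc (count M c) * (\<Prod>x\<in>set_mset M. fact (count M x) :: nat)"
  proof -
    have "(\<Prod>x\<in>set_mset (add_mset c M). fact (count (add_mset c M) x)) =
       fact (Suc (count M c)) * (\<Prod>x\<in>set_mset M - {c}. fact (count M x) :: nat)"
      by (auto simp: prod.insert_remove intro!: prod.cong split: if_splits)
    moreover have "(\<Prod>x\<in>set_mset M. fact (count M x) :: nat) =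
        fact (count M c) * (\<Prod>x\<in>set_mset M - {c}. fact (count M x))"
      by (cases "c \<in># M") (auto simp: prod.remove not_in_iff)
    ultimately show ?thesis by (simp add: algebra_simps)
  qed
  then show ?thesis by (simp add: centralizer_size_def algebra_simps)
qed

lemma refine_sum_assign_Nil:
  assumes "\<forall>x\<in>set \<gamma>. 0 < fst x" "\<exists>x\<in>set acc. 0 < fst x"
  shows "refine_sum \<gamma> acc (assign []) = 0"
  using assms
proof (induction \<gamma> arbitrary: acc)
  case (Cons g \<gamma>)
  have "refine_sum \<gamma> (acc @ xs) (assign []) = 0" for xs
    by (rule Cons.IH) (use Cons.prems in auto)
  then show ?case by (cases g) (simp del: assign.simps)
qed auto

text \<open>Orthogonality of power sum products, obtained by stripping one factor at a time with
  \<open>refine_sum_assign_Cons\<close>.\<close>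

lemma refine_sum_assign:
  assumes "\<forall>x\<in>set cs. 0 < fst x" "\<forall>x\<in>set \<gamma>. 0 < fst x"
  shows "refine_sum \<gamma> [] (assign cs) =
    (if mset \<gamma> = mset cs then of_nat (centralizer_size (mset cs)) else 0)"
  using assms
proof (induction cs arbitrary: \<gamma>)
  case Nil
  show ?case
  proof (cases \<gamma>)
    case (Cons g \<gamma>')
    obtain k b where g: "g = (k, b)" by force
    have "refine_sum \<gamma>' (map (\<lambda>x. (x, e)) d) (assign []) = 0" if "d \<in> comps k" for d e
    proof (rule refine_sum_assign_Nil)
      have "d \<noteq> []" using that Nil.prems Cons g by (auto simp: comps_def)
      then show "\<exists>x\<in>set (map (\<lambda>x. (x, e)) d). 0 < fst x"
        using that by (cases d) (auto simp: comps_def)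
    qed (use Nil.prems Cons in auto)
    then show ?thesis by (simp add: Cons g del: assign.simps)
  qed simp
next
  case (Cons c cs)
  obtain k b where c: "c = (k, b)" by force
  have mset_del: "mset (take i \<gamma> @ drop (Suc i) \<gamma>) = mset \<gamma> - {#c#}"
    if "i < length \<gamma>" "\<gamma> ! i = c" for i
  proof -
    have "mset \<gamma> = mset (take i \<gamma> @ c # drop (Suc i) \<gamma>)"
      using id_take_nth_drop[OF that(1)] that(2) by simp
    then show ?thesis by simp
  qed
  have "refine_sum \<gamma> [] (assign (c # cs)) = (\<Sum>i<length \<gamma>. if \<gamma> ! i = c
        then 2 * of_nat k * refine_sum (take i \<gamma> @ drop (Suc i) \<gamma>) [] (assign cs) else 0)"
    unfolding c by (subst refine_sum_assign_Cons) (use Cons.prems c in auto)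
  also have "\<dots> = (\<Sum>i<length \<gamma>. if \<gamma> ! i = c then 2 * of_nat k *
        (if mset \<gamma> - {#c#} = mset cs then of_nat (centralizer_size (mset cs)) else 0) else 0)"
  proof (rule sum.cong, simp, rule if_cong, simp)
    fix i assume i: "i \<in> {..<length \<gamma>}" "\<gamma> ! i = c"
    have "refine_sum (take i \<gamma> @ drop (Suc i) \<gamma>) [] (assign cs) =
      (if mset (take i \<gamma> @ drop (Suc i) \<gamma>) = mset cs then of_nat (centralizer_size (mset cs)) else 0)"
      by (rule Cons.IH) (use Cons.prems in \<open>auto dest: in_set_takeD in_set_dropD\<close>)
    also have "mset (take i \<gamma> @ drop (Suc i) \<gamma>) = mset \<gamma> - {#c#}"
      by (rule mset_del) (use i in auto)
    finally show "2 * of_nat k * refine_sum (take i \<gamma> @ drop (Suc i) \<gamma>) [] (assign cs) = 2 * of_nat k *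
        (if mset \<gamma> - {#c#} = mset cs then of_nat (centralizer_size (mset cs)) else 0)" by simp
  qed simp
  \<comment> \<open>Deleting any of the equal occurrences of \<open>c\<close> leaves the same
    multiset; their number supplies one factor of the factorial in
    \<open>centralizer_size\<close>.\<close>
  also have "\<dots> = of_nat (card {i. i < length \<gamma> \<and> \<gamma> ! i = c}) * (2 * of_nat k *
        (if mset \<gamma> - {#c#} = mset cs then of_nat (centralizer_size (mset cs)) else 0))"
    by (simp add: sum.If_cases lessThan_def Collect_conj_eq)
  also have "card {i. i < length \<gamma> \<and> \<gamma> ! i = c} = count (mset \<gamma>) c"
    by (simp add: count_mset count_list_eq_length_filter length_filter_conv_card eq_commute)
  also have "of_nat (count (mset \<gamma>) c) * (2 * of_nat k *
        (if mset \<gamma> - {#c#} = mset cs then of_nat (centralizer_size (mset cs)) else 0)) =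
      (if mset \<gamma> = mset (c # cs) then of_nat (centralizer_size (mset (c # cs))) else (0::complex))"
  proof (cases "c \<in># mset \<gamma>")
    case True
    then have "mset \<gamma> - {#c#} = mset cs \<longleftrightarrow> mset \<gamma> = mset (c # cs)"
      by (metis add_mset_remove_trivial insert_DiffM mset.simps(2))
    then show ?thesis by (auto simp: centralizer_size_add c algebra_simps)
  next
    case False
    then show ?thesis
      by (metis (no_types, lifting) count_eq_zero_iff list.set_intros(1) mult_zero_left of_nat_0 set_mset_mset)
  qed
  finally show ?case .
qed

subsection \<open>Centralizers in the hyperoctahedral group\<close>

text \<open>No \<open>n\<close> occurs here: the counting induction shrinks the set of letters while
  the permutation stays the same.\<close>

definition odd_perm :: "(int \<Rightarrow> int) \<Rightarrow> bool" where
  "odd_perm v \<longleftrightarrow> permutation v \<and> (\<forall>x. v (- x) = - v x)"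

text \<open>The support of a signed cycle. For a negative cycle the two sets coincide, for a
  positive one they are disjoint; for \<open>a \<noteq> 0\<close> the union has twice the signed
  length in both cases, so \<open>stype\<close> needs no case distinction.\<close>

definition sblock :: "(int \<Rightarrow> int) \<Rightarrow> int \<Rightarrow> int set" where
  "sblock v a = Orbits.orbit v a \<union> uminus ` Orbits.orbit v a"

text \<open>The second component tells whether the signed cycle through \<open>a\<close> is negative.\<close>

definition stype :: "(int \<Rightarrow> int) \<Rightarrow> int \<Rightarrow> nat \<times> bool" where
  "stype v a = (card (sblock v a) div 2, - a \<in> Orbits.orbit v a)"

lemma odd_perm_funpow_minus: "odd_perm v \<Longrightarrow> (v ^^ i) (- a) = - (v ^^ i) a"
  by (induction i) (auto simp: odd_perm_def)

lemma odd_perm_inj: "odd_perm v \<Longrightarrow> inj (v ^^ i)"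
  by (simp add: odd_perm_def permutation bij_is_inj inj_fn)

lemma in_orbit_iff: "odd_perm v \<Longrightarrow> x \<in> Orbits.orbit v a \<longleftrightarrow> (\<exists>i. x = (v ^^ i) a)"
  by (auto simp: odd_perm_def orbit_altdef_permutation)

lemma in_sblock_iff:
  "odd_perm v \<Longrightarrow> x \<in> sblock v a \<longleftrightarrow> (\<exists>i. x = (v ^^ i) a \<or> x = - (v ^^ i) a)"
  by (auto simp: sblock_def in_orbit_iff image_iff)

lemma sblockE:
  assumes "odd_perm v" "x \<in> sblock v a"
  obtains i where "x = (v ^^ i) a \<or> x = - (v ^^ i) a"
  using assms in_sblock_iff by blast

lemma sblockI: "odd_perm v \<Longrightarrow> (v ^^ i) a \<in> sblock v a" "odd_perm v \<Longrightarrow> - (v ^^ i) a \<in> sblock v a"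
  using in_sblock_iff by blast+

lemma orbit_eq: "odd_perm v \<Longrightarrow> b \<in> Orbits.orbit v a \<Longrightarrow> Orbits.orbit v b = Orbits.orbit v a"
  by (intro orbit_cyclic_eq3 cyclic_on_orbit') (simp add: odd_perm_def)

lemma orbit_minus: "odd_perm v \<Longrightarrow> Orbits.orbit v (- a) = uminus ` Orbits.orbit v a"
proof -
  assume v: "odd_perm v"
  have "x \<in> Orbits.orbit v (- a) \<longleftrightarrow> - x \<in> Orbits.orbit v a" for x
    unfolding in_orbit_iff[OF v] odd_perm_funpow_minus[OF v] by (metis minus_minus)
  moreover have "x \<in> uminus ` Orbits.orbit v a \<longleftrightarrow> - x \<in> Orbits.orbit v a" for x
    by (metis image_iff minus_minus)
  ultimately show ?thesis by blast
qed

lemma self_in_orbit: "odd_perm v \<Longrightarrow> a \<in> Orbits.orbit v a"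
  by (simp add: odd_perm_def permutation_self_in_orbit)

lemma self_in_sblock: "odd_perm v \<Longrightarrow> a \<in> sblock v a"
  by (simp add: sblock_def self_in_orbit)

lemma sblock_eq: "odd_perm v \<Longrightarrow> b \<in> sblock v a \<Longrightarrow> sblock v b = sblock v a"
proof -
  assume v: "odd_perm v" and b: "b \<in> sblock v a"
  then consider "b \<in> Orbits.orbit v a" | "b \<in> Orbits.orbit v (- a)"
    by (auto simp: sblock_def orbit_minus)
  then show ?thesis
    by cases (auto simp: sblock_def v orbit_eq orbit_minus[symmetric])
qed

lemma sblock_disjoint: "odd_perm v \<Longrightarrow> sblock v a \<noteq> sblock v b \<Longrightarrow> sblock v a \<inter> sblock v b = {}"
  using sblock_eq by blast

lemma finite_orbit': "odd_perm v \<Longrightarrow> finite (Orbits.orbit v a)"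
  using self_in_orbit finite_orbit by metis

lemma finite_sblock: "odd_perm v \<Longrightarrow> finite (sblock v a)"
  by (simp add: sblock_def finite_orbit')

lemma uminus_sblock: "odd_perm v \<Longrightarrow> x \<in> sblock v a \<Longrightarrow> - x \<in> sblock v a"
  by (auto simp: sblock_def)

lemma apply_sblock: "odd_perm v \<Longrightarrow> x \<in> sblock v a \<Longrightarrow> v x \<in> sblock v a"
  unfolding in_sblock_iff
  by (metis funpow.simps(2) o_apply odd_perm_def)

lemma card_orbit: "odd_perm v \<Longrightarrow> card (Orbits.orbit v a) = least_power v a"
proof -
  assume v: "odd_perm v"
  then have p: "permutation v" by (simp add: odd_perm_def)
  have "Orbits.orbit v a = set (support v a)"
    using support_set[OF p] orbit_altdef_permutation[OF p] by (auto simp: image_iff)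
  then show ?thesis
    using cycle_of_permutation[OF p, of a] distinct_card by fastforce
qed

lemma orbit_neg_iff:
  assumes v: "odd_perm v"
  shows "- a \<in> Orbits.orbit v a \<longleftrightarrow> uminus ` Orbits.orbit v a = Orbits.orbit v a"
  using orbit_minus[OF v] orbit_eq[OF v] self_in_orbit[OF v] by metis

lemma orbit_pos_disjoint:
  assumes v: "odd_perm v" and "- a \<notin> Orbits.orbit v a"
  shows "Orbits.orbit v a \<inter> uminus ` Orbits.orbit v a = {}"
  using assms orbit_minus[OF v] orbit_eq[OF v] self_in_orbit[OF v] by (metis disjoint_iff)

lemma card_uminus_image: "card (uminus ` (A :: int set)) = card A"
  by (simp add: card_image)

lemma funpow_mult_dvd:
  assumes "permutation v" "least_power v a dvd m"
  shows "(v ^^ m) a = a"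
  using assms by (simp add: least_power_dvd)

lemma stype_pos:
  assumes v: "odd_perm v" and "stype v a = (k, False)"
  shows "least_power v a = k" "card (sblock v a) = 2 * k"
proof -
  have n: "- a \<notin> Orbits.orbit v a" using assms by (simp add: stype_def)
  have "card (sblock v a) = 2 * card (Orbits.orbit v a)"
    unfolding sblock_def using orbit_pos_disjoint[OF v n] finite_orbit'[OF v]
    by (simp add: card_Un_disjoint card_uminus_image)
  then show "least_power v a = k" "card (sblock v a) = 2 * k"
    using assms(2) card_orbit[OF v] by (auto simp: stype_def)
qed

text \<open>If \<open>j\<close> steps, fewer than the period, lead from \<open>a\<close> to
  \<open>- a\<close>, then \<open>2 * j\<close> steps lead back. So the period divides
  \<open>2 * j\<close>, which is positive and less than twice the period, hence equal to it.\<close>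

lemma stype_neg:
  assumes v: "odd_perm v" and a: "a \<noteq> 0" and t: "stype v a = (k, True)"
  shows "least_power v a = 2 * k" "card (sblock v a) = 2 * k" "(v ^^ k) a = - a"
proof -
  have p: "permutation v" using v by (simp add: odd_perm_def)
  have n: "- a \<in> Orbits.orbit v a" using t by (simp add: stype_def)
  then have s: "sblock v a = Orbits.orbit v a"
    using orbit_neg_iff[OF v] by (auto simp: sblock_def)
  then have k: "k = least_power v a div 2" using t card_orbit[OF v] by (simp add: stype_def)
  obtain j0 where j0: "(v ^^ j0) a = - a" using n in_orbit_iff[OF v] by metis
  define p0 where "p0 = least_power v a"
  \<comment> \<open>The reduction makes \<open>j\<close> smaller than the period; \<open>j\<close>
    is nonzero because \<open>a\<close> differs from \<open>- a\<close>.\<close>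
  define j where "j = j0 mod p0"
  have pos: "p0 > 0" using least_power_of_permutation[OF p] p0_def by simp
  have "(v ^^ j) a = (v ^^ j) ((v ^^ (j0 - j)) a)"
    using funpow_mult_dvd[OF p, of a "j0 - j"] by (simp add: j_def p0_def dvd_minus_mod)
  also have "\<dots> = - a"
    using j0 by (metis funpow_add j_def le_add_diff_inverse mod_less_eq_dividend o_apply)
  finally have j: "(v ^^ j) a = - a" .
  then have "(v ^^ (j + j)) a = a"
    using odd_perm_funpow_minus[OF v] by (simp add: funpow_add)
  then have d: "p0 dvd j + j" using least_power_dvd[OF p] p0_def by blast
  have j0: "j \<noteq> 0" using j a by (intro notI) simp
  have jp: "j < p0" using pos j_def by simp
  obtain q where q: "j + j = p0 * q" using d by (rule dvdE)
  have "q \<noteq> 0" using q j0 by (cases "q = 0") simp_all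
  moreover have "\<not> 2 \<le> q"
  proof
    assume "2 \<le> q"
    then have "p0 * 2 \<le> p0 * q" by (rule mult_le_mono2)
    then show False using q jp by linarith
  qed
  ultimately have "q = 1" by simp
  then have "j + j = p0" using q by simp
  then have "k = (j + j) div 2" using k p0_def by simp
  then have "j = k" by simp
  then have "p0 = 2 * k" using \<open>j + j = p0\<close> by simp
  then show "least_power v a = 2 * k" "card (sblock v a) = 2 * k" "(v ^^ k) a = - a"
    using \<open>j = k\<close> j p0_def s card_orbit[OF v] by auto
qed

lemma card_sblock:
  assumes "odd_perm v" "a \<noteq> 0"
  shows "card (sblock v a) = 2 * fst (stype v a)"
proof -
  obtain k b where "stype v a = (k, b)" by force
  then show ?thesis using stype_pos(2) stype_neg(2) assms by (cases b) auto
qed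

lemma funpow_self_iff:
  assumes "odd_perm v" "a \<noteq> 0" "stype v a = (k, b)"
  shows "(v ^^ m) a = a \<longleftrightarrow> (if b then 2 * k else k) dvd m"
  using assms stype_pos(1) stype_neg(1) least_power_dvd[of v a m]
  by (auto simp: odd_perm_def split: if_splits)

lemma funpow_neg_iff:
  assumes v: "odd_perm v" and a: "a \<noteq> 0" and t: "stype v a = (k, b)"
  shows "(v ^^ m) a = - a \<longleftrightarrow> b \<and> k dvd m \<and> \<not> 2 * k dvd m"
proof
  assume m: "(v ^^ m) a = - a"
  then have "- a \<in> Orbits.orbit v a" using in_orbit_iff[OF v] by metis
  then have b: b using t by (simp add: stype_def)
  have "(v ^^ (m + m)) a = a"
    using m odd_perm_funpow_minus[OF v] by (simp add: funpow_add)
  then have "2 * k dvd m + m" using funpow_self_iff[OF v a t] b by simp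
  then have "k dvd m" by (simp flip: mult_2)
  moreover have "(v ^^ m) a \<noteq> a" using m a by simp
  ultimately show "b \<and> k dvd m \<and> \<not> 2 * k dvd m" using b funpow_self_iff[OF v a t] by simp
next
  assume m: "b \<and> k dvd m \<and> \<not> 2 * k dvd m"
  then obtain q where q: "m = k * q" by auto
  have "odd q" using m q by auto
  then obtain r where "q = 2 * r + 1" by (rule oddE)
  then have "m = k + 2 * k * r" using q by (simp add: algebra_simps)
  moreover have "(v ^^ (2 * k * r)) a = a" using funpow_self_iff[OF v a t] m by simp
  ultimately show "(v ^^ m) a = - a"
    using stype_neg(3)[OF v a] t m by (simp add: funpow_add)
qed

lemma funpow_eq_iff:
  assumes v: "odd_perm v" and "j \<le> i"
  shows "(v ^^ i) a = (v ^^ j) b \<longleftrightarrow> (v ^^ (i - j)) a = b"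
proof -
  have "(v ^^ i) a = (v ^^ j) ((v ^^ (i - j)) a)"
    using assms(2) by (metis funpow_add le_add_diff_inverse o_apply)
  then show ?thesis using odd_perm_inj[OF v] by (metis injD)
qed

text \<open>Which of the letters \<open>(v ^^ i) a\<close> and their negatives coincide depends only
  on \<open>stype v a\<close>. This makes the assignment of \<open>(w ^^ i) b\<close> to
  \<open>(v ^^ i) a\<close> well defined and injective.\<close>

lemma funpow_transfer:
  assumes v: "odd_perm v" and w: "odd_perm w" and a: "a \<noteq> 0" and b: "b \<noteq> 0"
    and t: "stype v a = stype w b"
  shows "(v ^^ i) a = (v ^^ j) a \<longleftrightarrow> (w ^^ i) b = (w ^^ j) b"
    and "(v ^^ i) a = - (v ^^ j) a \<longleftrightarrow> (w ^^ i) b = - (w ^^ j) b"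
proof -
  obtain k s where k: "stype v a = (k, s)" by force
  note 1 = funpow_self_iff[OF v a k] funpow_self_iff[OF w b k[unfolded t]]
    funpow_neg_iff[OF v a k] funpow_neg_iff[OF w b k[unfolded t]]
  have A: "(v ^^ i) a = (v ^^ j) a \<longleftrightarrow> (w ^^ i) b = (w ^^ j) b" if "j \<le> i" for i j
    using 1 by (simp add: funpow_eq_iff[OF v that] funpow_eq_iff[OF w that])
  have B: "(v ^^ i) a = - (v ^^ j) a \<longleftrightarrow> (w ^^ i) b = - (w ^^ j) b" if "j \<le> i" for i j
    using 1 by (simp add: funpow_eq_iff[OF v that] funpow_eq_iff[OF w that]
        odd_perm_funpow_minus[OF v, symmetric] odd_perm_funpow_minus[OF w, symmetric])
  show "(v ^^ i) a = (v ^^ j) a \<longleftrightarrow> (w ^^ i) b = (w ^^ j) b"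
    using A[of i j] A[of j i] by (metis nle_le)
  show "(v ^^ i) a = - (v ^^ j) a \<longleftrightarrow> (w ^^ i) b = - (w ^^ j) b"
    using B[of i j] B[of j i] by (metis nle_le minus_minus)
qed

text \<open>Extensionality makes this a set that can be counted by values on \<open>X\<close> alone,
  and allows restriction to the complement of a block.\<close>

definition equivariant :: "(int \<Rightarrow> int) \<Rightarrow> (int \<Rightarrow> int) \<Rightarrow> int set \<Rightarrow> int set \<Rightarrow> (int \<Rightarrow> int) set" where
  "equivariant v w X Y = {g \<in> extensional X. bij_betw g X Y \<and>
     (\<forall>x\<in>X. g (v x) = w (g x) \<and> g (- x) = - g x)}"

lemma ex_equivariant_sblock:
  assumes v: "odd_perm v" and w: "odd_perm w" and a: "a \<noteq> 0" and b: "b \<noteq> 0"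
    and t: "stype v a = stype w b"
  shows "\<exists>h. h a = b \<and> bij_betw h (sblock v a) (sblock w b) \<and>
    (\<forall>x\<in>sblock v a. h (v x) = w (h x) \<and> h (- x) = - h x)"
proof -
  \<comment> \<open>The chosen exponents are immaterial by \<open>funpow_transfer\<close>. A letter
    of a negative cycle is both a power image of \<open>a\<close> and the negative of one; the first
    form is preferred, and \<open>tr(2)\<close> shows that both give the same value.\<close>
  define h where "h x = (if \<exists>i. x = (v ^^ i) a then (w ^^ (SOME i. x = (v ^^ i) a)) b
     else - (w ^^ (SOME i. x = - (v ^^ i) a)) b)" for x
  note tr = funpow_transfer[OF v w a b t]
  have h1: "h ((v ^^ i) a) = (w ^^ i) b" for i
  proof -
    have "(v ^^ i) a = (v ^^ (SOME j. (v ^^ i) a = (v ^^ j) a)) a"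
      by (rule someI) simp
    then show ?thesis unfolding h_def using tr(1) by auto
  qed
  have h2: "h (- (v ^^ i) a) = - (w ^^ i) b" for i
  proof (cases "\<exists>j. - (v ^^ i) a = (v ^^ j) a")
    case True
    then obtain j where j: "- (v ^^ i) a = (v ^^ j) a" by auto
    then have "(w ^^ j) b = - (w ^^ i) b" using tr(2)[of j i] by simp
    then show ?thesis using h1[of j] j by simp
  next
    case False
    have "- (v ^^ i) a = - (v ^^ (SOME j. - (v ^^ i) a = - (v ^^ j) a)) a"
      by (rule someI[where P = "\<lambda>j. - (v ^^ i) a = - (v ^^ j) a"]) simp
    then have "(w ^^ i) b = (w ^^ (SOME j. - (v ^^ i) a = - (v ^^ j) a)) b"
      using tr(1) by (metis minus_minus)
    then show ?thesis unfolding h_def using False by auto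
  qed
  have ha: "h a = b" using h1[of 0] by simp
  have hx: "h (v x) = w (h x)" "h (- x) = - h x" if x: "x \<in> sblock v a" for x
  proof -
    obtain i where i: "x = (v ^^ i) a \<or> x = - (v ^^ i) a" using x by (rule sblockE[OF v])
    have "v (- (v ^^ i) a) = - v ((v ^^ i) a)" "w (- (w ^^ i) b) = - w ((w ^^ i) b)"
      using v w by (auto simp: odd_perm_def)
    moreover have "h (v ((v ^^ i) a)) = w ((w ^^ i) b)" "h (- v ((v ^^ i) a)) = - w ((w ^^ i) b)"
      using h1[of "Suc i"] h2[of "Suc i"] by auto
    ultimately show "h (v x) = w (h x)" "h (- x) = - h x"
      using i h1[of i] h2[of i] by (elim disjE; simp)+
  qed
  have hbij: "bij_betw h (sblock v a) (sblock w b)"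
    unfolding bij_betw_def
  proof
    show "inj_on h (sblock v a)"
    proof (rule inj_onI)
      fix x y assume x: "x \<in> sblock v a" and y: "y \<in> sblock v a" and e: "h x = h y"
      obtain i where i: "x = (v ^^ i) a \<or> x = - (v ^^ i) a" using x by (rule sblockE[OF v])
      obtain j where j: "y = (v ^^ j) a \<or> y = - (v ^^ j) a" using y by (rule sblockE[OF v])
      show "x = y"
        using i j e h1[of i] h2[of i] h1[of j] h2[of j] tr(1)[of i j] tr(2)[of i j] tr(2)[of j i]
        by (metis minus_minus)
    qed
    show "h ` sblock v a = sblock w b"
    proof
      show "h ` sblock v a \<subseteq> sblock w b"
        using h1 h2 sblockI[OF w] by (auto elim!: sblockE[OF v])
      show "sblock w b \<subseteq> h ` sblock v a"
      proof
        fix y assume "y \<in> sblock w b"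
        then obtain i where "y = (w ^^ i) b \<or> y = - (w ^^ i) b" by (rule sblockE[OF w])
        then have "y = h ((v ^^ i) a) \<or> y = h (- (v ^^ i) a)" using h1 h2 by simp
        then show "y \<in> h ` sblock v a" using sblockI[OF v] by blast
      qed
    qed
  qed
  show ?thesis by (intro exI[of _ h] conjI ballI ha hx hbij)
qed

section \<open>Counting odd equivariant bijections block by block\<close>

definition block_closed :: "(int \<Rightarrow> int) \<Rightarrow> int set \<Rightarrow> bool" where
  "block_closed v X \<longleftrightarrow> finite X \<and> 0 \<notin> X \<and> (\<forall>x\<in>X. sblock v x \<subseteq> X)"

definition block_types :: "(int \<Rightarrow> int) \<Rightarrow> int set \<Rightarrow> (nat \<times> bool) multiset" where
  "block_types v X = image_mset (\<lambda>B. stype v (SOME x. x \<in> B)) (mset_set (sblock v ` X))"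

lemma stype_eq:
  assumes v: "odd_perm v" and b: "b \<in> sblock v a"
  shows "stype v b = stype v a"
proof -
  have "- b \<in> Orbits.orbit v b \<longleftrightarrow> - a \<in> Orbits.orbit v a"
  proof -
    have "b \<in> Orbits.orbit v a \<or> b \<in> Orbits.orbit v (- a)"
      using b orbit_minus[OF v, of a] by (simp add: sblock_def)
    then show ?thesis
    proof
      assume "b \<in> Orbits.orbit v a"
      then have "Orbits.orbit v b = Orbits.orbit v a" by (rule orbit_eq[OF v])
      then show ?thesis unfolding orbit_neg_iff[OF v] by (simp only:)
    next
      assume "b \<in> Orbits.orbit v (- a)"
      then have "Orbits.orbit v b = uminus ` Orbits.orbit v a"
        by (simp only: orbit_eq[OF v] orbit_minus[OF v, symmetric])
      moreover have "uminus ` uminus ` Orbits.orbit v a = Orbits.orbit v a" by (simp add: image_image)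
      ultimately show ?thesis unfolding orbit_neg_iff[OF v] by metis
    qed
  qed
  then show ?thesis using sblock_eq[OF v b] by (simp add: stype_def)
qed

lemma stype_some: "odd_perm v \<Longrightarrow> stype v (SOME x. x \<in> sblock v a) = stype v a"
  by (metis self_in_sblock someI stype_eq)

lemma block_closed_diff:
  assumes v: "odd_perm v" and "block_closed v X"
  shows "block_closed v (X - sblock v a)"
  unfolding block_closed_def
proof (intro conjI ballI subsetI)
  fix x y assume x: "x \<in> X - sblock v a" and y: "y \<in> sblock v x"
  have "y \<in> X" using assms(2) x y unfolding block_closed_def by blast
  moreover have "y \<notin> sblock v a"
  proof
    assume "y \<in> sblock v a"
    then have "sblock v x = sblock v a" using sblock_eq[OF v y] sblock_eq[OF v] by simp
    then show False using x self_in_sblock[OF v, of x] by simp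
  qed
  ultimately show "y \<in> X - sblock v a" by simp
qed (use assms(2) in \<open>simp_all add: block_closed_def\<close>)

lemma block_types_remove:
  assumes v: "odd_perm v" and X: "block_closed v X" and a: "a \<in> X"
  shows "block_types v X = add_mset (stype v a) (block_types v (X - sblock v a))"
proof -
  define Bs where "Bs = sblock v ` (X - sblock v a)"
  have e: "sblock v ` X = insert (sblock v a) Bs"
    unfolding Bs_def using a sblock_eq[OF v, of _ a] by auto
  have "sblock v a \<notin> Bs" unfolding Bs_def using self_in_sblock[OF v] by blast
  moreover have "finite Bs" unfolding Bs_def using X by (simp add: block_closed_def)
  ultimately have "mset_set (insert (sblock v a) Bs) = add_mset (sblock v a) (mset_set Bs)"
    by (rule mset_set.insert[rotated])
  then show ?thesis
    unfolding block_types_def e Bs_def[symmetric] image_mset_add_mset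
    by (simp only: image_mset_add_mset stype_some[OF v])
qed

lemma card_filter_count:
  assumes "finite A"
  shows "card {x \<in> A. f x = t} = count (image_mset f (mset_set A)) t"
  using assms
proof (induction A rule: finite_induct)
  case (insert x A)
  have "{y \<in> insert x A. f y = t} = (if f x = t then insert x {y \<in> A. f y = t} else {y \<in> A. f y = t})"
    by auto
  then show ?case using insert by simp
qed simp

text \<open>Blocks of one type are disjoint and equally large. In \<open>card_equivariant\<close>
  this counts the possible images of a chosen letter.\<close>

lemma card_stype:
  assumes v: "odd_perm v" and X: "block_closed v X"
  shows "card {b \<in> X. stype v b = t} = count (block_types v X) t * (2 * fst t)"
proof -
  let ?Bs = "{B \<in> sblock v ` X. stype v (SOME x. x \<in> B) = t}"
  have fin: "finite X" and sub: "\<And>x. x \<in> X \<Longrightarrow> sblock v x \<subseteq> X" and nz: "0 \<notin> X"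
    using X unfolding block_closed_def by blast+
  have "{b \<in> X. stype v b = t} = \<Union> ?Bs"
  proof (intro equalityI subsetI)
    fix b assume "b \<in> {b \<in> X. stype v b = t}"
    then show "b \<in> \<Union> ?Bs" using self_in_sblock[OF v, of b] stype_some[OF v, of b] by auto
  next
    fix b assume "b \<in> \<Union> ?Bs"
    then obtain a where "a \<in> X" "b \<in> sblock v a" "stype v a = t" using stype_some[OF v] by auto
    then show "b \<in> {b \<in> X. stype v b = t}" using sub stype_eq[OF v] by blast
  qed
  also have "card \<dots> = (\<Sum>B\<in>?Bs. card B)"
  proof (rule card_Union_disjoint)
    show "pairwise disjnt ?Bs"
      using sblock_disjoint[OF v] by (auto simp: pairwise_def disjnt_def)
  qed (auto simp: finite_sblock v)
  also have "\<dots> = (\<Sum>B\<in>?Bs. 2 * fst t)"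
  proof (intro sum.cong refl)
    fix B assume "B \<in> ?Bs"
    then obtain a where "a \<in> X" "B = sblock v a" "stype v a = t" using stype_some[OF v] by auto
    then show "card B = 2 * fst t" using card_sblock[OF v, of a] nz by metis
  qed
  also have "\<dots> = card ?Bs * (2 * fst t)" by simp
  also have "card ?Bs = count (block_types v X) t"
    unfolding block_types_def using fin by (intro card_filter_count) simp
  finally show ?thesis .
qed

lemma equivariant_funpow:
  assumes v: "odd_perm v" and g: "g \<in> equivariant v w X Y" and X: "block_closed v X" and a: "a \<in> X"
  shows "g ((v ^^ i) a) = (w ^^ i) (g a)" "g (- (v ^^ i) a) = - (w ^^ i) (g a)"
proof -
  have X': "(v ^^ i) a \<in> X" for i
    using X a sblockI[OF v] unfolding block_closed_def by blast
  show 1: "g ((v ^^ i) a) = (w ^^ i) (g a)"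
  proof (induction i)
    case (Suc i)
    then show ?case using X'[of i] g by (simp add: equivariant_def)
  qed simp
  show "g (- (v ^^ i) a) = - (w ^^ i) (g a)"
    using X'[of i] g 1 by (simp add: equivariant_def)
qed

lemma equivariant_sblock:
  assumes v: "odd_perm v" and w: "odd_perm w" and g: "g \<in> equivariant v w X Y"
    and X: "block_closed v X" and a: "a \<in> X"
  shows "g ` sblock v a = sblock w (g a)" "stype w (g a) = stype v a"
proof -
  note f = equivariant_funpow[OF v g X a]
  show im: "g ` sblock v a = sblock w (g a)"
  proof (intro equalityI subsetI)
    fix y assume "y \<in> g ` sblock v a"
    then show "y \<in> sblock w (g a)" using f sblockI[OF w] by (auto elim!: sblockE[OF v])
  next
    fix y assume "y \<in> sblock w (g a)"
    then obtain i where "y = (w ^^ i) (g a) \<or> y = - (w ^^ i) (g a)" by (rule sblockE[OF w])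
    then have "y = g ((v ^^ i) a) \<or> y = g (- (v ^^ i) a)" using f by simp
    then show "y \<in> g ` sblock v a" using sblockI[OF v] by blast
  qed
  have inj: "inj_on g X" using g by (simp add: equivariant_def bij_betw_def)
  have sub: "sblock v a \<subseteq> X" using X a by (simp add: block_closed_def)
  have "card (sblock w (g a)) = card (sblock v a)"
    unfolding im[symmetric] using inj sub by (meson card_image inj_on_subset)
  moreover have "- g a \<in> Orbits.orbit w (g a) \<longleftrightarrow> - a \<in> Orbits.orbit v a"
  proof -
    have "- g a = (w ^^ i) (g a) \<longleftrightarrow> - a = (v ^^ i) a" for i
    proof -
      have "- a \<in> X" "(v ^^ i) a \<in> X"
        using sub uminus_sblock[OF v self_in_sblock[OF v]] sblockI[OF v] by blast+
      moreover have "g (- a) = - g a" using f(2)[of 0] by simp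
      ultimately show ?thesis using f(1)[of i] inj by (metis inj_on_eq_iff)
    qed
    then show ?thesis by (simp add: in_orbit_iff v w)
  qed
  ultimately show "stype w (g a) = stype v a" by (simp add: stype_def)
qed

text \<open>The image of \<open>a\<close> determines an equivariant map on the whole block of
  \<open>a\<close>, and the remaining letters are mapped independently, so restriction to the
  complement is a bijection.\<close>

lemma card_equivariant_fixed:
  assumes v: "odd_perm v" and w: "odd_perm w" and X: "block_closed v X" and Y: "block_closed w Y"
    and a: "a \<in> X" and b: "b \<in> Y" and t: "stype w b = stype v a"
  shows "card {g \<in> equivariant v w X Y. g a = b} =
    card (equivariant v w (X - sblock v a) (Y - sblock w b))"
proof (rule bij_betw_same_card)
  let ?A = "sblock v a" and ?B = "sblock w b"
  have A: "?A \<subseteq> X" and B: "?B \<subseteq> Y" and a0: "a \<noteq> 0" and b0: "b \<noteq> 0"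
    using X Y a b unfolding block_closed_def by blast+
  have XA: "v x \<in> X - ?A" "- x \<in> X - ?A" if "x \<in> X - ?A" for x
  proof -
    have "sblock v x \<subseteq> X - ?A"
      using block_closed_diff[OF v X, of a] that unfolding block_closed_def by (elim conjE bspec)
    then show "v x \<in> X - ?A" "- x \<in> X - ?A"
      using apply_sblock[OF v self_in_sblock[OF v, of x]]
        uminus_sblock[OF v self_in_sblock[OF v, of x]] by (auto simp only: subset_iff)
  qed
  obtain h where h: "h a = b" "bij_betw h ?A ?B" "\<forall>x\<in>?A. h (v x) = w (h x) \<and> h (- x) = - h x"
    using ex_equivariant_sblock[OF v w a0 b0 t[symmetric]] by blast
  show "bij_betw (\<lambda>g. restrict g (X - ?A)) {g \<in> equivariant v w X Y. g a = b}
      (equivariant v w (X - ?A) (Y - ?B))"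
    unfolding bij_betw_def
  proof
    show "inj_on (\<lambda>g. restrict g (X - ?A)) {g \<in> equivariant v w X Y. g a = b}"
    proof (rule inj_onI, rule ext)
      fix g g' x
      assume g: "g \<in> {g \<in> equivariant v w X Y. g a = b}" and g': "g' \<in> {g \<in> equivariant v w X Y. g a = b}"
        and e: "restrict g (X - ?A) = restrict g' (X - ?A)"
      consider "x \<notin> X" | "x \<in> X - ?A" | "x \<in> ?A" by blast
      then show "g x = g' x"
      proof cases
        case 1
        then show ?thesis using g g' by (auto simp: equivariant_def extensional_def)
      next
        case 2
        then show ?thesis using e by (metis restrict_apply')
      next
        case 3
        then obtain i where "x = (v ^^ i) a \<or> x = - (v ^^ i) a" by (rule sblockE[OF v])
        then show ?thesis
          using equivariant_funpow[OF v _ X a, of g w Y i] equivariant_funpow[OF v _ X a, of g' w Y i] g g'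
          by auto
      qed
    qed
    show "(\<lambda>g. restrict g (X - ?A)) ` {g \<in> equivariant v w X Y. g a = b} =
      equivariant v w (X - ?A) (Y - ?B)"
    proof (intro equalityI subsetI)
      fix g' assume "g' \<in> (\<lambda>g. restrict g (X - ?A)) ` {g \<in> equivariant v w X Y. g a = b}"
      then obtain g where g: "g \<in> equivariant v w X Y" "g a = b" "g' = restrict g (X - ?A)" by blast
      have "g ` ?A = ?B" using equivariant_sblock(1)[OF v w g(1) X a] g(2) by simp
      moreover have "bij_betw g X Y" using g by (simp add: equivariant_def)
      ultimately have "bij_betw g (X - ?A) (Y - ?B)"
        using A unfolding bij_betw_def by (metis Diff_subset inj_on_image_set_diff inj_on_subset)
      then have "bij_betw g' (X - ?A) (Y - ?B)"
        unfolding g(3) by (subst bij_betw_cong[where g = g]) auto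
      then show "g' \<in> equivariant v w (X - ?A) (Y - ?B)"
        using g XA by (auto simp: equivariant_def)
    next
      fix g' assume g': "g' \<in> equivariant v w (X - ?A) (Y - ?B)"
      \<comment> \<open>Surjectivity: a map on the complement is glued with the block map
        \<open>h\<close> from \<open>ex_equivariant_sblock\<close>.\<close>
      define g where "g = (\<lambda>x\<in>X. if x \<in> ?A then h x else g' x)"
      have "bij_betw g ?A ?B"
        using h(2) A by (subst bij_betw_cong[where g = h]) (auto simp: g_def)
      moreover have "bij_betw g (X - ?A) (Y - ?B)"
        using g' by (subst bij_betw_cong[where g = g']) (auto simp: g_def equivariant_def)
      ultimately have "bij_betw g (?A \<union> (X - ?A)) (?B \<union> (Y - ?B))"
        by (rule bij_betw_combine) blast
      then have "bij_betw g X Y" using A B by (simp add: Un_absorb1)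
      moreover have "g (v x) = w (g x) \<and> g (- x) = - g x" if x: "x \<in> X" for x
      proof (cases "x \<in> ?A")
        case True
        then have "v x \<in> ?A" "- x \<in> ?A" using apply_sblock[OF v] uminus_sblock[OF v] by auto
        then show ?thesis using True h(3) A by (auto simp: g_def)
      next
        case False
        then show ?thesis using XA[of x] x g' by (auto simp: g_def equivariant_def)
      qed
      moreover have "g a = b" using a h(1) self_in_sblock[OF v] by (simp add: g_def)
      moreover have "g' = restrict g (X - ?A)"
        using g' by (auto simp: g_def equivariant_def extensional_def fun_eq_iff)
      ultimately show "g' \<in> (\<lambda>g. restrict g (X - ?A)) ` {g \<in> equivariant v w X Y. g a = b}"
        unfolding equivariant_def by (intro image_eqI[of _ _ g] CollectI conjI ballI) (auto simp: g_def)
    qed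
  qed
qed

text \<open>Fix a letter \<open>a\<close> of \<open>X\<close>. Its image is any letter of
  \<open>Y\<close> of the same type, and the number of these is the factor by which
  \<open>centralizer_size_add\<close> grows; what remains is the same problem with one block removed
  on each side.\<close>

lemma card_equivariant:
  assumes v: "odd_perm v" and w: "odd_perm w" and "block_closed v X" "block_closed w Y"
  shows "card (equivariant v w X Y) =
    (if block_types v X = block_types w Y then centralizer_size (block_types v X) else 0)"
  using assms(3,4)
proof (induction "card X" arbitrary: X Y rule: less_induct)
  case less
  note X = less.prems(1) and Y = less.prems(2)
  have fX: "finite X" and fY: "finite Y" using X Y by (auto simp: block_closed_def)
  show ?case
  proof (cases "X = {}")
    case True
    then show ?thesis
    proof (cases "Y = {}")
      case True
      with \<open>X = {}\<close> have "equivariant v w X Y = {\<lambda>x. undefined}"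
        by (auto simp: equivariant_def extensional_def bij_betw_def)
      then show ?thesis using True \<open>X = {}\<close> by (simp add: block_types_def)
    next
      case False
      then have "equivariant v w X Y = {}"
        using \<open>X = {}\<close> by (auto simp: equivariant_def bij_betw_def)
      moreover have "block_types w Y \<noteq> {#}"
        using False fY by (simp add: block_types_def mset_set_empty_iff)
      ultimately show ?thesis using \<open>X = {}\<close> by (simp add: block_types_def)
    qed
  next
    case False
    then obtain a where a: "a \<in> X" by blast
    define t where "t = stype v a"
    define X' where "X' = X - sblock v a"
    have X': "block_closed v X'" unfolding X'_def by (rule block_closed_diff[OF v X])
    have TX: "block_types v X = add_mset t (block_types v X')"
      unfolding t_def X'_def by (rule block_types_remove[OF v X a])
    have "X' \<subset> X" using a self_in_sblock[OF v] unfolding X'_def by blast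
    then have lt: "card X' < card X" using fX by (rule psubset_card_mono[rotated])
    have sub: "equivariant v w X Y \<subseteq> X \<rightarrow>\<^sub>E Y"
      by (auto simp: equivariant_def PiE_def Pi_def bij_betw_def)
    have fin: "finite (equivariant v w X Y)"
      using sub fX fY by (meson finite_PiE finite_subset)
    have "card (equivariant v w X Y) = (\<Sum>b\<in>Y. card {g \<in> equivariant v w X Y. g a = b})"
    proof -
      have "equivariant v w X Y = (\<Union>b\<in>Y. {g \<in> equivariant v w X Y. g a = b})"
        using sub a by auto
      also have "card \<dots> = (\<Sum>b\<in>Y. card {g \<in> equivariant v w X Y. g a = b})"
        using fY fin by (intro card_UN_disjoint) auto
      finally show ?thesis .
    qed
    also have "\<dots> = (\<Sum>b\<in>Y. if stype w b = t then 
        (if block_types v X = block_types w Y then centralizer_size (block_types v X') else 0) else 0)"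
    proof (rule sum.cong, simp)
      fix b assume b: "b \<in> Y"
      show "card {g \<in> equivariant v w X Y. g a = b} = (if stype w b = t then 
        (if block_types v X = block_types w Y then centralizer_size (block_types v X') else 0) else 0)"
      proof (cases "stype w b = t")
        case True
        have "card {g \<in> equivariant v w X Y. g a = b} =
            card (equivariant v w X' (Y - sblock w b))"
          unfolding X'_def using True t_def by (intro card_equivariant_fixed[OF v w X Y a b]) simp
        also have "\<dots> = (if block_types v X' = block_types w (Y - sblock w b)
            then centralizer_size (block_types v X') else 0)"
          by (rule less.hyps[OF lt X' block_closed_diff[OF w Y]])
        finally show ?thesis
          using True block_types_remove[OF w Y b] TX by simp
      next
        case False
        then have "{g \<in> equivariant v w X Y. g a = b} = {}"
          using equivariant_sblock(2)[OF v w _ X a] t_def by auto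
        then have "card {g \<in> equivariant v w X Y. g a = b} = 0" by (simp only: card.empty)
        then show ?thesis using False by simp
      qed
    qed
    also have "\<dots> = card {b \<in> Y. stype w b = t} *
        (if block_types v X = block_types w Y then centralizer_size (block_types v X') else 0)"
      using fY by (simp add: sum.If_cases Int_def)
    also have "\<dots> = (if block_types v X = block_types w Y then
        count (block_types v X) t * (2 * fst t) * centralizer_size (block_types v X') else 0)"
      by (simp add: card_stype[OF w Y])
    also have "count (block_types v X) t * (2 * fst t) * centralizer_size (block_types v X') =
        centralizer_size (block_types v X)"
      by (simp add: TX centralizer_size_add algebra_simps)
    finally show ?thesis .
  qed
qed

section \<open>Signed cycle types and centralizers of elements of the hyperoctahedral group\<close>

lemma finite_letters [simp]: "finite (letters n)"
  by (simp add: letters_def)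

lemma zero_notin_letters [simp]: "0 \<notin> letters n"
  by (simp add: letters_def)

lemma uminus_in_letters [simp]: "- x \<in> letters n \<longleftrightarrow> x \<in> letters n"
  by (auto simp: letters_def)

lemma hyperoct_permutes: "w \<in> carrier (hyperoct n) \<Longrightarrow> w permutes letters n"
  by (simp add: hyperoct_def)

lemma hyperoct_odd_perm: "w \<in> carrier (hyperoct n) \<Longrightarrow> odd_perm w"
  unfolding odd_perm_def permutation_permutes
  by (intro conjI exI[of _ "letters n"] finite_letters hyperoct_permutes) (auto simp: hyperoct_def)

lemma hyperoct_sblock_subset:
  assumes "w \<in> carrier (hyperoct n)" "x \<in> letters n"
  shows "sblock w x \<subseteq> letters n"
  using permutes_orbit_subset[OF hyperoct_permutes[OF assms(1)] assms(2)]
  by (auto simp: sblock_def)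

lemma hyperoct_block_closed: "w \<in> carrier (hyperoct n) \<Longrightarrow> block_closed w (letters n)"
  unfolding block_closed_def using hyperoct_sblock_subset by simp

lemma fst_stype_pos:
  assumes "odd_perm v" "a \<noteq> 0"
  shows "0 < fst (stype v a)"
proof -
  have "card (sblock v a) > 0"
    using finite_sblock[OF assms(1)] self_in_sblock[OF assms(1)] by (auto simp: card_gt_0_iff)
  then show ?thesis using card_sblock[OF assms] by simp
qed

lemma block_types_fst_pos:
  assumes v: "odd_perm v" and X: "block_closed v X" and c: "c \<in># block_types v X"
  shows "0 < fst c"
proof -
  obtain a where a: "a \<in> X" "c = stype v a"
    using X c by (auto simp: block_types_def block_closed_def stype_some[OF v])
  then have "a \<noteq> 0" using X unfolding block_closed_def by metis
  then show ?thesis using fst_stype_pos[OF v] a by simp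
qed

text \<open>Links the counting of blocks to the two given cycle types, one made of unordered pairs
  of opposite cycles, the other of cycles that equal their negatives.\<close>

lemma block_types_hyperoct:
  assumes w: "w \<in> carrier (hyperoct n)"
  shows "block_types w (letters n) = image_mset (\<lambda>k. (k, False)) (pos_cycle_type n w) +
    image_mset (\<lambda>k. (k, True)) (neg_cycle_type n w)"
proof -
  note v = hyperoct_odd_perm[OF w]
  let ?O = "Orbits.orbit w"
  define Lp where "Lp = {x \<in> letters n. - x \<notin> ?O x}"
  define Ln where "Ln = {x \<in> letters n. - x \<in> ?O x}"
  define f where "f = (\<lambda>B. stype w (SOME x. x \<in> B))"
  define pr where "pr = (\<lambda>x. {?O x, uminus ` ?O x})"
  have fin: "finite Lp" "finite Ln" by (auto simp: Lp_def Ln_def)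
  have f: "f (sblock w x) = (card (sblock w x) div 2, - x \<in> ?O x)" for x
    unfolding f_def by (simp only: stype_some[OF v]) (simp add: stype_def)
  have "sblock w ` letters n = sblock w ` Lp \<union> sblock w ` Ln"
    by (auto simp: Lp_def Ln_def)
  moreover have "sblock w ` Lp \<inter> sblock w ` Ln = {}"
  proof -
    have "snd (f B) = False" if "B \<in> sblock w ` Lp" for B using that f by (auto simp: Lp_def)
    moreover have "snd (f B) = True" if "B \<in> sblock w ` Ln" for B using that f by (auto simp: Ln_def)
    ultimately show ?thesis by blast
  qed
  ultimately have "block_types w (letters n) =
      image_mset f (mset_set (sblock w ` Lp)) + image_mset f (mset_set (sblock w ` Ln))"
    unfolding block_types_def f_def[symmetric] using fin by (simp add: mset_set_Union)
  also have "image_mset f (mset_set (sblock w ` Lp)) = image_mset (\<lambda>k. (k, False)) (pos_cycle_type n w)"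
  proof -
    have P: "{{c, uminus ` c} |c. c \<in> cycles n w \<and> uminus ` c \<noteq> c} = pr ` Lp"
      by (auto simp: cycles_def Lp_def pr_def orbit_neg_iff[OF v])
    have U: "\<Union> (pr x) = sblock w x" for x by (simp add: pr_def sblock_def)
    \<comment> \<open>A pair of opposite cycles is recovered from its union, since any letter of the
      union generates one of the two cycles.\<close>
    have inj: "inj_on \<Union> (pr ` Lp)"
    proof (rule inj_onI)
      fix p q assume "p \<in> pr ` Lp" "q \<in> pr ` Lp" and e: "\<Union> p = \<Union> q"
      then obtain x y where xy: "p = pr x" "q = pr y" by auto
      then have "x \<in> sblock w y" using e U self_in_sblock[OF v, of x] by simp
      then have "x \<in> ?O y \<or> x \<in> ?O (- y)" using orbit_minus[OF v, of y] by (simp add: sblock_def)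
      then show "p = q"
      proof
        assume "x \<in> ?O y"
        then have "?O x = ?O y" by (rule orbit_eq[OF v])
        then show ?thesis by (simp add: xy pr_def)
      next
        assume "x \<in> ?O (- y)"
        then have "?O x = uminus ` ?O y" by (simp only: orbit_eq[OF v] orbit_minus[OF v, symmetric])
        then show ?thesis by (simp add: xy pr_def image_image insert_commute)
      qed
    qed
    have "sblock w ` Lp = \<Union> ` (pr ` Lp)" by (simp add: image_image U)
    then have "image_mset f (mset_set (sblock w ` Lp)) =
        image_mset (\<lambda>p. f (\<Union> p)) (mset_set (pr ` Lp))"
      by (simp add: image_mset_mset_set[OF inj, symmetric] multiset.map_comp comp_def del: image_mset_mset_set)
    also have "\<dots> = image_mset (\<lambda>p. (card (\<Union> p) div 2, False)) (mset_set (pr ` Lp))"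
      using fin by (intro image_mset_cong) (auto simp: U f Lp_def)
    finally show ?thesis by (simp add: pos_cycle_type_def P multiset.map_comp comp_def)
  qed
  also have "image_mset f (mset_set (sblock w ` Ln)) = image_mset (\<lambda>k. (k, True)) (neg_cycle_type n w)"
  proof -
    have "{c \<in> cycles n w. uminus ` c = c} = sblock w ` Ln"
    proof -
      have "sblock w x = ?O x" if "x \<in> Ln" for x
        using that orbit_neg_iff[OF v] by (auto simp: Ln_def sblock_def)
      then have "sblock w ` Ln = ?O ` Ln" by (intro image_cong) auto
      also have "\<dots> = {c \<in> cycles n w. uminus ` c = c}"
        by (auto simp: cycles_def Ln_def orbit_neg_iff[OF v])
      finally show ?thesis ..
    qed
    moreover have "image_mset f (mset_set (sblock w ` Ln)) =
        image_mset (\<lambda>B. (card B div 2, True)) (mset_set (sblock w ` Ln))"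
      using fin by (intro image_mset_cong) (auto simp: f Ln_def)
    ultimately show ?thesis by (simp add: neg_cycle_type_def multiset.map_comp comp_def)
  qed
  finally show ?thesis .
qed

text \<open>Elements of the group fix everything outside the letters, so they correspond to their
  restrictions. Allowing two permutations \<open>v\<close> and \<open>w\<close> yields conjugacy of
  elements of equal type together with the centralizer order.\<close>

lemma card_intertwiners:
  assumes v: "v \<in> carrier (hyperoct n)" and w: "w \<in> carrier (hyperoct n)"
  shows "card {g \<in> carrier (hyperoct n). g \<circ> v = w \<circ> g} =
    (if block_types v (letters n) = block_types w (letters n)
     then centralizer_size (block_types v (letters n)) else 0)"
proof -
  let ?L = "letters n"
  have vL: "v x \<in> ?L \<longleftrightarrow> x \<in> ?L" for x using permutes_in_image[OF hyperoct_permutes[OF v]] .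
  have "card {g \<in> carrier (hyperoct n). g \<circ> v = w \<circ> g} = card (equivariant v w ?L ?L)"
  proof (rule bij_betw_same_card[of "\<lambda>g. restrict g ?L"], unfold bij_betw_def, intro conjI)
    show "inj_on (\<lambda>g. restrict g ?L) {g \<in> carrier (hyperoct n). g \<circ> v = w \<circ> g}"
    proof (rule inj_onI, rule ext)
      fix g h x assume g: "g \<in> {g \<in> carrier (hyperoct n). g \<circ> v = w \<circ> g}"
        and h: "h \<in> {g \<in> carrier (hyperoct n). g \<circ> v = w \<circ> g}"
        and e: "restrict g ?L = restrict h ?L"
      show "g x = h x"
      proof (cases "x \<in> ?L")
        case True
        then show ?thesis using e by (metis restrict_apply')
      next
        case False
        then show ?thesis using g h by (auto simp: hyperoct_def permutes_not_in)
      qed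
    qed
    show "(\<lambda>g. restrict g ?L) ` {g \<in> carrier (hyperoct n). g \<circ> v = w \<circ> g} = equivariant v w ?L ?L"
    proof (intro equalityI subsetI)
      fix h assume "h \<in> (\<lambda>g. restrict g ?L) ` {g \<in> carrier (hyperoct n). g \<circ> v = w \<circ> g}"
      then obtain g where g: "g permutes ?L" "\<And>x. g (- x) = - g x" "g \<circ> v = w \<circ> g" "h = restrict g ?L"
        by (auto simp: hyperoct_def)
      have "bij_betw h ?L ?L"
        unfolding g(4) using permutes_imp_bij[OF g(1)] by (subst bij_betw_cong[where g = g]) auto
      moreover have "g (v x) = w (g x)" for x using g(3) by (metis comp_apply)
      ultimately show "h \<in> equivariant v w ?L ?L"
        using g vL by (auto simp: equivariant_def)
    next
      fix h assume h: "h \<in> equivariant v w ?L ?L"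
      define g where "g x = (if x \<in> ?L then h x else x)" for x
      have b: "bij_betw h ?L ?L" using h by (simp add: equivariant_def)
      have "g permutes ?L"
      proof (rule bij_imp_permutes)
        show "bij_betw g ?L ?L" using b by (subst bij_betw_cong[where g = h]) (auto simp: g_def)
      qed (simp add: g_def)
      moreover have "g (- x) = - g x" for x using h by (auto simp: g_def equivariant_def)
      moreover have "g (v x) = w (g x)" for x
        using h vL permutes_not_in[OF hyperoct_permutes[OF w]] permutes_not_in[OF hyperoct_permutes[OF v]]
        by (auto simp: g_def equivariant_def)
      moreover have "h = restrict g ?L"
        using h by (auto simp: g_def equivariant_def extensional_def fun_eq_iff)
      ultimately show "h \<in> (\<lambda>g. restrict g ?L) ` {g \<in> carrier (hyperoct n). g \<circ> v = w \<circ> g}"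
        by (intro image_eqI[of _ _ g]) (auto simp: hyperoct_def)
    qed
  qed
  then show ?thesis
    using card_equivariant[OF hyperoct_odd_perm[OF v] hyperoct_odd_perm[OF w]
        hyperoct_block_closed[OF v] hyperoct_block_closed[OF w]] by simp
qed

lemma centralizer_size_replicate: "centralizer_size (replicate_mset n (1, b)) = 2 ^ n * fact n"
  by (induction n) (simp_all add: centralizer_size_add algebra_simps)

lemma finite_hyperoct: "finite (carrier (hyperoct n))"
  using finite_permutations[OF finite_letters] by (rule rev_finite_subset) (auto simp: hyperoct_def)

text \<open>The whole group is the centralizer of the identity, whose type consists of
  \<open>n\<close> positive cycles of length 1.\<close>

lemma card_hyperoct: "card (carrier (hyperoct n)) = 2 ^ n * fact n"
proof -
  have id: "id \<in> carrier (hyperoct n)" by (simp add: hyperoct_def permutes_id)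
  have sb: "sblock id x = {x, - x}" for x
  proof -
    have "Orbits.orbit id x = {x}" by (simp add: orbit_eq_singleton_iff)
    then show ?thesis by (auto simp: sblock_def)
  qed
  have "block_types id (letters n) = replicate_mset n (1, False)"
  proof -
    have L: "sblock id ` letters n = (\<lambda>k. {int k, - int k}) ` {1..n}"
    proof (intro equalityI subsetI)
      fix B assume "B \<in> sblock id ` letters n"
      then obtain x where x: "x \<in> letters n" "B = {x, - x}" by (auto simp: sb)
      then have "B = {int (nat \<bar>x\<bar>), - int (nat \<bar>x\<bar>)}" "nat \<bar>x\<bar> \<in> {1..n}"
        by (auto simp: letters_def abs_if)
      then show "B \<in> (\<lambda>k. {int k, - int k}) ` {1..n}" by blast
    next
      fix B assume "B \<in> (\<lambda>k. {int k, - int k}) ` {1..n}"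
      then obtain k where "k \<in> {1..n}" "B = {int k, - int k}" by auto
      then show "B \<in> sblock id ` letters n" by (intro image_eqI[of _ _ "int k"]) (auto simp: sb letters_def)
    qed
    have "inj_on (\<lambda>k. {int k, - int k}) {1..n}"
      by (auto simp: inj_on_def doubleton_eq_iff)
    then have "card (sblock id ` letters n) = n" by (simp add: L card_image)
    moreover have "stype id x = (1, False)" if "x \<in> letters n" for x
      using that by (auto simp: stype_def sb letters_def orbit_eq_singleton_iff)
        (simp_all add: orbit_eq_singleton_iff[THEN iffD2])
    then have "stype id (SOME x. x \<in> B) = (1, False)" if "B \<in> sblock id ` letters n" for B
      using that stype_some[OF hyperoct_odd_perm[OF id]] by auto
    then have "block_types id (letters n) = image_mset (\<lambda>_. (1, False)) (mset_set (sblock id ` letters n))"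
      unfolding block_types_def by (intro image_mset_cong) simp
    ultimately show ?thesis by (simp add: image_mset_const_eq)
  qed
  then show ?thesis
    using card_intertwiners[OF id id] centralizer_size_replicate[of n False] by simp
qed

section \<open>Characters as class functions\<close>

lemma sum_list_diag_mult_commute:
  fixes A B :: "'a :: comm_semiring_1 mat"
  assumes "A \<in> carrier_mat d d" "B \<in> carrier_mat d d"
  shows "sum_list (diag_mat (A * B)) = sum_list (diag_mat (B * A))"
proof -
  have "sum_list (diag_mat (C * D)) = (\<Sum>i<d. \<Sum>j<d. C $$ (i, j) * D $$ (j, i))"
    if "C \<in> carrier_mat d d" "D \<in> carrier_mat d d" for C D :: "'a mat"
  proof -
    have "sum_list (diag_mat (C * D)) = (\<Sum>i<d. (C * D) $$ (i, i))"
      using that by (simp add: diag_mat_def sum_list_sum_nth atLeast0LessThan)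
    also have "\<dots> = (\<Sum>i<d. \<Sum>j<d. C $$ (i, j) * D $$ (j, i))"
      using that by (intro sum.cong) (auto simp: scalar_prod_def atLeast0LessThan)
    finally show ?thesis .
  qed
  note * = this
  show ?thesis
    unfolding *[OF assms] *[OF assms(2,1)] by (subst sum.swap) (simp add: mult.commute)
qed

text \<open>The trace of a product of two matrices is symmetric in them; invariance under
  conjugation follows in \<open>class_function_sum\<close>.\<close>

lemma irreducible_character_mult_commute:
  assumes G: "group G" and \<chi>: "irreducible_character G \<chi>" and "g \<in> carrier G" "h \<in> carrier G"
  shows "\<chi> (g \<otimes>\<^bsub>G\<^esub> h) = \<chi> (h \<otimes>\<^bsub>G\<^esub> g)"
proof -
  interpret group G by fact
  obtain d \<rho> where \<rho>: "\<rho> \<in> hom G (general_linear d)"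
    "\<And>g. g \<in> carrier G \<Longrightarrow> \<chi> g = sum_list (diag_mat (\<rho> g))"
    using \<chi> by (auto simp: irreducible_character_def irreducible_rep_def)
  have "\<rho> x \<in> carrier_mat d d" if "x \<in> carrier G" for x
    using \<rho>(1) that by (auto simp: hom_def units_of_def Units_def ring_mat_def)
  moreover have "\<rho> (x \<otimes>\<^bsub>G\<^esub> y) = \<rho> x * \<rho> y" if "x \<in> carrier G" "y \<in> carrier G" for x y
    using \<rho>(1) that by (auto simp: hom_def units_of_def ring_mat_def)
  ultimately show ?thesis using assms \<rho>(2) sum_list_diag_mult_commute[of "\<rho> g" d "\<rho> h"] by simp
qed

text \<open>Double counting of the pairs (w, g) with \<open>g \<circ> v = w \<circ> g\<close>: for
  fixed \<open>w\<close> they are counted by \<open>card_intertwiners\<close>, for fixed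
  \<open>g\<close> the only \<open>w\<close> is the conjugate of \<open>v\<close> by
  \<open>g\<close>.\<close>

lemma class_function_sum:
  assumes \<chi>: "irreducible_character (hyperoct n) \<chi>" and v: "v \<in> carrier (hyperoct n)"
  shows "(\<Sum>w\<in>carrier (hyperoct n). \<chi> w *
      (if block_types v (letters n) = block_types w (letters n)
       then of_nat (centralizer_size (block_types v (letters n))) else 0)) =
    2 ^ n * fact n * \<chi> v"
proof -
  interpret B: group "hyperoct n" by (rule group_hyperoct)
  let ?B = "carrier (hyperoct n)"
  have mult: "g \<otimes>\<^bsub>hyperoct n\<^esub> h = g \<circ> h" for g h by (simp add: hyperoct_def)
  have fin: "finite ?B" by (rule finite_hyperoct)
  have "(\<Sum>w\<in>?B. \<chi> w * (if block_types v (letters n) = block_types w (letters n)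
       then of_nat (centralizer_size (block_types v (letters n))) else 0)) =
     (\<Sum>w\<in>?B. \<chi> w * of_nat (card {g \<in> ?B. g \<circ> v = w \<circ> g}))"
    by (intro sum.cong refl) (simp add: card_intertwiners[OF v])
  also have "\<dots> = (\<Sum>w\<in>?B. \<Sum>g\<in>?B. if g \<circ> v = w \<circ> g then \<chi> w else 0)"
    using fin by (intro sum.cong refl) (simp add: sum.If_cases Int_def mult.commute)
  also have "\<dots> = (\<Sum>g\<in>?B. \<Sum>w\<in>?B. if g \<circ> v = w \<circ> g then \<chi> w else 0)"
    by (rule sum.swap)
  also have "\<dots> = (\<Sum>g\<in>?B. \<chi> v)"
  proof (rule sum.cong, simp)
    fix g assume g: "g \<in> ?B"
    let ?c = "g \<otimes>\<^bsub>hyperoct n\<^esub> v \<otimes>\<^bsub>hyperoct n\<^esub> inv\<^bsub>hyperoct n\<^esub> g"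
    have c: "?c \<in> ?B" using g v by simp
    have "g \<circ> v = w \<circ> g \<longleftrightarrow> w = ?c" if "w \<in> ?B" for w
      unfolding mult[symmetric] using that g v
      by (metis B.inv_closed B.inv_solve_right B.m_closed)
    then have "(\<Sum>w\<in>?B. if g \<circ> v = w \<circ> g then \<chi> w else 0) = (\<Sum>w\<in>?B. if w = ?c then \<chi> w else 0)"
      by (intro sum.cong) auto
    also have "\<dots> = \<chi> ?c" using c fin by (simp add: sum.delta)
    also have "\<dots> = \<chi> (inv\<^bsub>hyperoct n\<^esub> g \<otimes>\<^bsub>hyperoct n\<^esub> (g \<otimes>\<^bsub>hyperoct n\<^esub> v))"
      using g v by (intro irreducible_character_mult_commute[OF group_hyperoct \<chi>]) auto
    also have "inv\<^bsub>hyperoct n\<^esub> g \<otimes>\<^bsub>hyperoct n\<^esub> (g \<otimes>\<^bsub>hyperoct n\<^esub> v) = v"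
      using g v by (simp add: B.m_assoc[symmetric])
    finally show "(\<Sum>w\<in>?B. if g \<circ> v = w \<circ> g then \<chi> w else 0) = \<chi> v" .
  qed
  also have "\<dots> = 2 ^ n * fact n * \<chi> v" by (simp add: card_hyperoct)
  finally show ?thesis .
qed

subsection \<open>The functional on the Frobenius characteristic\<close>

definition var_of :: "sign \<Rightarrow> nat \<Rightarrow> nat + nat" where
  "var_of e j = (if e = Plus then Inl j else Inr j)"

text \<open>Position \<open>j\<close> uses the variable index \<open>j\<close> in whichever alphabet
  its sign selects. Distinct positions thus have distinct variables, x_j and y_j never occur
  together, and the index remembers the order of the list.\<close>

definition content :: "(nat \<times> sign) list \<Rightarrow> (nat + nat) multiset" where
  "content ds = (\<Sum>j<length ds. replicate_mset (fst (ds ! j)) (var_of (snd (ds ! j)) j))"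

lemma var_of_eq_iff [simp]: "var_of e j = var_of e' j' \<longleftrightarrow> e = e' \<and> j = j'"
  by (cases e; cases e') (auto simp: var_of_def)

lemma var_of_cases: obtains e j where "x = var_of e j"
proof (cases x)
  case (Inl j)
  then show ?thesis using that[of Plus j] by (simp add: var_of_def)
next
  case (Inr j)
  then show ?thesis using that[of Minus j] by (simp add: var_of_def)
qed

lemma count_content:
  "count (content ds) (var_of e j) = (if j < length ds \<and> snd (ds ! j) = e then fst (ds ! j) else 0)"
proof -
  have "count (content ds) (var_of e j) =
      (\<Sum>i<length ds. if i = j then (if snd (ds ! j) = e then fst (ds ! j) else 0) else 0)"
    unfolding content_def count_sum by (intro sum.cong) auto
  then show ?thesis by (simp add: sum.delta)
qed

lemma content_empty_iff: "content ds = {#} \<longleftrightarrow> (\<forall>x\<in>set ds. fst x = 0)"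
proof -
  have "content ds = {#} \<longleftrightarrow> (\<forall>j<length ds. fst (ds ! j) = 0)"
    unfolding content_def by (auto simp: sum_eq_empty_iff)
  then show ?thesis by (metis in_set_conv_nth)
qed

lemma content_update:
  assumes "j < length ds" "k \<le> fst (ds ! j)"
  shows "content (ds[j := (fst (ds ! j) - k, snd (ds ! j))]) =
    content ds - replicate_mset k (var_of (snd (ds ! j)) j)"
proof (rule multiset_eqI)
  fix x
  obtain e i where x: "x = var_of e i" by (rule var_of_cases)
  show "count (content (ds[j := (fst (ds ! j) - k, snd (ds ! j))])) x =
    count (content ds - replicate_mset k (var_of (snd (ds ! j)) j)) x"
    using assms by (auto simp: x count_content nth_list_update)
qed

section \<open>Monomial coefficients of products of power sums\<close>

lemma mcoeff_times: "mcoeff (f * g) M = (\<Sum>A | A \<subseteq># M. mcoeff f A * mcoeff g (M - A))"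
  by (simp add: times_mfps.rep_eq)

lemma mcoeff_sum: "mcoeff (\<Sum>x\<in>X. f x) M = (\<Sum>x\<in>X. mcoeff (f x) M)"
  by (induction X rule: infinite_finite_induct) (auto simp: zero_mfps.rep_eq plus_mfps.rep_eq)

lemma mcoeff_mconst_times: "mcoeff (mconst c * f) M = c * mcoeff f M"
proof -
  have "mcoeff (mconst c * f) M = (\<Sum>A | A \<subseteq># M. if A = {#} then c * mcoeff f M else 0)"
    unfolding mcoeff_times mconst_def by (intro sum.cong) (auto simp: Abs_mfps_inverse)
  then show ?thesis by (simp add: sum.delta)
qed

lemma power_sum_nonzero:
  assumes "mcoeff (power_sum s k) A \<noteq> 0"
  obtains e i where "A = replicate_mset k (var_of e i)"
proof -
  have "(\<exists>i. A = replicate_mset k (Inl i)) \<or> (\<exists>i. A = replicate_mset k (Inr i))"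
    using assms by (auto simp: power_sum_def Abs_mfps_inverse split: if_splits)
  then show ?thesis using that[of Plus] that[of Minus] by (auto simp: var_of_def)
qed

lemma replicate_mset_inj: "0 < k \<Longrightarrow> replicate_mset k x = replicate_mset k y \<longleftrightarrow> x = y"
  by (metis in_replicate_mset less_not_refl)

lemma mcoeff_power_sum:
  assumes "0 < k"
  shows "mcoeff (power_sum (if b then -1 else 1) k) (replicate_mset k (var_of e i)) = bar_sign b e"
  using assms by (cases e) (auto simp: power_sum_def Abs_mfps_inverse var_of_def replicate_mset_inj bar_sign_def)

lemma replicate_subset_content:
  assumes "0 < k"
  shows "replicate_mset k (var_of e i) \<subseteq># content ds \<longleftrightarrow>
    i < length ds \<and> snd (ds ! i) = e \<and> k \<le> fst (ds ! i)"
proof -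
  have "replicate_mset k (var_of e i) \<subseteq># content ds \<longleftrightarrow> k \<le> count (content ds) (var_of e i)"
    by (simp add: count_le_replicate_mset_subset_eq)
  then show ?thesis using assms by (auto simp: count_content)
qed

text \<open>Only k-th powers of single variables contribute to the convolution, and such a power
  divides the monomial exactly when some exponent is at least \<open>k\<close>. This reproduces the
  recursion of \<open>assign\<close>; \<open>0 < k\<close> keeps powers of different variables
  distinct.\<close>

lemma mcoeff_power_sum_times:
  assumes k: "0 < k"
  shows "mcoeff (power_sum (if b then -1 else 1) k * g) (content ds) =
    (\<Sum>j<length ds. if k \<le> fst (ds ! j) then bar_sign b (snd (ds ! j)) *
       mcoeff g (content (ds[j := (fst (ds ! j) - k, snd (ds ! j))])) else 0)"
proof -
  let ?J = "{j. j < length ds \<and> k \<le> fst (ds ! j)}"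
  let ?r = "\<lambda>j. replicate_mset k (var_of (snd (ds ! j)) j)"
  let ?p = "power_sum (if b then -1 else 1) k"
  have "mcoeff (?p * g) (content ds) = (\<Sum>A\<in>?r ` ?J. mcoeff ?p A * mcoeff g (content ds - A))"
    unfolding mcoeff_times
  proof (rule sum.mono_neutral_right)
    show "?r ` ?J \<subseteq> {A. A \<subseteq># content ds}" using k by (auto simp: replicate_subset_content)
    show "\<forall>A\<in>{A. A \<subseteq># content ds} - ?r ` ?J. mcoeff ?p A * mcoeff g (content ds - A) = 0"
    proof (rule ballI, rule ccontr)
      fix A assume A: "A \<in> {A. A \<subseteq># content ds} - ?r ` ?J"
        and "mcoeff ?p A * mcoeff g (content ds - A) \<noteq> 0"
      then obtain e i where "A = replicate_mset k (var_of e i)"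
        using power_sum_nonzero by (metis mult_zero_left)
      then show False using A k by (auto simp: replicate_subset_content)
    qed
  qed simp
  also have "\<dots> = (\<Sum>j\<in>?J. mcoeff ?p (?r j) * mcoeff g (content ds - ?r j))"
    using k by (subst sum.reindex) (auto simp: inj_on_def replicate_mset_inj)
  also have "\<dots> = (\<Sum>j\<in>?J. bar_sign b (snd (ds ! j)) *
       mcoeff g (content (ds[j := (fst (ds ! j) - k, snd (ds ! j))])))"
    by (intro sum.cong) (auto simp: mcoeff_power_sum[OF k] content_update)
  also have "\<dots> = (\<Sum>j<length ds. if k \<le> fst (ds ! j) then bar_sign b (snd (ds ! j)) *
       mcoeff g (content (ds[j := (fst (ds ! j) - k, snd (ds ! j))])) else 0)"
    by (simp add: sum.If_cases lessThan_def Collect_conj_eq)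
  finally show ?thesis .
qed

lemma mcoeff_prod_power_sum:
  assumes "\<forall>c\<in>set cs. 0 < fst c"
  shows "mcoeff (\<Prod>c\<leftarrow>cs. power_sum (if snd c then -1 else 1) (fst c)) (content ds) = assign cs ds"
  using assms
proof (induction cs arbitrary: ds)
  case Nil
  then show ?case by (simp add: one_mfps.rep_eq content_empty_iff)
next
  case (Cons c cs)
  obtain k b where c: "c = (k, b)" by force
  show ?case using Cons unfolding c by (simp add: mcoeff_power_sum_times cong: if_cong)
qed

text \<open>Inversion of the Frobenius characteristic: orthogonality keeps only the elements with
  the type of \<open>v\<close>, each weighted by the centralizer order, and
  \<open>class_function_sum\<close> cancels the normalizing constant.\<close>

lemma refine_sum_frob_char:
  assumes \<chi>: "irreducible_character (hyperoct n) \<chi>" and v: "v \<in> carrier (hyperoct n)"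
    and \<gamma>: "mset \<gamma> = image_mset (\<lambda>k. (k, False)) (pos_cycle_type n v) +
      image_mset (\<lambda>k. (k, True)) (neg_cycle_type n v)"
  shows "refine_sum \<gamma> [] (\<lambda>ds. mcoeff (frob_char n \<chi>) (content ds)) = \<chi> v"
proof -
  let ?B = "carrier (hyperoct n)"
  let ?T = "\<lambda>w. block_types w (letters n)"
  have \<gamma>': "mset \<gamma> = ?T v" using \<gamma> block_types_hyperoct[OF v] by simp
  have pos: "0 < fst c" if "c \<in># ?T w" "w \<in> ?B" for c w
    using that block_types_fst_pos[OF hyperoct_odd_perm hyperoct_block_closed] by blast
  \<comment> \<open>\<open>assign\<close> recurses over lists, so the cycle type of each
    \<open>w\<close> is listed in an arbitrary order.\<close>
  have "\<forall>w. \<exists>cs. mset cs = ?T w" by (metis ex_mset)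
  then obtain cs where cs: "\<And>w. mset (cs w) = ?T w" by metis
  have "mcoeff (frob_char n \<chi>) (content ds) =
      (\<Sum>w\<in>?B. (1 / (2 ^ n * fact n) * \<chi> w) * assign (cs w) ds)" for ds
  proof -
    have "mcoeff (mconst (\<chi> w) * (\<Prod>k\<in>#pos_cycle_type n w. power_sum 1 k) *
        (\<Prod>k\<in>#neg_cycle_type n w. power_sum (-1) k)) (content ds) = \<chi> w * assign (cs w) ds"
      if w: "w \<in> ?B" for w
    proof -
      have "(\<Prod>k\<in>#pos_cycle_type n w. power_sum 1 k) * (\<Prod>k\<in>#neg_cycle_type n w. power_sum (-1) k) =
          (\<Prod>c\<in>#mset (cs w). power_sum (if snd c then -1 else 1) (fst c))"
        unfolding cs block_types_hyperoct[OF w] by (simp add: multiset.map_comp comp_def)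
      also have "\<dots> = (\<Prod>c\<leftarrow>cs w. power_sum (if snd c then -1 else 1) (fst c))"
        by (simp only: mset_map[symmetric] prod_mset_prod_list)
      finally show ?thesis
        using mcoeff_prod_power_sum[of "cs w" ds] pos[OF _ w] cs[of w]
        by (simp add: mult.assoc mcoeff_mconst_times) (metis set_mset_mset)
    qed
    then show ?thesis
      unfolding frob_char_def mcoeff_mconst_times mcoeff_sum sum_distrib_left by (simp add: mult.assoc)
  qed
  then have "refine_sum \<gamma> [] (\<lambda>ds. mcoeff (frob_char n \<chi>) (content ds)) =
      (\<Sum>w\<in>?B. (1 / (2 ^ n * fact n) * \<chi> w) * refine_sum \<gamma> [] (assign (cs w)))"
    by (simp only: refine_sum_sum)
  also have "\<dots> = (\<Sum>w\<in>?B. (1 / (2 ^ n * fact n) * \<chi> w) *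
      (if ?T v = ?T w then of_nat (centralizer_size (?T v)) else 0))"
  proof (intro sum.cong refl)
    fix w assume w: "w \<in> ?B"
    have 1: "\<forall>x\<in>set (cs w). 0 < fst x" using pos[OF _ w] cs[of w] by (metis set_mset_mset)
    have 2: "\<forall>x\<in>set \<gamma>. 0 < fst x" using pos[OF _ v] \<gamma>' by (metis set_mset_mset)
    show "(1 / (2 ^ n * fact n) * \<chi> w) * refine_sum \<gamma> [] (assign (cs w)) = (1 / (2 ^ n * fact n) * \<chi> w) *
      (if ?T v = ?T w then of_nat (centralizer_size (?T v)) else 0)"
      by (auto simp: refine_sum_assign[OF 1 2] cs \<gamma>')
  qed
  also have "\<dots> = 1 / (2 ^ n * fact n) * (\<Sum>w\<in>?B. \<chi> w *
      (if ?T v = ?T w then of_nat (centralizer_size (?T v)) else 0))"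
    by (simp only: sum_distrib_left mult.assoc)
  also have "\<dots> = \<chi> v" unfolding class_function_sum[OF \<chi> v] by simp
  finally show ?thesis .
qed

subsection \<open>The functional on descent indicators\<close>

text \<open>Within the range covered by the list, starting after \<open>off\<close>, elements of
  \<open>S\<close> may occur only at ends of parts: the composition is at least as fine as the
  descents demand.\<close>

fun no_cut :: "nat set \<Rightarrow> nat \<Rightarrow> nat list \<Rightarrow> bool" where
  "no_cut S off [] \<longleftrightarrow> True"
| "no_cut S off (d # ds) \<longleftrightarrow> S \<inter> {off<..<off + d} = {} \<and> no_cut S (off + d) ds"

lemma comps_1: "comps (Suc 0) = {[Suc 0]}"
proof (intro equalityI subsetI)
  fix d assume "d \<in> comps (Suc 0)"
  then obtain x xs where d: "d = x # xs" "x + sum_list xs = 1" "x \<noteq> 0" "0 \<notin> set xs"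
    by (cases d) (auto simp: comps_def)
  then have "length xs = 0" using length_le_sum_list[OF d(4)] by linarith
  then have "xs = []" by simp
  then show "d \<in> {[Suc 0]}" using d by simp
qed (simp add: comps_def)

lemma comps_Suc:
  assumes "0 < k"
  shows "comps (Suc k) = (#) 1 ` comps k \<union> (\<lambda>d. Suc (hd d) # tl d) ` comps k"
proof (intro equalityI subsetI)
  fix d assume d: "d \<in> comps (Suc k)"
  then obtain x xs where x: "d = x # xs" by (cases d) (auto simp: comps_def)
  then obtain y where y: "x = Suc y" using d by (cases x) (auto simp: comps_def)
  show "d \<in> (#) 1 ` comps k \<union> (\<lambda>d. Suc (hd d) # tl d) ` comps k"
  proof (cases "y = 0")
    case True
    then show ?thesis using d x y by (auto simp: comps_def)
  next
    case False
    then show ?thesis using d x y by (intro UnI2 image_eqI[of _ _ "y # xs"]) (auto simp: comps_def)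
  qed
next
  fix d assume "d \<in> (#) 1 ` comps k \<union> (\<lambda>d. Suc (hd d) # tl d) ` comps k"
  then show "d \<in> comps (Suc k)"
  proof
    assume "d \<in> (\<lambda>d. Suc (hd d) # tl d) ` comps k"
    then obtain d' where d': "d = Suc (hd d') # tl d'" "d' \<in> comps k" by auto
    then have "d' \<noteq> []" using assms by (auto simp: comps_def)
    then show ?thesis using d' by (cases d') (auto simp: comps_def)
  qed (auto simp: comps_def)
qed

lemma comps_nonempty: "0 < k \<Longrightarrow> d \<in> comps k \<Longrightarrow> d \<noteq> []"
  by (auto simp: comps_def)

text \<open>This is the collapse to \<open>wt\<close> on one block. If
  \<open>Suc off \<in> S\<close>, the first part must be 1, and dropping it flips the sign.
  Otherwise \<open>1 # d\<close> cancels against \<open>d\<close> with its first part raised, except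
  for a surplus of 1 from the one-part composition, present only if \<open>S\<close> misses the rest
  of the block. Hence a position outside \<open>S\<close> forbids later ones in
  \<open>S\<close>.\<close>

lemma sum_comps_no_cut:
  assumes "0 < k"
  shows "(\<Sum>d\<in>comps k. comp_weight d * of_bool (no_cut S off d)) =
    (if initial_segment (S \<inter> {off<..<off + k}) {off<..<off + k}
     then (-1) ^ card (S \<inter> {off<..<off + k}) else 0)"
  using assms
proof (induction k arbitrary: off rule: nat_induct_non_zero)
  case 1
  have "{off<..<Suc off} = {}" by auto
  then show ?case by (simp add: comps_1 comp_weight_def initial_segment_def)
next
  case (Suc k)
  let ?W = "\<lambda>k off. \<Sum>d\<in>comps k. comp_weight d * of_bool (no_cut S off d)"
  let ?I = "{Suc off<..<Suc off + k}"
  have I: "{off<..<off + Suc k} = insert (Suc off) ?I" using Suc.hyps by auto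
  have ne: "d \<noteq> []" if "d \<in> comps k" for d using that Suc.hyps comps_nonempty by blast
  have disj: "(#) 1 ` comps k \<inter> (\<lambda>d. Suc (hd d) # tl d) ` comps k = {}"
  proof -
    have "hd d \<noteq> 0" if "d \<in> comps k" for d
      using that ne[OF that] by (cases d) (auto simp: comps_def)
    then show ?thesis by fastforce
  qed
  have inj: "inj_on (\<lambda>d. Suc (hd d) # tl d) (comps k)"
    using ne by (intro inj_onI) (metis list.collapse list.inject nat.inject)
  have inj1: "inj_on ((#) 1) (comps k)" by simp
  have "?W (Suc k) off = (\<Sum>d\<in>comps k. comp_weight (1 # d) * of_bool (no_cut S off (1 # d))) +
      (\<Sum>d\<in>comps k. comp_weight (Suc (hd d) # tl d) * of_bool (no_cut S off (Suc (hd d) # tl d)))"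
    unfolding comps_Suc[OF Suc.hyps]
    by (subst sum.union_disjoint[OF _ _ disj]) (simp_all only: finite_imageI finite_comps
        sum.reindex[OF inj] sum.reindex[OF inj1] comp_def)
  also have "(\<Sum>d\<in>comps k. comp_weight (1 # d) * of_bool (no_cut S off (1 # d))) = - ?W k (Suc off)"
  proof -
    have "comp_weight (1 # d) = - comp_weight d" if "d \<in> comps k" for d
      using ne[OF that] by (cases d) (auto simp: comp_weight_def)
    moreover have "{off<..<Suc off} = {}" by auto
    ultimately show ?thesis by (simp add: sum_negf)
  qed
  \<comment> \<open>Raising the first part changes the weight only when it is also the last part,
    that is for \<open>d = [k]\<close>, and then by 1.\<close>
  also have "(\<Sum>d\<in>comps k. comp_weight (Suc (hd d) # tl d) * of_bool (no_cut S off (Suc (hd d) # tl d))) =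
    (\<Sum>d\<in>comps k. of_bool (Suc off \<notin> S) * (comp_weight d * of_bool (no_cut S (Suc off) d) +
       (if d = [k] then of_bool (S \<inter> ?I = {}) else 0)))"
  proof (intro sum.cong refl)
    fix d assume d: "d \<in> comps k"
    obtain x xs where x: "d = x # xs" using ne[OF d] by (cases d) auto
    have "x > 0" using d by (auto simp: comps_def x)
    then have "{off<..<off + Suc x} = insert (Suc off) {Suc off<..<Suc off + x}" by auto
    then have nc: "no_cut S off (Suc x # xs) \<longleftrightarrow> Suc off \<notin> S \<and> no_cut S (Suc off) (x # xs)" by auto
    have k: "d = [k] \<longleftrightarrow> xs = []" using d by (auto simp: comps_def x)
    show "comp_weight (Suc (hd d) # tl d) * of_bool (no_cut S off (Suc (hd d) # tl d)) =
      of_bool (Suc off \<notin> S) * (comp_weight d * of_bool (no_cut S (Suc off) d) +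
       (if d = [k] then of_bool (S \<inter> ?I = {}) else 0))"
    proof (cases "xs = []")
      case True
      then have "x = k" using k x by simp
      then show ?thesis using True nc by (auto simp: x comp_weight_def)
    next
      case False
      then have "comp_weight (Suc x # xs) = comp_weight (x # xs)" by (simp add: comp_weight_def)
      then show ?thesis using False nc by (simp add: x)
    qed
  qed
  also have "\<dots> = of_bool (Suc off \<notin> S) * (?W k (Suc off) + of_bool (S \<inter> ?I = {}))"
  proof -
    have "[k] \<in> comps k" using Suc.hyps by (simp add: comps_def)
    then show ?thesis by (simp only: sum_distrib_left[symmetric] sum.distrib) (simp add: sum.delta)
  qed
  finally have W: "?W (Suc k) off =
      - ?W k (Suc off) + of_bool (Suc off \<notin> S) * (?W k (Suc off) + of_bool (S \<inter> ?I = {}))" .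
  show ?case
  proof (cases "Suc off \<in> S")
    case True
    then have "S \<inter> {off<..<off + Suc k} = insert (Suc off) (S \<inter> ?I)" unfolding I by auto
    moreover have "card (insert (Suc off) (S \<inter> ?I)) = Suc (card (S \<inter> ?I))" by simp
    moreover have "initial_segment (insert (Suc off) (S \<inter> ?I)) (insert (Suc off) ?I) \<longleftrightarrow>
       initial_segment (S \<inter> ?I) ?I"
      by (auto simp: initial_segment_def)
    ultimately show ?thesis using W True Suc.IH[of "Suc off"] unfolding I by simp
  next
    case False
    then have e: "S \<inter> {off<..<off + Suc k} = S \<inter> ?I" unfolding I by auto
    have "initial_segment (S \<inter> ?I) (insert (Suc off) ?I) \<longleftrightarrow> S \<inter> ?I = {}"
      using False by (auto simp: initial_segment_def)
    then show ?thesis using W False unfolding e I by auto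
  qed
qed

fun fits :: "nat set \<Rightarrow> (nat \<Rightarrow> sign) \<Rightarrow> nat \<Rightarrow> (nat \<times> sign) list \<Rightarrow> bool" where
  "fits S \<sigma> off [] \<longleftrightarrow> True"
| "fits S \<sigma> off ((d, e) # ds) \<longleftrightarrow> (\<forall>p\<in>{off<..off + d}. \<sigma> p = e) \<and>
     S \<inter> {off<..<off + d} = {} \<and> fits S \<sigma> (off + d) ds"

lemma fits_append:
  "fits S \<sigma> off (xs @ ys) \<longleftrightarrow> fits S \<sigma> off xs \<and> fits S \<sigma> (off + sum_list (map fst xs)) ys"
  by (induction xs arbitrary: off) (auto simp: add.assoc)

lemma fits_map:
  "fits S \<sigma> off (map (\<lambda>x. (x, e)) d) \<longleftrightarrow>
     (\<forall>p\<in>{off<..off + sum_list d}. \<sigma> p = e) \<and> no_cut S off d"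
proof (induction d arbitrary: off)
  case (Cons x d)
  have "{off<..off + sum_list (x # d)} = {off<..off + x} \<union> {off + x<..off + x + sum_list d}" by auto
  then show ?case using Cons by auto
qed auto

text \<open>The contribution of one block to \<open>wt\<close>; the explicit offset lets
  \<open>block_prod\<close> recurse along \<gamma>.\<close>

definition block_val :: "nat set \<Rightarrow> (nat \<Rightarrow> sign) \<Rightarrow> nat \<Rightarrow> nat \<times> bool \<Rightarrow> int" where
  "block_val S \<sigma> off = (\<lambda>(k, b).
     (if initial_segment (S \<inter> {off<..<off + k}) {off<..<off + k} \<and>
         (\<exists>e. \<forall>p\<in>{off<..off + k}. \<sigma> p = e)
      then (-1) ^ card (S \<inter> {off<..<off + k}) *
        (if b \<and> (\<forall>p\<in>{off<..off + k}. \<sigma> p = Minus) then -1 else 1) else 0))"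

lemma sum_fits_block:
  assumes "0 < k"
  shows "(\<Sum>e\<in>UNIV. bar_sign b e * (\<Sum>d\<in>comps k. comp_weight d *
      of_bool (fits S \<sigma> off (map (\<lambda>x. (x, e)) d)))) = of_int (block_val S \<sigma> off (k, b))"
proof -
  define c where "c e \<longleftrightarrow> (\<forall>p\<in>{off<..off + k}. \<sigma> p = e)" for e
  define i where "i \<longleftrightarrow> initial_segment (S \<inter> {off<..<off + k}) {off<..<off + k}"
  define m where "m = card (S \<inter> {off<..<off + k})"
  have fits_eq: "fits S \<sigma> off (map (\<lambda>x. (x, e)) d) \<longleftrightarrow> c e \<and> no_cut S off d"
    if "d \<in> comps k" for e d
    using that unfolding fits_map comps_def c_def by simp
  have inner: "(\<Sum>d\<in>comps k. comp_weight d * of_bool (fits S \<sigma> off (map (\<lambda>x. (x, e)) d))) =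
    of_bool (c e) * (if i then (-1) ^ m else 0)" for e
  proof -
    have "(\<Sum>d\<in>comps k. comp_weight d * of_bool (fits S \<sigma> off (map (\<lambda>x. (x, e)) d))) =
        (\<Sum>d\<in>comps k. of_bool (c e) * (comp_weight d * of_bool (no_cut S off d)))"
      by (rule sum.cong[OF refl]) (simp only: fits_eq of_bool_conj mult.left_commute)
    also have "\<dots> = of_bool (c e) * (if i then (-1) ^ m else 0)"
      by (simp only: sum_distrib_left[symmetric] sum_comps_no_cut[OF assms] i_def m_def)
    finally show ?thesis .
  qed
  \<comment> \<open>The block is nonempty, so at most one alphabet can be constant on it and at most
    one summand over \<open>e\<close> survives.\<close>
  have "off + k \<in> {off<..off + k}" using assms by simp
  then have nb: "\<not> (c Plus \<and> c Minus)" unfolding c_def by (metis sign.distinct(1))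
  have "(\<exists>e. c e) \<longleftrightarrow> c Plus \<or> c Minus" by (metis sign.exhaust)
  then have bv: "block_val S \<sigma> off (k, b) = (if i \<and> (c Plus \<or> c Minus)
      then (-1) ^ m * (if b \<and> c Minus then -1 else 1) else 0)"
    unfolding block_val_def prod.case c_def[symmetric] i_def[symmetric] m_def[symmetric] by simp
  show ?thesis
    unfolding inner bv UNIV_sign using nb
    by (cases "c Plus"; cases "c Minus"; cases i) (simp_all add: bar_sign_def)
qed

fun block_prod :: "nat set \<Rightarrow> (nat \<Rightarrow> sign) \<Rightarrow> nat \<Rightarrow> signed_comp \<Rightarrow> int" where
  "block_prod S \<sigma> off [] = 1"
| "block_prod S \<sigma> off (g # \<gamma>) = block_val S \<sigma> off g * block_prod S \<sigma> (off + fst g) \<gamma>"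

lemma sum_pull:
  fixes b :: "'e \<Rightarrow> 'a :: comm_ring_1"
  shows "(\<Sum>e\<in>E. b e * (\<Sum>d\<in>D. w d * (A * B e d * C))) =
    A * (\<Sum>e\<in>E. b e * (\<Sum>d\<in>D. w d * B e d)) * C"
  by (simp add: sum_distrib_left sum_distrib_right mult_ac)

text \<open>The indicator factors over consecutive blocks, and the later factors depend on the
  chosen composition only through its total size. Therefore the nested sum is a product of the sums
  treated in \<open>sum_fits_block\<close>.\<close>

lemma refine_sum_fits:
  assumes "\<forall>g\<in>set \<gamma>. 0 < fst g"
  shows "refine_sum \<gamma> acc (\<lambda>ds. of_bool (fits S \<sigma> 0 ds)) =
    of_bool (fits S \<sigma> 0 acc) * of_int (block_prod S \<sigma> (sum_list (map fst acc)) \<gamma>)"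
  using assms
proof (induction \<gamma> arbitrary: acc)
  case (Cons g \<gamma>)
  obtain k b where g: "g = (k, b)" by force
  let ?off = "sum_list (map fst acc)"
  have "refine_sum (g # \<gamma>) acc (\<lambda>ds. of_bool (fits S \<sigma> 0 ds)) =
    (\<Sum>e\<in>UNIV. bar_sign b e * (\<Sum>d\<in>comps k. comp_weight d *
      (of_bool (fits S \<sigma> 0 acc) * of_bool (fits S \<sigma> ?off (map (\<lambda>x. (x, e)) d)) *
       of_int (block_prod S \<sigma> (?off + k) \<gamma>))))"
    unfolding g refine_sum.simps
  proof (rule sum.cong[OF refl], rule arg_cong2[where f = "(*)", OF refl],
      rule sum.cong[OF refl], rule arg_cong2[where f = "(*)", OF refl])
    fix e d assume d: "d \<in> comps k"
    have "sum_list (map fst (acc @ map (\<lambda>x. (x, e)) d)) = ?off + k"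
      using d by (simp add: comps_def comp_def)
    moreover have "\<forall>g\<in>set \<gamma>. 0 < fst g" using Cons.prems by simp
    ultimately show "refine_sum \<gamma> (acc @ map (\<lambda>x. (x, e)) d) (\<lambda>ds. of_bool (fits S \<sigma> 0 ds)) =
      of_bool (fits S \<sigma> 0 acc) * of_bool (fits S \<sigma> ?off (map (\<lambda>x. (x, e)) d)) *
       of_int (block_prod S \<sigma> (?off + k) \<gamma>)"
      by (simp only: Cons.IH fits_append of_bool_conj add_0)
  qed
  also have "\<dots> = of_bool (fits S \<sigma> 0 acc) *
     (\<Sum>e\<in>UNIV. bar_sign b e * (\<Sum>d\<in>comps k. comp_weight d * of_bool (fits S \<sigma> ?off (map (\<lambda>x. (x, e)) d)))) *
     of_int (block_prod S \<sigma> (?off + k) \<gamma>)"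
    by (rule sum_pull)
  also have "(\<Sum>e\<in>UNIV. bar_sign b e * (\<Sum>d\<in>comps k. comp_weight d *
      of_bool (fits S \<sigma> ?off (map (\<lambda>x. (x, e)) d)))) = of_int (block_val S \<sigma> ?off g)"
    unfolding g by (rule sum_fits_block) (use Cons.prems g in simp)
  finally show ?case by (simp only: block_prod.simps g fst_conv of_int_mult mult.assoc)
qed simp

section \<open>Comparison of the block product with \<open>wt\<close>\<close>

lemma psum_0 [simp]: "psum \<gamma> 0 = 0"
  by (simp add: psum_def)

lemma psum_Cons_Suc: "psum (g # \<gamma>) (Suc i) = fst g + psum \<gamma> i"
  by (simp add: psum_def)

lemma psum_Suc: "i < length \<gamma> \<Longrightarrow> psum \<gamma> (Suc i) = psum \<gamma> i + fst (\<gamma> ! i)"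
  by (simp add: psum_def take_Suc_conv_app_nth)

lemma psum_mono: "i \<le> j \<Longrightarrow> psum \<gamma> i \<le> psum \<gamma> j"
  by (metis le_add1 le_add_diff_inverse map_append psum_def sum_list_append take_add)

lemma block_prod_eq:
  "block_prod S \<sigma> off \<gamma> = (\<Prod>i<length \<gamma>. block_val S \<sigma> (off + psum \<gamma> i) (\<gamma> ! i))"
proof (induction \<gamma> arbitrary: off)
  case (Cons g \<gamma>)
  then show ?case
    by (simp add: prod.lessThan_Suc_shift psum_Cons_Suc add.assoc del: prod.lessThan_Suc)
qed simp

lemma ex_psum_interval:
  assumes "0 < s" "s \<le> psum \<gamma> (length \<gamma>)"
  shows "\<exists>i<length \<gamma>. psum \<gamma> i < s \<and> s \<le> psum \<gamma> (Suc i)"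
proof -
  define m where "m = (LEAST j. s \<le> psum \<gamma> j)"
  have m: "s \<le> psum \<gamma> m" unfolding m_def using assms(2) by (rule LeastI)
  have "m \<noteq> 0" using m assms(1) by (intro notI) simp
  then obtain i where i: "m = Suc i" by (cases m) auto
  have "\<not> s \<le> psum \<gamma> i" using not_less_Least[of i "\<lambda>j. s \<le> psum \<gamma> j"] i m_def by simp
  moreover have "m \<le> length \<gamma>" unfolding m_def using assms(2) by (rule Least_le)
  ultimately show ?thesis using m i by (intro exI[of _ i]) auto
qed

lemma card_minus_psum:
  assumes S: "S \<subseteq> {1..psum \<gamma> (length \<gamma>)}"
  shows "card (S - psum \<gamma> ` {1..length \<gamma>}) =
    (\<Sum>i<length \<gamma>. card (S \<inter> {psum \<gamma> i<..<psum \<gamma> (Suc i)}))"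
proof -
  have "S - psum \<gamma> ` {1..length \<gamma>} = (\<Union>i<length \<gamma>. S \<inter> {psum \<gamma> i<..<psum \<gamma> (Suc i)})"
  proof (intro equalityI subsetI)
    fix s assume s: "s \<in> S - psum \<gamma> ` {1..length \<gamma>}"
    then have "0 < s" "s \<le> psum \<gamma> (length \<gamma>)" using S by auto
    then obtain i where i: "i < length \<gamma>" "psum \<gamma> i < s" "s \<le> psum \<gamma> (Suc i)"
      using ex_psum_interval by blast
    moreover have "s \<noteq> psum \<gamma> (Suc i)" using s i by auto
    ultimately show "s \<in> (\<Union>i<length \<gamma>. S \<inter> {psum \<gamma> i<..<psum \<gamma> (Suc i)})" using s by auto
  next
    fix s assume "s \<in> (\<Union>i<length \<gamma>. S \<inter> {psum \<gamma> i<..<psum \<gamma> (Suc i)})"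
    then obtain i where i: "i < length \<gamma>" "s \<in> S" "psum \<gamma> i < s" "s < psum \<gamma> (Suc i)" by auto
    have "s \<noteq> psum \<gamma> j" for j
      using i psum_mono[of j i \<gamma>] psum_mono[of "Suc i" j \<gamma>] by (cases "j \<le> i") auto
    then show "s \<in> S - psum \<gamma> ` {1..length \<gamma>}" using i by auto
  qed
  also have "card \<dots> = (\<Sum>i<length \<gamma>. card (S \<inter> {psum \<gamma> i<..<psum \<gamma> (Suc i)}))"
  proof (rule card_UN_disjoint, simp, simp, intro ballI impI)
    fix i j :: nat assume "i \<noteq> j"
    then show "(S \<inter> {psum \<gamma> i<..<psum \<gamma> (Suc i)}) \<inter> (S \<inter> {psum \<gamma> j<..<psum \<gamma> (Suc j)}) = {}"
      using psum_mono[of "Suc i" j \<gamma>] psum_mono[of "Suc j" i \<gamma>] by (cases "i < j") auto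
  qed
  finally show ?thesis .
qed

lemma wt_eq_block_prod:
  assumes S: "fst \<tau> \<subseteq> {1..psum \<gamma> (length \<gamma>)}"
  shows "wt \<gamma> \<tau> = block_prod (fst \<tau>) (sign_vector \<tau>) 0 \<gamma>"
proof -
  let ?S = "fst \<tau>" and ?\<sigma> = "sign_vector \<tau>"
  let ?bad = "\<lambda>i. \<not> initial_segment (?S \<inter> {psum \<gamma> i<..<psum \<gamma> (Suc i)}) {psum \<gamma> i<..<psum \<gamma> (Suc i)} \<or>
          \<not> (\<exists>e. \<forall>j\<in>{psum \<gamma> i<..psum \<gamma> (Suc i)}. ?\<sigma> j = e)"
  let ?m = "\<lambda>i. snd (\<gamma> ! i) \<and> (\<forall>j\<in>{psum \<gamma> i<..psum \<gamma> (Suc i)}. ?\<sigma> j = Minus)"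
  have val: "block_val ?S ?\<sigma> (0 + psum \<gamma> i) (\<gamma> ! i) = (if ?bad i then 0
      else (-1) ^ card (?S \<inter> {psum \<gamma> i<..<psum \<gamma> (Suc i)}) * (if ?m i then -1 else 1))"
    if "i < length \<gamma>" for i
    unfolding block_val_def psum_Suc[OF that] case_prod_beta add_0 by (simp only: de_Morgan_disj not_not if_not_P split: if_splits) blast
  show ?thesis
  proof (cases "\<exists>i<length \<gamma>. ?bad i")
    case True
    then obtain i where i: "i < length \<gamma>" "?bad i" by blast
    then have "block_val ?S ?\<sigma> (0 + psum \<gamma> i) (\<gamma> ! i) = 0" using val[OF i(1)] by simp
    then have "block_prod ?S ?\<sigma> 0 \<gamma> = 0" unfolding block_prod_eq using i(1) by (intro prod_zero) auto
    then show ?thesis using True by (simp add: wt_def)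
  next
    case False
    then have "block_prod ?S ?\<sigma> 0 \<gamma> = (\<Prod>i<length \<gamma>.
        (-1) ^ card (?S \<inter> {psum \<gamma> i<..<psum \<gamma> (Suc i)}) * (if ?m i then -1 else 1))"
      unfolding block_prod_eq by (intro prod.cong refl) (subst val, auto)
    also have "\<dots> = (-1) ^ (\<Sum>i<length \<gamma>. card (?S \<inter> {psum \<gamma> i<..<psum \<gamma> (Suc i)})) *
        (\<Prod>i<length \<gamma>. if ?m i then -1 else 1)"
      by (simp add: prod.distrib power_sum)
    also have "(\<Prod>i<length \<gamma>. if ?m i then -1 else 1 :: int) = (-1) ^ card {i. i < length \<gamma> \<and> ?m i}"
      by (simp add: prod.If_cases lessThan_def Collect_conj_eq)
    finally show ?thesis using False card_minus_psum[OF S] by (simp add: wt_def power_add)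
  qed
qed

subsection \<open>Standardization\<close>

text \<open>The weakly increasing word in which part number \<open>j\<close> is repeated as often as
  its size. With \<open>L = labels 0 ds\<close>, the label of an entry \<open>p\<close> of [n] is
  \<open>L ! (p - 1)\<close>, since entries start at 1 and list indices at 0.\<close>

fun labels :: "nat \<Rightarrow> (nat \<times> sign) list \<Rightarrow> nat list" where
  "labels i [] = []"
| "labels i ((d, e) # ds) = replicate d i @ labels (Suc i) ds"

lemma length_labels: "length (labels i ds) = sum_list (map fst ds)"
  by (induction i ds rule: labels.induct) auto

lemma labels_bounds: "x \<in> set (labels i ds) \<Longrightarrow> i \<le> x \<and> x < i + length ds"
  by (induction i ds rule: labels.induct) fastforce+

lemma sorted_labels: "sorted (labels i ds)"
proof (induction i ds rule: labels.induct)
  case (2 i d e ds)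
  then show ?case using labels_bounds[of _ "Suc i" ds] by (fastforce simp: sorted_append)
qed simp

lemma mset_labels: "mset (labels i ds) = (\<Sum>j<length ds. replicate_mset (fst (ds ! j)) (i + j))"
proof (induction i ds rule: labels.induct)
  case (2 i d e ds)
  then show ?case by (simp add: sum.lessThan_Suc_shift del: sum.lessThan_Suc)
qed simp

lemma image_mset_sum: "image_mset f (\<Sum>x\<in>A. g x) = (\<Sum>x\<in>A. image_mset f (g x))"
  by (induction A rule: infinite_finite_induct) auto

lemma content_labels: "content ds = image_mset (\<lambda>j. var_of (snd (ds ! j)) j) (mset (labels 0 ds))"
  by (simp add: content_def mset_labels image_mset_sum)

lemma all_less_add: "(\<forall>q<a + b. P q) \<longleftrightarrow> (\<forall>q<a. P q) \<and> (\<forall>q<b. P (a + q))" for a b :: nat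
  by (metis add_less_cancel_left le_add_diff_inverse not_less trans_less_add1)

text \<open>Turns the recursive condition into one on adjacent positions, the form needed to compare
  with cells. The start label \<open>i\<close> is arbitrary for the induction.\<close>

lemma fits_labels:
  "fits S \<sigma> off ds \<longleftrightarrow> (\<forall>q<length (labels i ds). \<sigma> (off + Suc q) = snd (ds ! (labels i ds ! q - i)) \<and>
     (Suc q < length (labels i ds) \<and> labels i ds ! q = labels i ds ! Suc q \<longrightarrow> off + Suc q \<notin> S))"
proof (induction ds arbitrary: off i)
  case (Cons c ds)
  obtain d e where c: "c = (d, e)" by force
  define L where "L = labels (Suc i) ds"
  have L: "labels i (c # ds) = replicate d i @ L" by (simp add: c L_def)
  have Lb: "Suc i \<le> L ! q" if "q < length L" for q
    using labels_bounds[of "L ! q" "Suc i" ds] that nth_mem[OF that] by (simp add: L_def)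
  let ?\<Phi> = "\<lambda>q. \<sigma> (off + Suc q) = snd ((c # ds) ! ((replicate d i @ L) ! q - i)) \<and>
     (Suc q < length (replicate d i @ L) \<and> (replicate d i @ L) ! q = (replicate d i @ L) ! Suc q \<longrightarrow> off + Suc q \<notin> S)"
  have "(\<forall>q<d. ?\<Phi> q) \<longleftrightarrow> (\<forall>q<d. \<sigma> (off + Suc q) = e \<and> (Suc q < d \<longrightarrow> off + Suc q \<notin> S))"
  proof (intro all_cong)
    fix q assume q: "q < d"
    have "Suc q < length (replicate d i @ L) \<and> (replicate d i @ L) ! q = (replicate d i @ L) ! Suc q \<longleftrightarrow> Suc q < d"
    proof (cases "Suc q < d")
      case False
      \<comment> \<open>At the last position of the part, the next label, if any, is at least
        \<open>Suc i\<close>, so no condition on \<open>S\<close> arises there.\<close>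
      then have "Suc q = d" using q by simp
      then show ?thesis using Lb[of 0] q by (auto simp: nth_append)
    qed (simp add: nth_append)
    then show "?\<Phi> q \<longleftrightarrow> \<sigma> (off + Suc q) = e \<and> (Suc q < d \<longrightarrow> off + Suc q \<notin> S)"
      using q by (simp add: nth_append c)
  qed
  also have "\<dots> \<longleftrightarrow> (\<forall>p\<in>{off<..off + d}. \<sigma> p = e) \<and> S \<inter> {off<..<off + d} = {}"
  proof -
    have 1: "(\<forall>q<d. \<sigma> (off + Suc q) = e) \<longleftrightarrow> (\<forall>p\<in>{off<..off + d}. \<sigma> p = e)"
    proof (intro iffI ballI allI impI)
      fix p assume h: "\<forall>q<d. \<sigma> (off + Suc q) = e" and p: "p \<in> {off<..off + d}"
      have "p = off + Suc (p - off - 1)" "p - off - 1 < d" using p by auto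
      then show "\<sigma> p = e" using h by metis
    qed auto
    have 2: "(\<forall>q<d. Suc q < d \<longrightarrow> off + Suc q \<notin> S) \<longleftrightarrow> S \<inter> {off<..<off + d} = {}"
    proof (intro iffI equals0I allI impI)
      fix p assume h: "\<forall>q<d. Suc q < d \<longrightarrow> off + Suc q \<notin> S" and p: "p \<in> S \<inter> {off<..<off + d}"
      have "p = off + Suc (p - off - 1)" "Suc (p - off - 1) < d" using p by auto
      then show False using h p by (metis IntD1 Suc_lessD)
    next
      fix q assume "S \<inter> {off<..<off + d} = {}" "Suc q < d"
      moreover have "off + Suc q \<in> {off<..<off + d}" using \<open>Suc q < d\<close> by simp
      ultimately show "off + Suc q \<notin> S" by blast
    qed
    show ?thesis using 1 2 by blast
  qed
  finally have A: "(\<forall>q<d. ?\<Phi> q) \<longleftrightarrow> (\<forall>p\<in>{off<..off + d}. \<sigma> p = e) \<and> S \<inter> {off<..<off + d} = {}" .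
  have B: "(\<forall>q<length L. ?\<Phi> (d + q)) \<longleftrightarrow> fits S \<sigma> (off + d) ds"
    unfolding Cons.IH[of "off + d" "Suc i"] L_def[symmetric]
  proof (intro all_cong)
    fix q assume q: "q < length L"
    have "L ! q - i = Suc (L ! q - Suc i)" using Lb[OF q] by simp
    then show "?\<Phi> (d + q) \<longleftrightarrow> \<sigma> (off + d + Suc q) = snd (ds ! (L ! q - Suc i)) \<and>
     (Suc q < length L \<and> L ! q = L ! Suc q \<longrightarrow> off + d + Suc q \<notin> S)"
      using nth_append_right[of "replicate d i" "d + Suc q" L]
      by (simp add: nth_append add.assoc)
  qed
  show ?case unfolding L using A B by (simp only: c fits.simps length_append length_replicate all_less_add conj_assoc)
qed simp

section \<open>Diagrams, ranks and bitableaux as single fillings\<close>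

lemma finite_diagram [simp]: "finite (diagram l)"
proof -
  have "diagram l = (SIGMA r:{..<length l}. {..<l ! r})" by (auto simp: diagram_def)
  then show ?thesis by simp
qed

lemma card_diagram: "card (diagram l) = sum_list l"
proof -
  have "diagram l = (SIGMA r:{..<length l}. {..<l ! r})" by (auto simp: diagram_def)
  then show ?thesis by (simp add: sum_list_sum_nth atLeast0LessThan)
qed

lemma diagram_down:
  assumes l: "is_partition l" and d: "(r', c') \<in> diagram l" and "r \<le> r'" "c \<le> c'"
  shows "(r, c) \<in> diagram l"
proof -
  have "l ! r' \<le> l ! r"
    using l d assms(3) sorted_wrt_nth_less[of "(\<ge>)" l r r']
    by (cases "r = r'") (auto simp: is_partition_def diagram_def)
  then show ?thesis using d assms(3,4) by (auto simp: diagram_def)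
qed

lemma bij_betw_rank:
  fixes q :: "'a \<Rightarrow> nat"
  assumes q: "bij_betw q C {1..n}" and x: "x \<in> C"
  shows "card {y \<in> C. q y \<le> q x} = q x"
proof -
  have "q ` {y \<in> C. q y \<le> q x} = {1..q x}"
  proof (intro equalityI subsetI)
    fix p assume "p \<in> {1..q x}"
    moreover have "q x \<le> n" using q x by (auto simp: bij_betw_def)
    ultimately have "p \<in> q ` C" using q by (auto simp: bij_betw_def)
    then show "p \<in> q ` {y \<in> C. q y \<le> q x}" using \<open>p \<in> {1..q x}\<close> by auto
  qed (use q in \<open>auto simp: bij_betw_def\<close>)
  moreover have "inj_on q {y \<in> C. q y \<le> q x}"
    using q by (auto simp: bij_betw_def inj_on_def)
  ultimately show ?thesis by (metis card_atLeastAtMost card_image diff_Suc_1)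
qed

text \<open>Each element is numbered by how many elements lie weakly below it. Applied to
  \<open>cell_less\<close>, this constructs the standardization.\<close>

lemma ex_rank:
  assumes fin: "finite C"
    and irr: "\<And>x. x \<in> C \<Longrightarrow> \<not> R x x"
    and tr: "\<And>x y z. R x y \<Longrightarrow> R y z \<Longrightarrow> R x z"
    and tot: "\<And>x y. x \<in> C \<Longrightarrow> y \<in> C \<Longrightarrow> x \<noteq> y \<Longrightarrow> R x y \<or> R y x"
  shows "\<exists>q. bij_betw q C {1..card C} \<and> (\<forall>x\<in>C. \<forall>y\<in>C. R x y \<longrightarrow> q x < (q y :: nat))"
proof -
  define q where "q x = card {y \<in> C. y = x \<or> R y x}" for x
  have mono: "q x < q y" if "x \<in> C" "y \<in> C" "R x y" for x y
    unfolding q_def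
  proof (rule psubset_card_mono)
    have "y \<notin> {z \<in> C. z = x \<or> R z x}" using that irr tr by blast
    moreover have "{z \<in> C. z = x \<or> R z x} \<subseteq> {z \<in> C. z = y \<or> R z y}" using that tr by blast
    ultimately show "{z \<in> C. z = x \<or> R z x} \<subset> {z \<in> C. z = y \<or> R z y}" using that by blast
  qed (use fin in simp)
  have inj: "inj_on q C"
    using mono tot by (intro inj_onI) (metis less_irrefl)
  have "q x \<in> {1..card C}" if "x \<in> C" for x
  proof -
    have "{y \<in> C. y = x \<or> R y x} \<noteq> {}" using that by blast
    then have "q x \<noteq> 0" using fin by (simp add: q_def)
    moreover have "q x \<le> card C" unfolding q_def using fin by (intro card_mono) auto
    ultimately show ?thesis by simp
  qed
  then have "q ` C \<subseteq> {1..card C}" by blast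
  then have "q ` C = {1..card C}"
    using card_image[OF inj] by (intro card_subset_eq) auto
  then show ?thesis using inj mono by (auto simp: bij_betw_def)
qed

type_synonym cell = "sign \<times> nat \<times> nat"

locale bishape =
  fixes n :: nat and lam mu :: "nat list"
  assumes bip: "is_bipartition n lam mu"
begin

text \<open>Tagging each cell with its tableau turns a bitableau into one function on one set, so
  that standardization is done once, across both shapes.\<close>

definition cells :: "cell set" where
  "cells = {(e, b). b \<in> diagram (if e = Plus then lam else mu)}"

definition both :: "filling \<times> filling \<Rightarrow> cell \<Rightarrow> nat" where
  "both Q x = (if fst x = Plus then fst Q (snd x) else snd Q (snd x))"

definition unboth :: "(cell \<Rightarrow> nat) \<Rightarrow> filling \<times> filling" where
  "unboth q = (\<lambda>b\<in>diagram lam. q (Plus, b), \<lambda>b\<in>diagram mu. q (Minus, b))"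

definition standard :: "(cell \<Rightarrow> nat) \<Rightarrow> bool" where
  "standard q \<longleftrightarrow> bij_betw q cells {1..n} \<and>
     (\<forall>e r c c'. c < c' \<and> (e, r, c) \<in> cells \<and> (e, r, c') \<in> cells \<longrightarrow> q (e, r, c) < q (e, r, c')) \<and>
     (\<forall>e r r' c. r < r' \<and> (e, r, c) \<in> cells \<and> (e, r', c) \<in> cells \<longrightarrow> q (e, r, c) < q (e, r', c))"

definition semistandard :: "(cell \<Rightarrow> nat) \<Rightarrow> bool" where
  "semistandard q \<longleftrightarrow>
     (\<forall>e r c c'. c < c' \<and> (e, r, c) \<in> cells \<and> (e, r, c') \<in> cells \<longrightarrow> q (e, r, c) \<le> q (e, r, c')) \<and>
     (\<forall>e r r' c. r < r' \<and> (e, r, c) \<in> cells \<and> (e, r', c) \<in> cells \<longrightarrow> q (e, r, c) < q (e, r', c))"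

lemma cells_eq: "cells = Pair Plus ` diagram lam \<union> Pair Minus ` diagram mu"
proof (intro equalityI subsetI)
  fix x assume "x \<in> cells"
  then show "x \<in> Pair Plus ` diagram lam \<union> Pair Minus ` diagram mu"
    by (cases "fst x") (auto simp: cells_def)
qed (auto simp: cells_def)

lemma finite_cells [simp]: "finite cells"
  by (simp add: cells_eq)

lemma card_cells: "card cells = n"
proof -
  have "card cells = card (Pair Plus ` diagram lam) + card (Pair Minus ` diagram mu)"
    unfolding cells_eq by (intro card_Un_disjoint) auto
  also have "\<dots> = sum_list lam + sum_list mu"
    by (simp add: card_image inj_on_def card_diagram)
  finally show ?thesis using bip by (simp add: is_bipartition_def)
qed

lemma cells_down:
  "(e, r', c') \<in> cells \<Longrightarrow> r \<le> r' \<Longrightarrow> c \<le> c' \<Longrightarrow> (e, r, c) \<in> cells"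
  using bip diagram_down[of lam r' c' r c] diagram_down[of mu r' c' r c]
  by (cases e) (simp_all add: cells_def is_bipartition_def)

lemma image_mset_cells:
  "image_mset (\<lambda>b. Inl (P b)) (mset_set (diagram lam)) + image_mset (\<lambda>b. Inr (N b)) (mset_set (diagram mu)) =
   image_mset (\<lambda>x. var_of (fst x) (both (P, N) x)) (mset_set cells)"
proof -
  have "mset_set cells = mset_set (Pair Plus ` diagram lam) + mset_set (Pair Minus ` diagram mu)"
    unfolding cells_eq by (intro mset_set_Union) auto
  also have "mset_set (Pair Plus ` diagram lam) = image_mset (Pair Plus) (mset_set (diagram lam))"
    by (simp add: image_mset_mset_set inj_on_def)
  also have "mset_set (Pair Minus ` diagram mu) = image_mset (Pair Minus) (mset_set (diagram mu))"
    by (simp add: image_mset_mset_set inj_on_def)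
  finally show ?thesis
    by (simp add: multiset.map_comp comp_def both_def var_of_def)
qed

lemma standard_cong: "standard q \<Longrightarrow> (\<And>x. x \<in> cells \<Longrightarrow> q x = q' x) \<Longrightarrow> standard q'"
  unfolding standard_def using bij_betw_cong[of cells q q'] by metis

lemma semistandard_cong:
  "semistandard q \<Longrightarrow> (\<And>x. x \<in> cells \<Longrightarrow> q x = q' x) \<Longrightarrow> semistandard q'"
  unfolding semistandard_def by metis

lemma both_unboth: "x \<in> cells \<Longrightarrow> both (unboth q) x = q x"
  by (cases x; cases "fst x") (auto simp: both_def unboth_def cells_def)

lemma both_inj:
  assumes "P \<in> extensional (diagram lam)" "N \<in> extensional (diagram mu)"
    "P' \<in> extensional (diagram lam)" "N' \<in> extensional (diagram mu)"
    and e: "\<And>x. x \<in> cells \<Longrightarrow> both (P, N) x = both (P', N') x"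
  shows "P = P'" "N = N'"
proof -
  have "P b = P' b" if "b \<in> diagram lam" for b
    using e[of "(Plus, b)"] that by (simp add: both_def cells_def)
  then show "P = P'" using assms by (intro extensionalityI[of P "diagram lam"]) auto
  have "N b = N' b" if "b \<in> diagram mu" for b
    using e[of "(Minus, b)"] that by (simp add: both_def cells_def)
  then show "N = N'" using assms by (intro extensionalityI[of N "diagram mu"]) auto
qed

lemma bij_betw_both:
  "bij_betw (both (P, N)) cells {1..n} \<longleftrightarrow> inj_on P (diagram lam) \<and> inj_on N (diagram mu) \<and>
     P ` diagram lam \<inter> N ` diagram mu = {} \<and> P ` diagram lam \<union> N ` diagram mu = {1..n}"
proof -
  have "both (P, N) ` cells = P ` diagram lam \<union> N ` diagram mu"
    unfolding cells_eq by (simp only: image_Un image_image) (simp add: both_def)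
  moreover have "inj_on (both (P, N)) cells \<longleftrightarrow> inj_on P (diagram lam) \<and> inj_on N (diagram mu) \<and>
     P ` diagram lam \<inter> N ` diagram mu = {}"
  proof -
    have "inj_on (both (P, N)) (Pair Plus ` diagram lam) \<longleftrightarrow> inj_on P (diagram lam)"
      "inj_on (both (P, N)) (Pair Minus ` diagram mu) \<longleftrightarrow> inj_on N (diagram mu)"
      by (simp_all add: inj_on_def both_def)
    moreover have "Pair Plus ` diagram lam - Pair Minus ` diagram mu = Pair Plus ` diagram lam"
      "Pair Minus ` diagram mu - Pair Plus ` diagram lam = Pair Minus ` diagram mu" by auto
    moreover have "both (P, N) ` Pair Plus ` diagram lam = P ` diagram lam"
      "both (P, N) ` Pair Minus ` diagram mu = N ` diagram mu"
      by (simp_all only: image_image) (simp_all add: both_def)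
    ultimately show ?thesis unfolding cells_eq inj_on_Un by (simp only:)
  qed
  ultimately show ?thesis unfolding bij_betw_def by (simp only: conj_assoc)
qed

lemma all_sign: "(\<forall>e. A e) \<longleftrightarrow> A Plus \<and> A Minus"
  by (metis sign.exhaust)

lemma row_strict_both:
  "(\<forall>e r c c'. c < c' \<and> (e, r, c) \<in> cells \<and> (e, r, c') \<in> cells \<longrightarrow>
     both (P, N) (e, r, c) < both (P, N) (e, r, c')) \<longleftrightarrow> row_strict lam P \<and> row_strict mu N"
  unfolding row_strict_def all_sign by (simp add: cells_def both_def)

lemma row_weak_both:
  "(\<forall>e r c c'. c < c' \<and> (e, r, c) \<in> cells \<and> (e, r, c') \<in> cells \<longrightarrow>
     both (P, N) (e, r, c) \<le> both (P, N) (e, r, c')) \<longleftrightarrow> row_weak lam P \<and> row_weak mu N"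
  unfolding row_weak_def all_sign by (simp add: cells_def both_def)

lemma col_strict_both:
  "(\<forall>e r r' c. r < r' \<and> (e, r, c) \<in> cells \<and> (e, r', c) \<in> cells \<longrightarrow>
     both (P, N) (e, r, c) < both (P, N) (e, r', c)) \<longleftrightarrow> col_strict lam P \<and> col_strict mu N"
  unfolding col_strict_def all_sign by (simp add: cells_def both_def)

lemma SYT2_iff: "(P, N) \<in> SYT2 n lam mu \<longleftrightarrow>
  P \<in> extensional (diagram lam) \<and> N \<in> extensional (diagram mu) \<and> standard (both (P, N))"
  unfolding standard_def bij_betw_both row_strict_both col_strict_both SYT2_def mem_Collect_eq prod.case
  by (simp only: conj_ac)

lemma SSYT_iff: "P \<in> SSYT lam \<and> N \<in> SSYT mu \<longleftrightarrow>
  P \<in> extensional (diagram lam) \<and> N \<in> extensional (diagram mu) \<and> semistandard (both (P, N))"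
  unfolding semistandard_def row_weak_both col_strict_both SSYT_def mem_Collect_eq
  by (simp only: conj_ac)

lemma unboth_extensional:
  "fst (unboth q) \<in> extensional (diagram lam)" "snd (unboth q) \<in> extensional (diagram mu)"
  by (auto simp: unboth_def)

text \<open>The sign read directly from the tableau containing \<open>p\<close>;
  \<open>sign_vector_sDes\<close> identifies it with the sign vector, which is defined through the
  next descent.\<close>

definition sign_at :: "filling \<times> filling \<Rightarrow> nat \<Rightarrow> sign" where
  "sign_at Q p = (if p \<in> fst Q ` diagram lam then Plus else Minus)"

lemma sign_at_both:
  assumes "standard (both Q)" "x \<in> cells"
  shows "sign_at Q (both Q x) = fst x"
proof -
  obtain P N where Q: "Q = (P, N)" by force
  have d: "P ` diagram lam \<inter> N ` diagram mu = {}"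
    using assms(1) bij_betw_both by (simp add: Q standard_def)
  from assms(2) consider b where "x = (Plus, b)" "b \<in> diagram lam" | b where "x = (Minus, b)" "b \<in> diagram mu"
    unfolding cells_eq by auto
  then show ?thesis
  proof cases
    case 2
    then have "N b \<notin> P ` diagram lam" using d by blast
    then show ?thesis using 2 by (simp add: Q both_def sign_at_def)
  qed (simp add: Q both_def sign_at_def)
qed

lemma descent_iff:
  assumes std: "standard (both Q)" and x: "x \<in> cells" and y: "y \<in> cells"
    and xy: "both Q y = Suc (both Q x)"
  shows "both Q x \<in> fst (sDes n lam mu Q) \<longleftrightarrow> fst x \<noteq> fst y \<or> fst (snd x) < fst (snd y)"
proof -
  obtain P N where Q: "Q = (P, N)" by force
  obtain e r c where xe: "x = (e, r, c)" by (cases x) auto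
  obtain e' r' c' where ye: "y = (e', r', c')" by (cases y) auto
  let ?s = "both Q x"
  have bij: "bij_betw (both Q) cells {1..n}" using std by (simp add: standard_def)
  then have rng: "both Q z \<in> {1..n}" if "z \<in> cells" for z using that by (auto simp: bij_betw_def)
  \<comment> \<open>\<open>n\<close> is a member of the descent set by convention and must be
    excluded; the cell \<open>y\<close> with the next entry shows that it is.\<close>
  have s: "?s \<in> {1..n - 1}" "?s \<noteq> n" using rng[OF x] rng[OF y] xy by auto
  have P: "P b = both Q z \<longleftrightarrow> z = (Plus, b)" if "z \<in> cells" "b \<in> diagram lam" for z b
  proof -
    have "(Plus, b) \<in> cells" "both Q (Plus, b) = P b" using that by (auto simp: cells_def both_def Q)
    then show ?thesis using bij that by (metis bij_betw_imp_inj_on inj_on_eq_iff)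
  qed
  have N: "N b = both Q z \<longleftrightarrow> z = (Minus, b)" if "z \<in> cells" "b \<in> diagram mu" for z b
  proof -
    have "(Minus, b) \<in> cells" "both Q (Minus, b) = N b" using that by (auto simp: cells_def both_def Q)
    then show ?thesis using bij that by (metis bij_betw_imp_inj_on inj_on_eq_iff)
  qed
  have s1: "?s + 1 = both Q y" using xy by simp
  have inP: "both Q z \<in> P ` diagram lam \<longleftrightarrow> fst z = Plus" if z: "z \<in> cells" for z
  proof
    assume "both Q z \<in> P ` diagram lam"
    then obtain b where "b \<in> diagram lam" "P b = both Q z" by auto
    then show "fst z = Plus" using P[OF z] by simp
  next
    assume h: "fst z = Plus"
    then have b: "snd z \<in> diagram lam" using z by (auto simp: cells_def)
    have "z = (Plus, snd z)" using h by (metis prod.collapse)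
    then have "P (snd z) = both Q z" using P[OF z b] by blast
    then show "both Q z \<in> P ` diagram lam" using b by (metis imageI)
  qed
  have inN: "both Q z \<in> N ` diagram mu \<longleftrightarrow> fst z = Minus" if z: "z \<in> cells" for z
  proof
    assume "both Q z \<in> N ` diagram mu"
    then obtain b where "b \<in> diagram mu" "N b = both Q z" by auto
    then show "fst z = Minus" using N[OF z] by simp
  next
    assume h: "fst z = Minus"
    then have b: "snd z \<in> diagram mu" using z by (auto simp: cells_def)
    have "z = (Minus, snd z)" using h by (metis prod.collapse)
    then have "N (snd z) = both Q z" using N[OF z b] by blast
    then show "both Q z \<in> N ` diagram mu" using b by (metis imageI)
  qed
  have nP: "next_lower lam P ?s \<longleftrightarrow> e = Plus \<and> e' = Plus \<and> r < r'"
  proof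
    assume "next_lower lam P ?s"
    then obtain a b a' b' where "(a, b) \<in> diagram lam" "(a', b') \<in> diagram lam" "P (a, b) = ?s"
      "P (a', b') = both Q y" "a < a'" unfolding next_lower_def s1 by blast
    then show "e = Plus \<and> e' = Plus \<and> r < r'" using P[OF x] P[OF y] by (auto simp: xe ye)
  next
    assume h: "e = Plus \<and> e' = Plus \<and> r < r'"
    then have "(r, c) \<in> diagram lam" "(r', c') \<in> diagram lam" using x y by (auto simp: xe ye cells_def)
    moreover from this have "P (r, c) = ?s" "P (r', c') = both Q y" using P[OF x] P[OF y] h by (auto simp: xe ye)
    ultimately show "next_lower lam P ?s" unfolding next_lower_def s1 using h by blast
  qed
  have nN: "next_lower mu N ?s \<longleftrightarrow> e = Minus \<and> e' = Minus \<and> r < r'"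
  proof
    assume "next_lower mu N ?s"
    then obtain a b a' b' where "(a, b) \<in> diagram mu" "(a', b') \<in> diagram mu" "N (a, b) = ?s"
      "N (a', b') = both Q y" "a < a'" unfolding next_lower_def s1 by blast
    then show "e = Minus \<and> e' = Minus \<and> r < r'" using N[OF x] N[OF y] by (auto simp: xe ye)
  next
    assume h: "e = Minus \<and> e' = Minus \<and> r < r'"
    then have "(r, c) \<in> diagram mu" "(r', c') \<in> diagram mu" using x y by (auto simp: xe ye cells_def)
    moreover from this have "N (r, c) = ?s" "N (r', c') = both Q y" using N[OF x] N[OF y] h by (auto simp: xe ye)
    ultimately show "next_lower mu N ?s" unfolding next_lower_def s1 using h by blast
  qed
  have "?s \<in> fst (sDes n lam mu Q) \<longleftrightarrow> next_lower lam P ?s \<or> next_lower mu N ?s \<or>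
      (?s \<in> P ` diagram lam \<and> ?s + 1 \<in> N ` diagram mu) \<or> (?s \<in> N ` diagram mu \<and> ?s + 1 \<in> P ` diagram lam)"
    unfolding Q sDes_def Let_def prod.case fst_conv using s unfolding Q by blast
  also have "\<dots> \<longleftrightarrow> fst x \<noteq> fst y \<or> fst (snd x) < fst (snd y)"
    unfolding nP nN s1 inP[OF x] inP[OF y] inN[OF x] inN[OF y]
    by (cases e; cases e') (simp_all add: xe ye)
  finally show ?thesis .
qed


text \<open>The labels \<open>L ! (q x - 1)\<close> respect the signs \<open>sg\<close>, and all descents of \<open>q\<close> occur where the
  label changes.\<close>

definition coherent :: "nat list \<Rightarrow> (nat \<Rightarrow> sign) \<Rightarrow> (cell \<Rightarrow> nat) \<Rightarrow> bool" where
  "coherent L sg q \<longleftrightarrow> (\<forall>x\<in>cells. fst x = sg (L ! (q x - 1))) \<and>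
     (\<forall>x\<in>cells. \<forall>y\<in>cells. q y = Suc (q x) \<and> L ! (q x - 1) = L ! (q y - 1) \<longrightarrow>
        fst (snd y) \<le> fst (snd x))"

text \<open>The standardization order: by label, and from left to right among equal labels.
  Comparing columns is enough because cells with equal labels lie in the same tableau and, by column
  strictness, in different columns.\<close>

definition cell_less :: "(cell \<Rightarrow> nat) \<Rightarrow> cell \<Rightarrow> cell \<Rightarrow> bool" where
  "cell_less t x y \<longleftrightarrow> t x < t y \<or> t x = t y \<and> snd (snd x) < snd (snd y)"

lemma standard_range: "standard q \<Longrightarrow> x \<in> cells \<Longrightarrow> 1 \<le> q x \<and> q x \<le> n"
  by (auto simp: standard_def bij_betw_def)

lemma standard_surj:
  assumes "standard q" "1 \<le> p" "p \<le> n"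
  obtains x where "x \<in> cells" "q x = p"
proof -
  have "p \<in> q ` cells" using assms by (simp add: standard_def bij_betw_def)
  then show ?thesis using that by blast
qed

text \<open>Equal labels force equal signs, so the change of tableau in \<open>descent_iff\<close>
  cannot occur between them and only its row condition is left in \<open>coherent\<close>.\<close>

lemma fits_iff_coherent:
  assumes std: "standard (both Q)" and ds: "sum_list (map fst ds) = n"
  shows "fits (fst (sDes n lam mu Q)) (sign_at Q) 0 ds \<longleftrightarrow>
    coherent (labels 0 ds) (\<lambda>j. snd (ds ! j)) (both Q)"
proof -
  define L where "L = labels 0 ds"
  define q where "q = both Q"
  define S where "S = fst (sDes n lam mu Q)"
  have len: "length L = n" by (simp add: L_def length_labels ds)
  note std' = std[folded q_def]
  have desc: "q x \<in> S \<longleftrightarrow> fst x \<noteq> fst y \<or> fst (snd x) < fst (snd y)"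
    if "x \<in> cells" "y \<in> cells" "q y = Suc (q x)" for x y
    unfolding q_def S_def by (rule descent_iff[OF std]) (use that q_def in auto)
  have sgn: "sign_at Q (q x) = fst x" if "x \<in> cells" for x
    unfolding q_def by (rule sign_at_both[OF std that])
  have "fits S (sign_at Q) 0 ds \<longleftrightarrow> (\<forall>k<n. sign_at Q (Suc k) = snd (ds ! (L ! k)) \<and>
     (Suc k < n \<and> L ! k = L ! Suc k \<longrightarrow> Suc k \<notin> S))"
    unfolding fits_labels[where i = 0] L_def[symmetric] len by simp
  also have "\<dots> \<longleftrightarrow> coherent L (\<lambda>j. snd (ds ! j)) q"
  proof
    assume h: "\<forall>k<n. sign_at Q (Suc k) = snd (ds ! (L ! k)) \<and>
     (Suc k < n \<and> L ! k = L ! Suc k \<longrightarrow> Suc k \<notin> S)"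
    show "coherent L (\<lambda>j. snd (ds ! j)) q"
      unfolding coherent_def
    proof (intro conjI ballI impI)
      fix x assume x: "x \<in> cells"
      have "q x - 1 < n" "Suc (q x - 1) = q x" using standard_range[OF std' x] by auto
      then show "fst x = snd (ds ! (L ! (q x - 1)))" using h sgn[OF x] by metis
    next
      fix x y assume x: "x \<in> cells" and y: "y \<in> cells"
        and e: "q y = Suc (q x) \<and> L ! (q x - 1) = L ! (q y - 1)"
      have "q x - 1 < n" "Suc (q x - 1) = q x" "Suc (q x - 1) < n" "q y - 1 = Suc (q x - 1)"
        using standard_range[OF std' x] standard_range[OF std' y] e by auto
      then have "q x \<notin> S" using h e by metis
      then show "fst (snd y) \<le> fst (snd x)" using desc[OF x y] e by simp
    qed
  next
    assume h: "coherent L (\<lambda>j. snd (ds ! j)) q"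
    show "\<forall>k<n. sign_at Q (Suc k) = snd (ds ! (L ! k)) \<and>
     (Suc k < n \<and> L ! k = L ! Suc k \<longrightarrow> Suc k \<notin> S)"
    proof (intro allI impI conjI)
      fix k assume "k < n"
      then obtain x where x: "x \<in> cells" "q x = Suc k"
        using standard_surj[OF std', of "Suc k"] by auto
      show sx: "sign_at Q (Suc k) = snd (ds ! (L ! k))"
        using h x sgn[OF x(1)] unfolding coherent_def by (metis diff_Suc_1)
    next
      fix k assume "k < n" and k: "Suc k < n \<and> L ! k = L ! Suc k"
      then obtain x where x: "x \<in> cells" "q x = Suc k"
        using standard_surj[OF std', of "Suc k"] by auto
      obtain y where y: "y \<in> cells" "q y = Suc (Suc k)"
        using standard_surj[OF std', of "Suc (Suc k)"] k by auto
      have "fst x = snd (ds ! (L ! k))" "fst y = snd (ds ! (L ! Suc k))"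
        using h x y unfolding coherent_def by (metis diff_Suc_1)+
      moreover have "fst (snd y) \<le> fst (snd x)"
        using h x y k unfolding coherent_def by (metis diff_Suc_1)
      ultimately show "Suc k \<notin> S" using desc[OF x(1) y(1)] x y k by simp
    qed
  qed
  finally show ?thesis by (simp only: S_def L_def q_def)
qed

text \<open>Go through the corner cell in row \<open>r\<close> and column \<open>c'\<close>, which
  is present because the shape is a partition.\<close>

lemma standard_le:
  assumes "standard q" "(e, r', c') \<in> cells" "r \<le> r'" "c \<le> c'"
  shows "q (e, r, c) \<le> q (e, r', c')"
proof -
  have 1: "(e, r, c') \<in> cells" "(e, r, c) \<in> cells" using assms(2-4) cells_down by blast+
  have "q (e, r, c) \<le> q (e, r, c')"
    using assms(1,4) 1 unfolding standard_def by (cases "c = c'") (auto simp: le_less)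
  also have "\<dots> \<le> q (e, r', c')"
    using assms(1-3) 1 unfolding standard_def by (cases "r = r'") (auto simp: le_less)
  finally show ?thesis .
qed

text \<open>If \<open>s\<close> is not a descent, then \<open>s + 1\<close> lies in a column strictly to the right of \<open>s\<close>; hence
  equal labels form horizontal strips.\<close>

lemma coherent_col_less:
  assumes std: "standard q" and coh: "coherent L sg q" and L: "sorted L" "length L = n"
    and x: "x \<in> cells" and y: "y \<in> cells" "q x < q y" "L ! (q x - 1) = L ! (q y - 1)"
  shows "snd (snd x) < snd (snd y)"
  using y
proof (induction "q y" arbitrary: y)
  case (Suc k)
  note y = Suc.prems(1) and eq = Suc.prems(3)
  have step: "snd (snd z) < snd (snd y)" if z: "z \<in> cells" "q y = Suc (q z)" "L ! (q z - 1) = L ! (q y - 1)" for z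
  proof (rule ccontr)
    \<comment> \<open>Otherwise \<open>z\<close> lies weakly below and weakly to the right of
      \<open>y\<close>, so its entry could not be the smaller one.\<close>
    assume nl: "\<not> snd (snd z) < snd (snd y)"
    have f: "fst z = fst y" using coh z y unfolding coherent_def by metis
    have r: "fst (snd y) \<le> fst (snd z)" using coh z y unfolding coherent_def by blast
    obtain e r c where ze: "z = (e, r, c)" by (cases z) auto
    obtain r' c' where ye: "y = (e, r', c')" using f ze by (cases y) auto
    have "q (e, r', c') \<le> q (e, r, c)"
      using z(1) nl r by (intro standard_le[OF std]) (simp_all add: ze ye)
    then show False using z(2) by (simp add: ze ye)
  qed
  have rx: "1 \<le> q x" and ry: "q y \<le> n" using standard_range[OF std] x y by blast+
  have "1 \<le> q y - 1" "q y - 1 \<le> n" using rx ry Suc.prems(2) by auto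
  then obtain z where z: "z \<in> cells" "q z = q y - 1" by (rule standard_surj[OF std])
  have "L ! (q x - 1) \<le> L ! (q z - 1)" "L ! (q z - 1) \<le> L ! (q y - 1)"
    using L rx ry Suc.prems(2) z(2) by (auto intro!: sorted_nth_mono)
  then have lz: "L ! (q z - 1) = L ! (q y - 1)" using eq by simp
  have s: "snd (snd z) < snd (snd y)" using step[OF z(1) _ lz] z(2) Suc.prems(2) by simp
  show ?case
  proof (cases "q x = q z")
    case True
    then have "x = z" using std x z(1) unfolding standard_def bij_betw_def by (metis inj_on_eq_iff)
    then show ?thesis using s by simp
  next
    case False
    then have "snd (snd x) < snd (snd z)"
      using Suc.hyps(1)[OF _ z(1)] Suc.hyps(2) z(2) Suc.prems(2) lz eq by simp
    then show ?thesis using s by simp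
  qed
qed simp

lemma coherent_cell_less:
  assumes std: "standard q" and coh: "coherent L sg q" and L: "sorted L" "length L = n"
    and x: "x \<in> cells" and y: "y \<in> cells" and xy: "q x < q y"
  shows "cell_less (\<lambda>x. L ! (q x - 1)) x y"
proof -
  have "L ! (q x - 1) \<le> L ! (q y - 1)"
    using L standard_range[OF std x] standard_range[OF std y] xy by (intro sorted_nth_mono) auto
  then show ?thesis
    using coherent_col_less[OF std coh L x y xy] unfolding cell_less_def by linarith
qed

text \<open>Larger entries are larger in \<open>cell_less\<close>. In a row this gives weak increase
  of labels; in a column equality is impossible, since equal labels would require different
  columns.\<close>

lemma semistandard_label:
  assumes std: "standard q" and coh: "coherent L sg q" and L: "sorted L" "length L = n"
  shows "semistandard (\<lambda>x. L ! (q x - 1))"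
  unfolding semistandard_def
proof (intro conjI allI impI)
  fix e r and c c' :: nat assume h: "c < c' \<and> (e, r, c) \<in> cells \<and> (e, r, c') \<in> cells"
  then have "q (e, r, c) < q (e, r, c')" using std unfolding standard_def by blast
  then show "L ! (q (e, r, c) - 1) \<le> L ! (q (e, r, c') - 1)"
    using coherent_cell_less[OF std coh L] h unfolding cell_less_def by fastforce
next
  fix e c and r r' :: nat assume h: "r < r' \<and> (e, r, c) \<in> cells \<and> (e, r', c) \<in> cells"
  then have "q (e, r, c) < q (e, r', c)" using std unfolding standard_def by blast
  then show "L ! (q (e, r, c) - 1) < L ! (q (e, r', c) - 1)"
    using coherent_cell_less[OF std coh L] h unfolding cell_less_def by fastforce
qed

text \<open>A coherent standard filling is the ranking of the cells by \<open>cell_less\<close>, so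
  it can be recovered from the labels alone. This is the injectivity of passing to labels.\<close>

lemma coherent_rank:
  assumes std: "standard q" and coh: "coherent L sg q" and L: "sorted L" "length L = n"
    and x: "x \<in> cells"
  shows "q x = card {y \<in> cells. y = x \<or> cell_less (\<lambda>x. L ! (q x - 1)) y x}"
proof -
  have bij: "bij_betw q cells {1..n}" using std by (simp add: standard_def)
  have "q y \<le> q x \<longleftrightarrow> y = x \<or> cell_less (\<lambda>x. L ! (q x - 1)) y x" if y: "y \<in> cells" for y
  proof (cases "y = x")
    case False
    then have "q y < q x \<or> q x < q y"
      using bij x y unfolding bij_betw_def by (metis inj_on_eq_iff linorder_neqE_nat)
    then show ?thesis
    proof
      assume "q y < q x"
      then show ?thesis using coherent_cell_less[OF std coh L y x] by simp
    next
      assume h: "q x < q y"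
      then have "\<not> cell_less (\<lambda>x. L ! (q x - 1)) y x"
        using coherent_cell_less[OF std coh L x y h] unfolding cell_less_def by linarith
      then show ?thesis using h False by simp
    qed
  qed simp
  then have "{y \<in> cells. y = x \<or> cell_less (\<lambda>x. L ! (q x - 1)) y x} = {y \<in> cells. q y \<le> q x}" by blast
  then show ?thesis using bij_betw_rank[OF bij x] by simp
qed

lemma coherent_unique:
  assumes "standard q" "coherent L sg q" "standard q'" "coherent L sg q'" and L: "sorted L" "length L = n"
    and eq: "\<And>x. x \<in> cells \<Longrightarrow> L ! (q x - 1) = L ! (q' x - 1)" and x: "x \<in> cells"
  shows "q x = q' x"
proof -
  have "{y \<in> cells. y = x \<or> cell_less (\<lambda>x. L ! (q x - 1)) y x} =
      {y \<in> cells. y = x \<or> cell_less (\<lambda>x. L ! (q' x - 1)) y x}"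
    using eq x by (intro Collect_cong conj_cong refl disj_cong) (simp add: cell_less_def)
  then show ?thesis
    using coherent_rank[OF assms(1,2) L x] coherent_rank[OF assms(3,4) L x] by simp
qed

lemma map_nth_shift: "length L = n \<Longrightarrow> map (\<lambda>p. L ! (p - 1)) [1..<Suc n] = L"
  by (intro nth_equalityI) (auto simp del: upt_Suc)

lemma content_label:
  assumes std: "standard q" and coh: "coherent L sg q" and L: "length L = n"
  shows "image_mset (\<lambda>x. var_of (fst x) (L ! (q x - 1))) (mset_set cells) =
    image_mset (\<lambda>j. var_of (sg j) j) (mset L)"
proof -
  have bij: "bij_betw q cells {1..n}" using std by (simp add: standard_def)
  have "image_mset (\<lambda>x. var_of (fst x) (L ! (q x - 1))) (mset_set cells) =
      image_mset (\<lambda>x. var_of (sg (L ! (q x - 1))) (L ! (q x - 1))) (mset_set cells)"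
    using coh unfolding coherent_def by (intro image_mset_cong) simp
  also have "\<dots> = image_mset (\<lambda>j. var_of (sg j) j) (image_mset (\<lambda>p. L ! (p - 1)) (image_mset q (mset_set cells)))"
    by (simp add: multiset.map_comp comp_def)
  also have "image_mset q (mset_set cells) = mset_set {1..n}"
    using bij unfolding bij_betw_def by (simp add: image_mset_mset_set)
  also have "mset_set {1..n} = mset [1..<Suc n]"
    by (metis atLeastLessThanSuc_atLeastAtMost mset_upt)
  also have "image_mset (\<lambda>p. L ! (p - 1)) (mset [1..<Suc n]) = mset L"
    by (simp only: mset_map[symmetric] map_nth_shift[OF L])
  finally show ?thesis .
qed

text \<open>Surjectivity: number the cells along \<open>cell_less\<close>. Reading \<open>t\<close>
  in this order gives a sorted list with the multiset of \<open>L\<close>, hence \<open>L\<close>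
  itself.\<close>

lemma ex_standardization:
  assumes ss: "semistandard t" and L: "sorted L" "length L = n"
    and ct: "image_mset (\<lambda>x. var_of (fst x) (t x)) (mset_set cells) =
      image_mset (\<lambda>j. var_of (sg j) j) (mset L)"
  shows "\<exists>q. standard q \<and> coherent L sg q \<and> (\<forall>x\<in>cells. L ! (q x - 1) = t x)"
proof -
  \<comment> \<open>The content records the alphabet of every label, so it determines the tableau in
    which each label occurs.\<close>
  have sgt: "fst x = sg (t x)" if "x \<in> cells" for x
  proof -
    have "var_of (fst x) (t x) \<in># image_mset (\<lambda>j. var_of (sg j) j) (mset L)"
      unfolding ct[symmetric] using that by simp
    then show ?thesis by auto
  qed
  have mt: "image_mset t (mset_set cells) = mset L"
  proof -
    have v: "case_sum id id (var_of e j) = j" for e j by (simp add: var_of_def)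
    show ?thesis using arg_cong[OF ct, of "image_mset (case_sum id id)"]
      by (simp add: multiset.map_comp comp_def v)
  qed
  have row: "t (e, r, c) \<le> t (e, r, c')" if "(e, r, c) \<in> cells" "(e, r, c') \<in> cells" "c < c'" for e r c c'
    using ss that unfolding semistandard_def by blast
  have col: "t (e, r, c) < t (e, r', c)" if "(e, r, c) \<in> cells" "(e, r', c) \<in> cells" "r < r'" for e r r' c
    using ss that unfolding semistandard_def by blast
  have tot: "cell_less t x y \<or> cell_less t y x" if x: "x \<in> cells" and y: "y \<in> cells" and ne: "x \<noteq> y" for x y
  proof (rule ccontr)
    assume "\<not> (cell_less t x y \<or> cell_less t y x)"
    then have e: "t x = t y" "snd (snd x) = snd (snd y)" unfolding cell_less_def by linarith+
    have f: "fst x = fst y" using sgt[OF x] sgt[OF y] e by simp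
    obtain e' r c where xe: "x = (e', r, c)" by (cases x) auto
    obtain r' where ye: "y = (e', r', c)" using e f xe by (cases y) auto
    have "r \<noteq> r'" using ne xe ye by auto
    then show False using col[of e' r c r'] col[of e' r' c r] x y e(1) xe ye by (cases "r < r'") auto
  qed
  have "\<exists>q. bij_betw q cells {1..card cells} \<and>
      (\<forall>x\<in>cells. \<forall>y\<in>cells. cell_less t x y \<longrightarrow> q x < (q y :: nat))"
  proof (rule ex_rank)
    show "cell_less t x z" if "cell_less t x y" "cell_less t y z" for x y z
      using that unfolding cell_less_def by linarith
  qed (use tot in \<open>simp_all add: cell_less_def\<close>)
  then obtain q where q: "bij_betw q cells {1..card cells}"
      and mono: "\<forall>x\<in>cells. \<forall>y\<in>cells. cell_less t x y \<longrightarrow> q x < q y" by blast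
  have bij: "bij_betw q cells {1..n}" using q card_cells by simp
  have "standard q"
    unfolding standard_def
  proof (intro conjI allI impI bij)
    fix e r and c c' :: nat assume h: "c < c' \<and> (e, r, c) \<in> cells \<and> (e, r, c') \<in> cells"
    then have "cell_less t (e, r, c) (e, r, c')" using row[of e r c c'] unfolding cell_less_def by auto
    then show "q (e, r, c) < q (e, r, c')" using mono h by blast
  next
    fix e c and r r' :: nat assume h: "r < r' \<and> (e, r, c) \<in> cells \<and> (e, r', c) \<in> cells"
    then have "cell_less t (e, r, c) (e, r', c)" using col[of e r c r'] unfolding cell_less_def by auto
    then show "q (e, r, c) < q (e, r', c)" using mono h by blast
  qed
  note std = this
  have lessD: "cell_less t x y" if "x \<in> cells" "y \<in> cells" "q x < q y" for x y
  proof -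
    have "x \<noteq> y" using that by auto
    moreover have "\<not> cell_less t y x" using mono that by (meson less_asym)
    ultimately show ?thesis using tot that by blast
  qed
  define cell where "cell = inv_into cells q"
  have cell: "cell p \<in> cells" "q (cell p) = p" if "1 \<le> p" "p \<le> n" for p
    using that bij unfolding cell_def bij_betw_def by (auto intro: inv_into_into f_inv_into_f)
  have cellq: "cell (q x) = x" if "x \<in> cells" for x
    using that bij unfolding cell_def bij_betw_def by (simp add: inv_into_f_f)
  define xs where "xs = map (\<lambda>p. t (cell p)) [1..<Suc n]"
  have len: "length xs = n" by (simp add: xs_def)
  have nth: "xs ! k = t (cell (Suc k))" if "k < n" for k
    using that by (simp add: xs_def del: upt_Suc)
  have "sorted xs"
    unfolding sorted_iff_nth_mono
  proof (intro allI impI)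
    fix i j assume "i \<le> j" "j < length xs"
    then show "xs ! i \<le> xs ! j"
    proof (cases "i = j")
      case False
      then have ij: "i < j" "j < n" using \<open>i \<le> j\<close> \<open>j < length xs\<close> len by auto
      then have "cell_less t (cell (Suc i)) (cell (Suc j))" using cell by (intro lessD) auto
      then show ?thesis using ij by (auto simp: nth cell_less_def)
    qed simp
  qed
  moreover have "mset xs = mset L"
  proof -
    have "mset xs = image_mset t (image_mset cell (mset_set {1..n}))"
    proof -
      have "mset [1..<Suc n] = mset_set {1..n}" by (metis atLeastLessThanSuc_atLeastAtMost mset_upt)
      then show ?thesis by (simp add: xs_def multiset.map_comp comp_def del: upt_Suc)
    qed
    also have "image_mset cell (mset_set {1..n}) = mset_set cells"
    proof -
      have "cell ` {1..n} = cells" "inj_on cell {1..n}"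
        using bij bij_betw_inv_into[OF bij] unfolding cell_def bij_betw_def by auto
      then show ?thesis by (simp add: image_mset_mset_set)
    qed
    finally show ?thesis using mt by simp
  qed
  ultimately have "xs = L" using L(1) by (metis properties_for_sort)
  then have Lq: "L ! (q x - 1) = t x" if "x \<in> cells" for x
    using nth[of "q x - 1"] standard_range[OF std that] cellq[OF that] by auto
  have "coherent L sg q"
    unfolding coherent_def
  proof (intro conjI ballI impI)
    fix x assume x: "x \<in> cells"
    then show "fst x = sg (L ! (q x - 1))" using Lq sgt by simp
  next
    fix x y assume x: "x \<in> cells" and y: "y \<in> cells" and h: "q y = Suc (q x) \<and> L ! (q x - 1) = L ! (q y - 1)"
    have e: "t x = t y" using h Lq[OF x] Lq[OF y] by simp
    have f: "fst x = fst y" using sgt[OF x] sgt[OF y] e by simp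
    have c: "snd (snd x) < snd (snd y)" using lessD[OF x y] h e unfolding cell_less_def by simp
    obtain e' r c0 where xe: "x = (e', r, c0)" by (cases x) auto
    obtain r' c' where ye: "y = (e', r', c')" using f xe by (cases y) auto
    show "fst (snd y) \<le> fst (snd x)"
    proof (rule ccontr)
      assume "\<not> fst (snd y) \<le> fst (snd x)"
      then have rr: "r < r'" by (simp add: xe ye)
      \<comment> \<open>The cell in the row of \<open>x\<close> and the column of \<open>y\<close>:
        its label would be at least \<open>t x\<close> and strictly below \<open>t y\<close>,
        although these are equal.\<close>
      have m: "(e', r, c') \<in> cells" using y rr cells_down[of e' r' c' r c'] by (simp add: ye)
      have "t x \<le> t (e', r, c')" using row[of e' r c0 c'] m x c by (simp add: xe ye)
      also have "\<dots> < t y" using col[of e' r c' r'] m y rr by (simp add: ye)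
      finally show False using e by simp
    qed
  qed
  then show ?thesis using std Lq by blast
qed

text \<open>Replacing every entry \<open>p\<close> by \<open>L ! (p - 1)\<close> is the bijection:
  \<open>semistandard_label\<close> and \<open>content_label\<close> give its range,
  \<open>coherent_unique\<close> injectivity and \<open>ex_standardization\<close>
  surjectivity.\<close>

lemma card_fits:
  assumes ds: "sum_list (map fst ds) = n"
  shows "card {Q \<in> SYT2 n lam mu. fits (fst (sDes n lam mu Q)) (sign_at Q) 0 ds} =
    card {(P, N). P \<in> SSYT lam \<and> N \<in> SSYT mu \<and>
      image_mset (\<lambda>b. Inl (P b)) (mset_set (diagram lam)) +
      image_mset (\<lambda>b. Inr (N b)) (mset_set (diagram mu)) = content ds}" (is "card ?A = card ?B")
proof -
  define L where "L = labels 0 ds"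
  define sg where "sg j = snd (ds ! j)" for j
  have L: "sorted L" "length L = n" by (simp_all add: L_def sorted_labels length_labels ds)
  have A: "(P, N) \<in> ?A \<longleftrightarrow> P \<in> extensional (diagram lam) \<and> N \<in> extensional (diagram mu) \<and>
      standard (both (P, N)) \<and> coherent L sg (both (P, N))" for P N
    using fits_iff_coherent[OF _ ds] SYT2_iff unfolding L_def sg_def by auto
  have B: "(P, N) \<in> ?B \<longleftrightarrow> P \<in> extensional (diagram lam) \<and> N \<in> extensional (diagram mu) \<and>
      semistandard (both (P, N)) \<and> image_mset (\<lambda>x. var_of (fst x) (both (P, N) x)) (mset_set cells) =
      image_mset (\<lambda>j. var_of (sg j) j) (mset L)" for P N
    using SSYT_iff[of P N] unfolding image_mset_cells content_labels L_def sg_def by auto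
  let ?f = "\<lambda>Q. unboth (\<lambda>x. L ! (both Q x - 1))"
  have "bij_betw ?f ?A ?B"
    unfolding bij_betw_def
  proof
    show "inj_on ?f ?A"
    proof (rule inj_onI)
      fix Q Q' assume Q: "Q \<in> ?A" and Q': "Q' \<in> ?A" and e: "?f Q = ?f Q'"
      obtain P N where PN: "Q = (P, N)" by force
      obtain P' N' where PN': "Q' = (P', N')" by force
      have "L ! (both Q x - 1) = L ! (both Q' x - 1)" if "x \<in> cells" for x
        using both_unboth[OF that, of "\<lambda>x. L ! (both Q x - 1)"]
          both_unboth[OF that, of "\<lambda>x. L ! (both Q' x - 1)"] e by simp
      then have "both Q x = both Q' x" if "x \<in> cells" for x
        using coherent_unique[OF _ _ _ _ L _ that, of "both Q" sg "both Q'"] Q Q' A by (simp add: PN PN')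
      then show "Q = Q'" using both_inj[of P N P' N'] Q Q' A by (simp add: PN PN')
    qed
    show "?f ` ?A = ?B"
    proof (intro equalityI subsetI)
      fix R assume "R \<in> ?f ` ?A"
      then obtain P N where PN: "(P, N) \<in> ?A" "R = ?f (P, N)" by auto
      let ?t = "\<lambda>x. L ! (both (P, N) x - 1)"
      have std: "standard (both (P, N))" and coh: "coherent L sg (both (P, N))" using PN A by auto
      obtain X Y where XY: "R = (X, Y)" by force
      have XYe: "both (X, Y) x = ?t x" if "x \<in> cells" for x
        using both_unboth[OF that, of ?t] PN(2) XY by simp
      have "semistandard (both (X, Y))"
        by (rule semistandard_cong[OF semistandard_label[OF std coh L]]) (simp add: XYe)
      moreover have "image_mset (\<lambda>x. var_of (fst x) (both (X, Y) x)) (mset_set cells) =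
          image_mset (\<lambda>j. var_of (sg j) j) (mset L)"
        unfolding content_label[OF std coh L(2), symmetric] by (intro image_mset_cong) (simp add: XYe)
      moreover have "X \<in> extensional (diagram lam)" "Y \<in> extensional (diagram mu)"
        using unboth_extensional[of ?t] PN(2) XY by (metis fst_conv, metis snd_conv)
      ultimately show "R \<in> ?B" using B XY by blast
    next
      fix R assume R: "R \<in> ?B"
      obtain X Y where XY: "R = (X, Y)" by force
      have R': "X \<in> extensional (diagram lam)" "Y \<in> extensional (diagram mu)"
        "semistandard (both (X, Y))" "image_mset (\<lambda>x. var_of (fst x) (both (X, Y) x)) (mset_set cells) =
          image_mset (\<lambda>j. var_of (sg j) j) (mset L)"
        using R B[of X Y] unfolding XY by blast+
      obtain q where q: "standard q" "coherent L sg q" "\<forall>x\<in>cells. L ! (q x - 1) = both (X, Y) x"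
        using ex_standardization[OF R'(3) L R'(4)] by blast
      obtain P N where PN: "unboth q = (P, N)" by force
      have e: "both (P, N) x = q x" if "x \<in> cells" for x using both_unboth[OF that, of q] PN by simp
      have "standard (both (P, N))" by (rule standard_cong[OF q(1)]) (simp add: e)
      moreover have "coherent L sg (both (P, N))"
        using q(2) unfolding coherent_def by (simp add: e cong: ball_cong)
      ultimately have "(P, N) \<in> ?A" using A[of P N] unboth_extensional[of q] PN by simp
      moreover have "R = ?f (P, N)"
      proof -
        obtain X' Y' where XY': "?f (P, N) = (X', Y')" by force
        have "both (X', Y') x = both (X, Y) x" if "x \<in> cells" for x
          using both_unboth[OF that, of "\<lambda>x. L ! (both (P, N) x - 1)"] XY' e[OF that] q(3) that by simp
        then show ?thesis
          using both_inj[of X' Y' X Y] R' unboth_extensional[of "\<lambda>x. L ! (both (P, N) x - 1)"] XY XY' by simp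
      qed
      ultimately show "R \<in> ?f ` ?A" by blast
    qed
  qed
  then show ?thesis by (rule bij_betw_same_card)
qed

end

section \<open>Coefficients of Schur products and assembly of the theorem\<close>

lemma finite_SSYT_content:
  assumes "inj v"
  shows "finite {T \<in> SSYT l. image_mset (\<lambda>b. v (T b)) (mset_set (diagram l)) = M}"
proof (rule finite_subset)
  show "{T \<in> SSYT l. image_mset (\<lambda>b. v (T b)) (mset_set (diagram l)) = M} \<subseteq>
    diagram l \<rightarrow>\<^sub>E v -` set_mset M"
    by (auto simp: SSYT_def PiE_def)
  show "finite (diagram l \<rightarrow>\<^sub>E v -` set_mset M)"
    using assms by (intro finite_PiE finite_vimageI) auto
qed

lemma mcoeff_schur_times:
  "mcoeff (schur Inl l * schur Inr m) M = of_nat (card {(P, N). P \<in> SSYT l \<and> N \<in> SSYT m \<and>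
      image_mset (\<lambda>b. Inl (P b)) (mset_set (diagram l)) +
      image_mset (\<lambda>b. Inr (N b)) (mset_set (diagram m)) = M})"
proof -
  let ?X = "\<lambda>A. {P \<in> SSYT l. image_mset (\<lambda>b. Inl (P b)) (mset_set (diagram l)) = A}"
  let ?Y = "\<lambda>A. {N \<in> SSYT m. image_mset (\<lambda>b. Inr (N b)) (mset_set (diagram m)) = A}"
  have fX: "finite (?X A)" for A using finite_SSYT_content[of Inl l A] by simp
  have fY: "finite (?Y A)" for A using finite_SSYT_content[of Inr m A] by simp
  have "{(P, N). P \<in> SSYT l \<and> N \<in> SSYT m \<and> image_mset (\<lambda>b. Inl (P b)) (mset_set (diagram l)) +
      image_mset (\<lambda>b. Inr (N b)) (mset_set (diagram m)) = M} = (\<Union>A\<in>{A. A \<subseteq># M}. ?X A \<times> ?Y (M - A))"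
  proof (intro equalityI subsetI)
    fix R assume "R \<in> (\<Union>A\<in>{A. A \<subseteq># M}. ?X A \<times> ?Y (M - A))"
    then show "R \<in> {(P, N). P \<in> SSYT l \<and> N \<in> SSYT m \<and> image_mset (\<lambda>b. Inl (P b)) (mset_set (diagram l)) +
      image_mset (\<lambda>b. Inr (N b)) (mset_set (diagram m)) = M}"
      by (auto simp: subset_mset.add_diff_inverse)
  qed auto
  also have "card \<dots> = (\<Sum>A\<in>{A. A \<subseteq># M}. card (?X A \<times> ?Y (M - A)))"
    using fX fY by (intro card_UN_disjoint) (auto intro!: finite_cartesian_product)
  finally show ?thesis
    unfolding mcoeff_times schur_def by (simp add: Abs_mfps_inverse card_cartesian_product)
qed

context bishape
begin

lemma finite_SYT2: "finite (SYT2 n lam mu)"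
proof (rule finite_subset)
  show "SYT2 n lam mu \<subseteq> (diagram lam \<rightarrow>\<^sub>E {1..n}) \<times> (diagram mu \<rightarrow>\<^sub>E {1..n})"
    by (auto simp: SYT2_def PiE_def)
qed (intro finite_cartesian_product finite_PiE; simp)

text \<open>Every change of sign is a descent, so the sign stays constant from \<open>j\<close> up
  to the next element of the descent set.\<close>

lemma sign_vector_sDes:
  assumes n: "1 \<le> n" and Q: "Q \<in> SYT2 n lam mu" and j: "1 \<le> j" "j \<le> n"
  shows "sign_vector (sDes n lam mu Q) j = sign_at Q j"
proof -
  obtain P N where PN: "Q = (P, N)" by force
  have std: "standard (both Q)" using Q SYT2_iff by (simp add: PN)
  define S where "S = fst (sDes n lam mu Q)"
  define s where "s = (LEAST s. s \<in> S \<and> s \<ge> j)"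
  have nS: "n \<in> S" by (simp add: S_def PN sDes_def Let_def)
  have s: "s \<in> S" "j \<le> s" "s \<le> n"
    using LeastI[of "\<lambda>s. s \<in> S \<and> s \<ge> j" n] Least_le[of "\<lambda>s. s \<in> S \<and> s \<ge> j" n] nS j
    by (simp_all add: s_def)
  have before: "p \<notin> S" if "j \<le> p" "p < s" for p
    using not_less_Least[of p "\<lambda>s. s \<in> S \<and> s \<ge> j"] that by (auto simp: s_def)
  have const: "sign_at Q p = sign_at Q j" if "j \<le> p" "p \<le> s" for p
    using that
  proof (induction p rule: dec_induct)
    case (step p)
    obtain x where x: "x \<in> cells" "both Q x = p" using standard_surj[OF std, of p] step j s by auto
    obtain y where y: "y \<in> cells" "both Q y = Suc p" using standard_surj[OF std, of "Suc p"] step j s by auto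
    have "p \<notin> S" using before step by simp
    then have "fst x = fst y" using descent_iff[OF std x(1) y(1)] x y by (simp add: S_def)
    then have "sign_at Q (Suc p) = sign_at Q p"
      using sign_at_both[OF std x(1)] sign_at_both[OF std y(1)] x y by simp
    then show ?case using step by simp
  qed simp
  have "sign_at Q s = sign_at Q j" using s by (intro const) simp_all
  moreover have "sign_vector (sDes n lam mu Q) j = sign_at Q s"
  proof -
    have "sign_vector (sDes n lam mu Q) j = snd (sDes n lam mu Q) s"
      by (simp add: sign_vector_def case_prod_beta s_def S_def)
    also have "\<dots> = sign_at Q s"
      using s(1) unfolding S_def PN sDes_def Let_def by (simp add: sign_at_def)
    finally show ?thesis .
  qed
  ultimately show ?thesis by simp
qed

end

lemma fits_cong:
  assumes "\<And>p. off < p \<Longrightarrow> p \<le> off + sum_list (map fst ds) \<Longrightarrow> \<sigma> p = \<sigma>' p"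
  shows "fits S \<sigma> off ds \<longleftrightarrow> fits S \<sigma>' off ds"
  unfolding fits_labels[where i = 0] using assms by (simp add: length_labels)

text \<open>Refining preserves the total size, so \<open>F\<close> is evaluated only at lists of one
  size. This is needed because \<open>card_fits\<close> holds for lists of size
  \<open>n\<close>.\<close>

lemma refine_sum_cong:
  assumes "\<And>ds. sum_list (map fst ds) = sum_list (map fst acc) + sum_list (map fst \<gamma>) \<Longrightarrow> F ds = G ds"
  shows "refine_sum \<gamma> acc F = refine_sum \<gamma> acc G"
  using assms
proof (induction \<gamma> arbitrary: acc)
  case (Cons g \<gamma>)
  obtain k b where g: "g = (k, b)" by force
  have "refine_sum \<gamma> (acc @ map (\<lambda>x. (x, e)) d) F = refine_sum \<gamma> (acc @ map (\<lambda>x. (x, e)) d) G"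
    if "d \<in> comps k" for e d
    by (rule Cons.IH, rule Cons.prems) (use that in \<open>simp add: g comps_def comp_def\<close>)
  then show ?case by (simp add: g)
qed simp

theorem theorem4p1:
  fixes n :: nat and lam mu \<alpha> \<beta> :: "nat list" and \<gamma> :: signed_comp
    and \<chi> :: "(int \<Rightarrow> int) \<Rightarrow> complex" and w :: "int \<Rightarrow> int"
  assumes "n \<ge> 1"
    and "is_bipartition n lam mu"
    and "is_bipartition n \<alpha> \<beta>"
    and "irreducible_character (hyperoct n) \<chi>"
    and "frob_char n \<chi> = schur Inl lam * schur Inr mu"
    and "w \<in> carrier (hyperoct n)"
    and "pos_cycle_type n w = mset \<alpha>"
    and "neg_cycle_type n w = mset \<beta>"
    and "mset \<gamma> = mset (map (\<lambda>a. (a, False)) \<alpha> @ map (\<lambda>b. (b, True)) \<beta>)"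
  shows "\<chi> w = of_int (\<Sum>Q\<in>SYT2 n lam mu. wt \<gamma> (sDes n lam mu Q))"
proof -
  interpret bishape n lam mu by standard fact
  let ?S = "\<lambda>Q. fst (sDes n lam mu Q)" and ?\<sigma> = "\<lambda>Q. sign_vector (sDes n lam mu Q)"
  have set\<gamma>: "set \<gamma> = (\<lambda>a. (a, False)) ` set \<alpha> \<union> (\<lambda>b. (b, True)) ` set \<beta>"
    using mset_eq_setD[OF assms(9)] by simp
  have pos: "\<forall>g\<in>set \<gamma>. 0 < fst g"
    using assms(3) unfolding set\<gamma> is_bipartition_def is_partition_def by (auto intro!: gr0I)
  have "mset (map fst \<gamma>) = mset (\<alpha> @ \<beta>)"
    using arg_cong[OF assms(9), of "image_mset fst"] by (simp add: multiset.map_comp comp_def)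
  then have sum\<gamma>: "sum_list (map fst \<gamma>) = n"
    using assms(3) by (metis is_bipartition_def sum_list_append sum_mset_sum_list)
  have "\<chi> w = refine_sum \<gamma> [] (\<lambda>ds. mcoeff (frob_char n \<chi>) (content ds))"
    using assms(7-9) by (intro refine_sum_frob_char[OF assms(4,6), symmetric]) simp
  \<comment> \<open>Monomial coefficients of the Schur product become a sum of indicators over
    bitableaux; the factor 1 matches the shape of \<open>refine_sum_sum\<close>.\<close>
  also have "\<dots> = refine_sum \<gamma> [] (\<lambda>ds. \<Sum>Q\<in>SYT2 n lam mu. 1 * of_bool (fits (?S Q) (?\<sigma> Q) 0 ds))"
  proof (rule refine_sum_cong)
    fix ds :: "(nat \<times> sign) list"
    assume "sum_list (map fst ds) = sum_list (map fst ([] :: (nat \<times> sign) list)) + sum_list (map fst \<gamma>)"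
    then have ds: "sum_list (map fst ds) = n" using sum\<gamma> by simp
    have "mcoeff (frob_char n \<chi>) (content ds) =
        of_nat (card {Q \<in> SYT2 n lam mu. fits (?S Q) (sign_at Q) 0 ds})"
      unfolding assms(5) mcoeff_schur_times card_fits[OF ds] ..
    \<comment> \<open>\<open>card_fits\<close> takes signs from the cells while \<open>wt\<close>
      takes them from the sign vector; they agree on the positions 1 to \<open>n\<close>, which are
      all that \<open>fits\<close> inspects.\<close>
    also have "{Q \<in> SYT2 n lam mu. fits (?S Q) (sign_at Q) 0 ds} =
        {Q \<in> SYT2 n lam mu. fits (?S Q) (?\<sigma> Q) 0 ds}"
    proof (rule Collect_cong, rule conj_cong[OF refl], rule fits_cong)
      fix Q p assume "Q \<in> SYT2 n lam mu" "0 < p" "p \<le> 0 + sum_list (map fst ds)"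
      then show "sign_at Q p = ?\<sigma> Q p" using sign_vector_sDes[OF assms(1)] ds by simp
    qed
    also have "of_nat (card \<dots>) = (\<Sum>Q\<in>SYT2 n lam mu. 1 * of_bool (fits (?S Q) (?\<sigma> Q) 0 ds) :: complex)"
      using finite_SYT2 by (simp add: Collect_conj_eq)
    finally show "mcoeff (frob_char n \<chi>) (content ds) =
        (\<Sum>Q\<in>SYT2 n lam mu. 1 * of_bool (fits (?S Q) (?\<sigma> Q) 0 ds))" .
  qed
  also have "\<dots> = (\<Sum>Q\<in>SYT2 n lam mu. 1 * refine_sum \<gamma> [] (\<lambda>ds. of_bool (fits (?S Q) (?\<sigma> Q) 0 ds)))"
    by (rule refine_sum_sum)
  also have "\<dots> = (\<Sum>Q\<in>SYT2 n lam mu. of_int (wt \<gamma> (sDes n lam mu Q)))"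
  proof (rule sum.cong[OF refl])
    fix Q assume "Q \<in> SYT2 n lam mu"
    have "?S Q \<subseteq> {1..n}" using assms(1) by (cases Q) (auto simp: sDes_def Let_def)
    moreover have "psum \<gamma> (length \<gamma>) = n" using sum\<gamma> by (simp add: psum_def)
    ultimately have "wt \<gamma> (sDes n lam mu Q) = block_prod (?S Q) (?\<sigma> Q) 0 \<gamma>"
      by (intro wt_eq_block_prod) simp
    then show "1 * refine_sum \<gamma> [] (\<lambda>ds. of_bool (fits (?S Q) (?\<sigma> Q) 0 ds)) =
        of_int (wt \<gamma> (sDes n lam mu Q))"
      using refine_sum_fits[OF pos, of "[]"] by simp
  qed
  finally show ?thesis by simp
qed

end
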